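(* Let $l\in\mathbb N$. For all $i\in\mathbb Z$ the spaces $\overline{\mathbb C[SU_{2,q}]^{(i)}}$ are projective modules over the $C^*$-algebra $C(\mathbb{WP}_{1,l,q})$, and every element of the even K-theory group $K_0(C(\mathbb{WP}_{1,l,q}))$ can be realized by applying the group structure of $K_0$ to these modules, i.e. every element of $K_0(C(\mathbb{WP}_{1,l,q}))$ is a finite $\mathbb Z$-linear combination of the classes of the modules $\overline{\mathbb C[SU_{2,q}]^{(i)}}$, $i\in\mathbb Z$.
   Context: Fix $q\in(0,1)$ and $l\in\mathbb N=\{1,2,\dots\}$; $\mathbb N_0=\{0,1,2,\dots\}$. $\mathbb C[SU_{2,q}]$ is the unital complex $*$-algebra generated by $\alpha,\beta$ with relations $\beta\alpha=q\alpha\beta$, $\beta^*\alpha=q\alpha\beta^*$, $\beta\beta^*=\beta^*\beta$, $\alpha\alpha^*+\beta\beta^*=1$, $\alpha^*\alpha+q^2\beta^*\beta=1$. Let $B=\mathbb C[u,u^{-1}]$ be the Hopf $*$-algebra in which $u$ is grouplike and unitary, and let $\theta:\mathbb C[SU_{2,q}]\to\mathbb C[SU_{2,q}]\otimes B$ be the $*$-homomorphism with $\alpha\mapsto\alpha\otimes u^{-1}$, $\beta\mapsto\beta\otimes u^{l}$ (this is the case $k=1$). For $i\in\mathbb Z$ let $\mathbb C[SU_{2,q}]^{(i)}=\{t:\theta(t)=t\otimes u^i\}$; then $\mathbb C[\mathbb{WP}_{1,l,q}]:=\mathbb C[SU_{2,q}]^{(0)}$, which is the $*$-subalgebra generated by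 $\beta\beta^*$ and $\beta\alpha^l$. Let $\varpi$ be the faithful $*$-representation of $\mathbb C[SU_{2,q}]$ on $l^2(\mathbb Z)\otimes l^2(\mathbb N_0)$ given on basis vectors by $\varpi(\alpha)(e_r\otimes e_n)=\sqrt{1-q^{2(n+1)}}\,e_r\otimes e_{n+1}$ and $\varpi(\beta)(e_r\otimes e_n)=q^n e_{r+1}\otimes e_n$. Identify $l^2(\mathbb N_0)$ with $\bigoplus_{s=1}^l l^2(\mathbb N_0)$ by $e_{lp+s-1}\mapsto e^s_p$ ($p\in\mathbb N_0$, $1\le s\le l$), where $\{e^s_p\}_p$ is the basis of the $s$-th copy. For $m\in\mathbb Z$ let $\mathcal X_m$ be the closed span of the $e_{p+m}\otimes e^s_p$ ($p\ge0$, $1\le s\le l$), identified with $\bigoplus_{s=1}^l l^2(\mathbb N_0)$ by $e_{p+m}\otimes e^s_p\mapsto e^s_p$. The operators in $\varpi(\mathbb C[\mathbb{WP}_{1,l,q}])$ preserve each $\mathcal X_m$ and act on it by an operator in $\mathcal B(\bigoplus_{s=1}^l l^2(\mathbb N_0))$ independent of $m$; $C(\mathbb{WP}_{1,l,q})$ is the operator norm completion of this algebra of operators. It equals $(\bigoplus_{s=1}^l\mathcal K)^+=\bigoplus_{s=1}^l\mathcal K+\mathbb C1$, where $\mathcal K$ is the algebra of compact operators on $l^2(\mathbb N_0)$ and $+$ denotes unitization. $\overline{\mathbb C[SU_{2,q}]^{(i)}}$ denotes the operator norm completion of $\varpi(\mathbb C[SU_{2,q}]^{(i)})$, a left module over $C(\mathbb{WP}_{1,l,q})$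 (identified with the norm closure of $\varpi(\mathbb C[\mathbb{WP}_{1,l,q}])$) under the operator product. *)

theory Defs
  imports
    "HOL-Analysis.Analysis"
    "HOL-Algebra.Module"
    "HOL-Algebra.QuotRing"
    "HOL-Algebra.Multiplicative_Group"
begin

section \<open>Complex *-algebras presented by generators and relations\<close>

record 'a star_algebra = "(complex, 'a) module" +
  star :: "'a \<Rightarrow> 'a"

text \<open>
  The free unital complex *-algebra on a type of generators: finitely supported complex functions
  on words in the letters \<open>(g, False)\<close>, standing for \<open>g\<close>, and \<open>(g, True)\<close>, standing for \<open>g\<^sup>*\<close>.
\<close>

definition free_star_algebra :: "(('g \<times> bool) list \<Rightarrow> complex) star_algebra" where
  "free_star_algebra = \<lparr>
     carrier = {f. finite {w. f w \<noteq> 0}},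
     mult = (\<lambda>f g w. \<Sum>k\<le>length w. f (take k w) * g (drop k w)),
     one = (\<lambda>w. if w = [] then 1 else 0),
     zero = (\<lambda>w. 0),
     add = (\<lambda>f g w. f w + g w),
     smult = (\<lambda>c f w. c * f w),
     star = (\<lambda>f w. cnj (f (rev (map (\<lambda>(g, s). (g, \<not> s)) w))))\<rparr>"

definition free_gen :: "'g \<Rightarrow> ('g \<times> bool) list \<Rightarrow> complex" where
  "free_gen g = (\<lambda>w. if w = [(g, False)] then 1 else 0)"

definition star_ideal :: "('a, 'm) star_algebra_scheme \<Rightarrow> 'a set \<Rightarrow> 'a set" where
  "star_ideal S X = genideal S (X \<union> star S ` X)"

definition quot_star_algebra ::
    "('a, 'm) star_algebra_scheme \<Rightarrow> 'a set \<Rightarrow> 'a set star_algebra" where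
  "quot_star_algebra S I = \<lparr>
     carrier = carrier (S Quot I),
     mult = mult (S Quot I),
     one = one (S Quot I),
     zero = zero (S Quot I),
     add = add (S Quot I),
     smult = (\<lambda>c X. \<Union>x\<in>X. I +>\<^bsub>S\<^esub> (c \<odot>\<^bsub>S\<^esub> x)),
     star = (\<lambda>X. \<Union>x\<in>X. I +>\<^bsub>S\<^esub> star S x)\<rparr>"

fun letter_eval :: "('a, 'm) star_algebra_scheme \<Rightarrow> ('g \<Rightarrow> 'a) \<Rightarrow> 'g \<times> bool \<Rightarrow> 'a" where
  "letter_eval S x (g, s) = (if s then star S (x g) else x g)"

definition free_eval ::
    "('a, 'm) star_algebra_scheme \<Rightarrow> ('g \<Rightarrow> 'a) \<Rightarrow> (('g \<times> bool) list \<Rightarrow> complex) \<Rightarrow> 'a" where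
  "free_eval S x f =
     (\<Oplus>\<^bsub>S\<^esub>w\<in>{w. f w \<noteq> 0}. f w \<odot>\<^bsub>S\<^esub> foldr (\<lambda>a y. letter_eval S x a \<otimes>\<^bsub>S\<^esub> y) w \<one>\<^bsub>S\<^esub>)"

text \<open>
  The *-homomorphism on a quotient of the free *-algebra determined by the images \<open>x\<close> of the
  generators: evaluation is constant on cosets as soon as \<open>x\<close> satisfies the defining relations.
\<close>

definition induced_hom ::
    "('a, 'm) star_algebra_scheme \<Rightarrow> ('g \<Rightarrow> 'a) \<Rightarrow> (('g \<times> bool) list \<Rightarrow> complex) set \<Rightarrow> 'a" where
  "induced_hom S x X = the_elem (free_eval S x ` X)"


section \<open>The algebra of quantum SU(2) and its grading\<close>

datatype su2_gen = Alpha | Beta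

definition SU2_relations :: "real \<Rightarrow> ((su2_gen \<times> bool) list \<Rightarrow> complex) set" where
  "SU2_relations q =
    (let F = (free_star_algebra :: ((su2_gen \<times> bool) list \<Rightarrow> complex) star_algebra);
         a = free_gen Alpha; b = free_gen Beta; a' = star F a; b' = star F b;
         c = complex_of_real q
     in {(b \<otimes>\<^bsub>F\<^esub> a) \<ominus>\<^bsub>F\<^esub> (c \<odot>\<^bsub>F\<^esub> (a \<otimes>\<^bsub>F\<^esub> b)),
         (b' \<otimes>\<^bsub>F\<^esub> a) \<ominus>\<^bsub>F\<^esub> (c \<odot>\<^bsub>F\<^esub> (a \<otimes>\<^bsub>F\<^esub> b')),
         (b \<otimes>\<^bsub>F\<^esub> b') \<ominus>\<^bsub>F\<^esub> (b' \<otimes>\<^bsub>F\<^esub> b),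
         ((a \<otimes>\<^bsub>F\<^esub> a') \<oplus>\<^bsub>F\<^esub> (b \<otimes>\<^bsub>F\<^esub> b')) \<ominus>\<^bsub>F\<^esub> \<one>\<^bsub>F\<^esub>,
         ((a' \<otimes>\<^bsub>F\<^esub> a) \<oplus>\<^bsub>F\<^esub> (c\<^sup>2 \<odot>\<^bsub>F\<^esub> (b' \<otimes>\<^bsub>F\<^esub> b))) \<ominus>\<^bsub>F\<^esub> \<one>\<^bsub>F\<^esub>})"

definition SU2 :: "real \<Rightarrow> ((su2_gen \<times> bool) list \<Rightarrow> complex) set star_algebra" where
  "SU2 q = quot_star_algebra free_star_algebra (star_ideal free_star_algebra (SU2_relations q))"

definition SU2_gen :: "real \<Rightarrow> su2_gen \<Rightarrow> ((su2_gen \<times> bool) list \<Rightarrow> complex) set" where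
  "SU2_gen q g = star_ideal free_star_algebra (SU2_relations q) +>\<^bsub>free_star_algebra\<^esub> free_gen g"

text \<open>
  \<open>S \<otimes> \<complex>[u, u\<^sup>-\<^sup>1]\<close> with \<open>u\<close> unitary. As \<open>(u\<^sup>j)\<^sub>j\<close> is a basis of the second factor, an element
  \<open>\<Sum>\<^sub>j t\<^sub>j \<otimes> u\<^sup>j\<close> is the finitely supported function \<open>j \<mapsto> t\<^sub>j\<close>; \<open>tensor_u S t j\<close> is \<open>t \<otimes> u\<^sup>j\<close>.
\<close>

definition laurent_tensor :: "('a, 'm) star_algebra_scheme \<Rightarrow> (int \<Rightarrow> 'a) star_algebra" where
  "laurent_tensor S = \<lparr>
     carrier = {t. range t \<subseteq> carrier S \<and> finite {j. t j \<noteq> \<zero>\<^bsub>S\<^esub>}},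
     mult = (\<lambda>t t' j. \<Oplus>\<^bsub>S\<^esub>k\<in>{k. t k \<noteq> \<zero>\<^bsub>S\<^esub>}. t k \<otimes>\<^bsub>S\<^esub> t' (j - k)),
     one = (\<lambda>j. if j = 0 then \<one>\<^bsub>S\<^esub> else \<zero>\<^bsub>S\<^esub>),
     zero = (\<lambda>j. \<zero>\<^bsub>S\<^esub>),
     add = (\<lambda>t t' j. t j \<oplus>\<^bsub>S\<^esub> t' j),
     smult = (\<lambda>c t j. c \<odot>\<^bsub>S\<^esub> t j),
     star = (\<lambda>t j. star S (t (- j)))\<rparr>"

definition tensor_u :: "('a, 'm) star_algebra_scheme \<Rightarrow> 'a \<Rightarrow> int \<Rightarrow> int \<Rightarrow> 'a" where
  "tensor_u S t j = (\<lambda>k. if k = j then t else \<zero>\<^bsub>S\<^esub>)"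

definition coaction :: "real \<Rightarrow> nat \<Rightarrow> ((su2_gen \<times> bool) list \<Rightarrow> complex) set
    \<Rightarrow> int \<Rightarrow> ((su2_gen \<times> bool) list \<Rightarrow> complex) set" where
  "coaction q l = induced_hom (laurent_tensor (SU2 q))
     (\<lambda>g. case g of Alpha \<Rightarrow> tensor_u (SU2 q) (SU2_gen q Alpha) (- 1)
                  | Beta \<Rightarrow> tensor_u (SU2 q) (SU2_gen q Beta) (int l))"

definition SU2_degree :: "real \<Rightarrow> nat \<Rightarrow> int \<Rightarrow> ((su2_gen \<times> bool) list \<Rightarrow> complex) set set" where
  "SU2_degree q l i = {t \<in> carrier (SU2 q). coaction q l t = tensor_u (SU2 q) t i}"

abbreviation WP :: "real \<Rightarrow> nat \<Rightarrow> ((su2_gen \<times> bool) list \<Rightarrow> complex) set set" where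
  "WP q l \<equiv> SU2_degree q l 0"


section \<open>Square-summable families and bounded operators on them\<close>

lemma square_summable_mult:
  fixes f g :: "'i \<Rightarrow> complex"
  assumes "(\<lambda>i. (cmod (f i))\<^sup>2) summable_on UNIV" "(\<lambda>i. (cmod (g i))\<^sup>2) summable_on UNIV"
  shows "(\<lambda>i. cnj (f i) * g i) summable_on UNIV"
proof -
  have "(\<lambda>i. (cmod (f i))\<^sup>2 + (cmod (g i))\<^sup>2) summable_on UNIV"
    using assms by (rule summable_on_add)
  moreover have "norm (cnj (f i) * g i) \<le> (cmod (f i))\<^sup>2 + (cmod (g i))\<^sup>2" for i
  proof -
    have "norm (cnj (f i) * g i) = cmod (f i) * cmod (g i)"
      by (simp add: norm_mult)
    moreover have "0 \<le> cmod (f i) * cmod (g i)"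
      by simp
    ultimately show ?thesis
      using sum_squares_bound[of "cmod (f i)" "cmod (g i)"] by linarith
  qed
  ultimately have "(\<lambda>i. norm (cnj (f i) * g i)) summable_on UNIV"
    by (rule summable_on_comparison_test) auto
  then show ?thesis
    by (rule abs_summable_summable)
qed

typedef 'i ell2 = "{f :: 'i \<Rightarrow> complex. (\<lambda>i. (cmod (f i))\<^sup>2) summable_on UNIV}"
  morphisms ell2_coord Abs_ell2
  by (rule exI[of _ "\<lambda>_. 0"]) simp

setup_lifting type_definition_ell2

lift_definition scaleC_ell2 :: "complex \<Rightarrow> 'i ell2 \<Rightarrow> 'i ell2" is "\<lambda>c f i. c * f i"
  by (simp add: norm_mult power_mult_distrib summable_on_cmult_right)

definition cinner_ell2 :: "'i ell2 \<Rightarrow> 'i ell2 \<Rightarrow> complex" where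
  "cinner_ell2 x y = (\<Sum>\<^sub>\<infinity>i. cnj (ell2_coord x i) * ell2_coord y i)"

lift_definition ket :: "'i \<Rightarrow> 'i ell2" is "\<lambda>i j. if j = i then 1 else 0"
proof -
  fix i :: 'i
  have "(\<lambda>j. (cmod (if j = i then 1 else 0))\<^sup>2) summable_on {i}"
    by (simp add: summable_on_finite)
  then show "(\<lambda>j. (cmod (if j = i then 1 else 0))\<^sup>2) summable_on UNIV"
    by (rule summable_on_cong_neutral[THEN iffD1, rotated -1]) auto
qed

instantiation ell2 :: (type) real_inner
begin

lift_definition zero_ell2 :: "'a ell2" is "\<lambda>_. 0"
  by simp

lift_definition plus_ell2 :: "'a ell2 \<Rightarrow> 'a ell2 \<Rightarrow> 'a ell2" is "\<lambda>f g i. f i + g i"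
proof -
  fix f g :: "'a \<Rightarrow> complex"
  assume *: "(\<lambda>i. (cmod (f i))\<^sup>2) summable_on UNIV" "(\<lambda>i. (cmod (g i))\<^sup>2) summable_on UNIV"
  have "(\<lambda>i. 2 * (cmod (f i))\<^sup>2 + 2 * (cmod (g i))\<^sup>2) summable_on UNIV"
    using * by (intro summable_on_add summable_on_cmult_right)
  then show "(\<lambda>i. (cmod (f i + g i))\<^sup>2) summable_on UNIV"
  proof (rule summable_on_comparison_test)
    fix i
    have "(cmod (f i + g i))\<^sup>2 \<le> (cmod (f i) + cmod (g i))\<^sup>2"
      by (intro power_mono norm_triangle_ineq) auto
    also have "\<dots> \<le> 2 * (cmod (f i))\<^sup>2 + 2 * (cmod (g i))\<^sup>2"
      using sum_squares_bound[of "cmod (f i)" "cmod (g i)"] by (simp add: power2_sum)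
    finally show "(cmod (f i + g i))\<^sup>2 \<le> 2 * (cmod (f i))\<^sup>2 + 2 * (cmod (g i))\<^sup>2" .
  qed simp
qed

lift_definition uminus_ell2 :: "'a ell2 \<Rightarrow> 'a ell2" is "\<lambda>f i. - f i"
  by simp

definition minus_ell2 :: "'a ell2 \<Rightarrow> 'a ell2 \<Rightarrow> 'a ell2" where
  "minus_ell2 x y = x + - y"

definition scaleR_ell2 :: "real \<Rightarrow> 'a ell2 \<Rightarrow> 'a ell2" where
  "scaleR_ell2 r x = scaleC_ell2 (complex_of_real r) x"

definition inner_ell2 :: "'a ell2 \<Rightarrow> 'a ell2 \<Rightarrow> real" where
  "inner_ell2 x y = Re (cinner_ell2 x y)"

definition norm_ell2 :: "'a ell2 \<Rightarrow> real" where
  "norm_ell2 x = sqrt (inner x x)"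

definition dist_ell2 :: "'a ell2 \<Rightarrow> 'a ell2 \<Rightarrow> real" where
  "dist_ell2 x y = norm (x - y)"

definition sgn_ell2 :: "'a ell2 \<Rightarrow> 'a ell2" where
  "sgn_ell2 x = inverse (norm x) *\<^sub>R x"

definition uniformity_ell2 :: "('a ell2 \<times> 'a ell2) filter" where
  "uniformity_ell2 = (INF e\<in>{0<..}. principal {(x, y). dist x y < e})"

definition open_ell2 :: "'a ell2 set \<Rightarrow> bool" where
  "open_ell2 U \<longleftrightarrow> (\<forall>x\<in>U. eventually (\<lambda>(x', y). x' = x \<longrightarrow> y \<in> U) uniformity)"

instance
proof
  fix x y z :: "'a ell2" and r s :: real
  note coord_simps = plus_ell2.rep_eq uminus_ell2.rep_eq zero_ell2.rep_eq scaleC_ell2.rep_eq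
  have summ: "(\<lambda>i. cnj (ell2_coord x i) * ell2_coord y i) summable_on UNIV" for x y :: "'a ell2"
    using ell2_coord[of x] ell2_coord[of y] by (intro square_summable_mult) auto
  have inner_self: "inner x x = (\<Sum>\<^sub>\<infinity>i. (cmod (ell2_coord x i))\<^sup>2)"
    using infsum_Re[OF summ[of x x]]
    by (simp add: inner_ell2_def cinner_ell2_def cmod_def power2_eq_square)
  show "x + y + z = x + (y + z)" "x + y = y + x" "0 + x = x" "- x + x = 0" "x - y = x + - y"
    unfolding minus_ell2_def by (transfer, simp add: add_ac)+
  show "r *\<^sub>R (x + y) = r *\<^sub>R x + r *\<^sub>R y" "(r + s) *\<^sub>R x = r *\<^sub>R x + s *\<^sub>R x"
    "r *\<^sub>R s *\<^sub>R x = (r * s) *\<^sub>R x" "1 *\<^sub>R x = x"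
    unfolding scaleR_ell2_def by (transfer, simp add: algebra_simps)+
  show "dist x y = norm (x - y)" "sgn x = inverse (norm x) *\<^sub>R x"
    "(uniformity :: ('a ell2 \<times> 'a ell2) filter) = (INF e\<in>{0<..}. principal {(x, y). dist x y < e})"
    "norm x = sqrt (inner x x)"
    by (simp_all add: dist_ell2_def sgn_ell2_def uniformity_ell2_def norm_ell2_def)
  show "open U \<longleftrightarrow> (\<forall>x\<in>U. \<forall>\<^sub>F (x', y) in uniformity. x' = x \<longrightarrow> y \<in> U)" for U :: "'a ell2 set"
    by (simp add: open_ell2_def)
  show "inner x y = inner y x"
    using infsum_Re[OF summ[of x y]] infsum_Re[OF summ[of y x]]
    by (simp add: inner_ell2_def cinner_ell2_def mult.commute)
  show "inner (x + y) z = inner x z + inner y z"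
    using infsum_add[OF summ[of x z] summ[of y z]]
    by (simp add: inner_ell2_def cinner_ell2_def coord_simps algebra_simps)
  show "inner (r *\<^sub>R x) y = r * inner x y"
    using infsum_cmult_right[OF summ[of x y], of "complex_of_real r"]
    by (simp add: inner_ell2_def cinner_ell2_def coord_simps scaleR_ell2_def mult.assoc)
  show "0 \<le> inner x x"
    unfolding inner_self by (intro infsum_nonneg) auto
  show "inner x x = 0 \<longleftrightarrow> x = 0"
  proof
    assume "inner x x = 0"
    then have "(cmod (ell2_coord x i))\<^sup>2 = 0" for i
      using nonneg_infsum_le_0D[of "\<lambda>i. (cmod (ell2_coord x i))\<^sup>2" UNIV i] ell2_coord[of x]
      by (simp add: inner_self)
    then have "ell2_coord x = (\<lambda>i. 0)"
      by (simp add: fun_eq_iff)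
    then show "x = 0"
      by transfer (simp add: fun_eq_iff)
  next
    assume "x = 0"
    then show "inner x x = 0"
      unfolding inner_self by (simp add: coord_simps)
  qed
qed

end

definition clinear_op :: "('i ell2 \<Rightarrow>\<^sub>L 'i ell2) \<Rightarrow> bool" where
  "clinear_op T \<longleftrightarrow> (\<forall>c x. blinfun_apply T (scaleC_ell2 c x) = scaleC_ell2 c (blinfun_apply T x))"

definition adjoint_op :: "('i ell2 \<Rightarrow>\<^sub>L 'i ell2) \<Rightarrow> 'i ell2 \<Rightarrow>\<^sub>L 'i ell2" where
  "adjoint_op T = (THE T'. \<forall>x y. cinner_ell2 (blinfun_apply T x) y = cinner_ell2 x (blinfun_apply T' y))"

definition bounded_op :: "('i ell2 \<Rightarrow>\<^sub>L 'i ell2) star_algebra" where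
  "bounded_op = \<lparr>
     carrier = {T. clinear_op T},
     mult = (o\<^sub>L),
     one = id_blinfun,
     zero = 0,
     add = (+),
     smult = (\<lambda>c T. Blinfun (scaleC_ell2 c) o\<^sub>L T),
     star = adjoint_op\<rparr>"


section \<open>The representation and the norm completions\<close>

text \<open>\<open>l\<^sup>2(\<int>) \<otimes> l\<^sup>2(\<nat>)\<close> is realised as \<open>l\<^sup>2(\<int> \<times> \<nat>)\<close>, with \<open>e\<^sub>r \<otimes> e\<^sub>n\<close> being \<open>ket (r, n)\<close>.\<close>

type_synonym operator = "(int \<times> nat) ell2 \<Rightarrow>\<^sub>L (int \<times> nat) ell2"

definition rep_gen :: "real \<Rightarrow> su2_gen \<Rightarrow> operator" where
  "rep_gen q g = (case g of
     Alpha \<Rightarrow> (THE T. clinear_op T \<and>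
       (\<forall>r n. blinfun_apply T (ket (r, n)) = sqrt (1 - q ^ (2 * (n + 1))) *\<^sub>R ket (r, n + 1)))
   | Beta \<Rightarrow> (THE T. clinear_op T \<and>
       (\<forall>r n. blinfun_apply T (ket (r, n)) = q ^ n *\<^sub>R ket (r + 1, n))))"

definition rep :: "real \<Rightarrow> ((su2_gen \<times> bool) list \<Rightarrow> complex) set \<Rightarrow> operator" where
  "rep q = induced_hom bounded_op (rep_gen q)"

text \<open>
  Bounded operators are norm complete, so completions are closures. \<open>C(WP)\<close> is the closure inside
  the bounded operators on \<open>l\<^sup>2(\<int>) \<otimes> l\<^sup>2(\<nat>)\<close>; restriction to any of the invariant subspaces
  \<open>X\<^sub>m\<close> identifies it isometrically with an algebra of operators on \<open>\<Oplus>\<^sub>s l\<^sup>2(\<nat>)\<close>. It is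
  used through its ring structure only.
\<close>

definition CWP :: "real \<Rightarrow> nat \<Rightarrow> operator ring" where
  "CWP q l = \<lparr>
     carrier = closure (rep q ` WP q l),
     mult = (o\<^sub>L),
     one = id_blinfun,
     zero = 0,
     add = (+)\<rparr>"

text \<open>The fields \<open>mult\<close> and \<open>one\<close> of a module record play no role.\<close>

definition degree_module :: "real \<Rightarrow> nat \<Rightarrow> int \<Rightarrow> (operator, operator) module" where
  "degree_module q l i = \<lparr>
     carrier = closure (rep q ` SU2_degree q l i),
     mult = undefined,
     one = undefined,
     zero = 0,
     add = (+),
     smult = (o\<^sub>L)\<rparr>"


section \<open>Left modules over a not necessarily commutative ring\<close>

text \<open>The library locale \<^locale>\<open>module\<close> requires a commutative ring of scalars.\<close>

locale left_module = R?: ring R + M?: abelian_group M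
  for R :: "('a, 'r) ring_scheme" (structure) and M :: "('a, 'b, 'm) module_scheme" (structure) +
  assumes smult_closed:
      "\<lbrakk>a \<in> carrier R; x \<in> carrier M\<rbrakk> \<Longrightarrow> a \<odot>\<^bsub>M\<^esub> x \<in> carrier M"
    and smult_l_distr:
      "\<lbrakk>a \<in> carrier R; b \<in> carrier R; x \<in> carrier M\<rbrakk> \<Longrightarrow>
       (a \<oplus>\<^bsub>R\<^esub> b) \<odot>\<^bsub>M\<^esub> x = a \<odot>\<^bsub>M\<^esub> x \<oplus>\<^bsub>M\<^esub> b \<odot>\<^bsub>M\<^esub> x"
    and smult_r_distr:
      "\<lbrakk>a \<in> carrier R; x \<in> carrier M; y \<in> carrier M\<rbrakk> \<Longrightarrow>
       a \<odot>\<^bsub>M\<^esub> (x \<oplus>\<^bsub>M\<^esub> y) = a \<odot>\<^bsub>M\<^esub> x \<oplus>\<^bsub>M\<^esub> a \<odot>\<^bsub>M\<^esub> y"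
    and smult_assoc:
      "\<lbrakk>a \<in> carrier R; b \<in> carrier R; x \<in> carrier M\<rbrakk> \<Longrightarrow>
       (a \<otimes>\<^bsub>R\<^esub> b) \<odot>\<^bsub>M\<^esub> x = a \<odot>\<^bsub>M\<^esub> (b \<odot>\<^bsub>M\<^esub> x)"
    and smult_one:
      "x \<in> carrier M \<Longrightarrow> \<one>\<^bsub>R\<^esub> \<odot>\<^bsub>M\<^esub> x = x"

definition module_iso ::
    "('a, 'r) ring_scheme \<Rightarrow> ('a, 'b, 'm) module_scheme \<Rightarrow> ('a, 'c, 'n) module_scheme \<Rightarrow> bool" where
  "module_iso R M N \<longleftrightarrow>
     (\<exists>h. bij_betw h (carrier M) (carrier N) \<and>
        (\<forall>x\<in>carrier M. \<forall>y\<in>carrier M. h (x \<oplus>\<^bsub>M\<^esub> y) = h x \<oplus>\<^bsub>N\<^esub> h y) \<and>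
        (\<forall>a\<in>carrier R. \<forall>x\<in>carrier M. h (a \<odot>\<^bsub>M\<^esub> x) = a \<odot>\<^bsub>N\<^esub> h x))"

definition module_sum ::
    "('a, 'b, 'm) module_scheme \<Rightarrow> ('a, 'c, 'n) module_scheme \<Rightarrow> ('a, 'b \<times> 'c) module" where
  "module_sum M N = \<lparr>
     carrier = carrier M \<times> carrier N,
     mult = undefined,
     one = undefined,
     zero = (\<zero>\<^bsub>M\<^esub>, \<zero>\<^bsub>N\<^esub>),
     add = (\<lambda>(x, y) (x', y'). (x \<oplus>\<^bsub>M\<^esub> x', y \<oplus>\<^bsub>N\<^esub> y')),
     smult = (\<lambda>a (x, y). (a \<odot>\<^bsub>M\<^esub> x, a \<odot>\<^bsub>N\<^esub> y))\<rparr>"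

definition free_module :: "('a, 'r) ring_scheme \<Rightarrow> 'x set \<Rightarrow> ('a, 'x \<Rightarrow> 'a) module" where
  "free_module R X = \<lparr>
     carrier = {f. range f \<subseteq> carrier R \<and> finite {x. f x \<noteq> \<zero>\<^bsub>R\<^esub>} \<and> {x. f x \<noteq> \<zero>\<^bsub>R\<^esub>} \<subseteq> X},
     mult = undefined,
     one = undefined,
     zero = (\<lambda>x. \<zero>\<^bsub>R\<^esub>),
     add = (\<lambda>f g x. f x \<oplus>\<^bsub>R\<^esub> g x),
     smult = (\<lambda>a f x. a \<otimes>\<^bsub>R\<^esub> f x)\<rparr>"

text \<open>
  Projective means: direct summand of a free module. A projective module is a direct summand of the
  free module on its own underlying set, and the complement may be taken inside that free module,
  so the types of \<open>X\<close> and \<open>N\<close> below impose no restriction.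
\<close>

definition projective_module :: "('a, 'r) ring_scheme \<Rightarrow> ('a, 'b, 'm) module_scheme \<Rightarrow> bool" where
  "projective_module R M \<longleftrightarrow> left_module R M \<and>
     (\<exists>(X :: 'b set) (N :: ('a, 'b \<Rightarrow> 'a) module).
        left_module R N \<and> module_iso R (module_sum M N) (free_module R X))"

definition finitely_generated :: "('a, 'r) ring_scheme \<Rightarrow> ('a, 'b, 'm) module_scheme \<Rightarrow> bool" where
  "finitely_generated R M \<longleftrightarrow>
     (\<exists>S. finite S \<and> S \<subseteq> carrier M \<and>
        (\<forall>x\<in>carrier M. \<exists>a\<in>S \<rightarrow> carrier R. x = (\<Oplus>\<^bsub>M\<^esub>s\<in>S. a s \<odot>\<^bsub>M\<^esub> s)))"

definition fg_projective :: "('a, 'r) ring_scheme \<Rightarrow> ('a, 'b, 'm) module_scheme \<Rightarrow> bool" where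
  "fg_projective R M \<longleftrightarrow> projective_module R M \<and> finitely_generated R M"


section \<open>The group \<open>K\<^sub>0\<close>\<close>

text \<open>
  Isomorphism classes of finitely generated projective left modules. Each such module is
  isomorphic to a submodule of some \<open>R\<^sup>n\<close>, so representatives on sets of functions
  \<^typ>\<open>nat \<Rightarrow> 'a\<close> suffice.
\<close>

definition iso_class ::
    "('a, 'r) ring_scheme \<Rightarrow> ('a, 'b, 'm) module_scheme \<Rightarrow> ('a, nat \<Rightarrow> 'a) module set" where
  "iso_class R M = {N. fg_projective R N \<and> module_iso R M N}"

definition proj_monoid :: "('a, 'r) ring_scheme \<Rightarrow> ('a, nat \<Rightarrow> 'a) module set monoid" where
  "proj_monoid R = \<lparr>
     carrier = iso_class R ` {M :: ('a, nat \<Rightarrow> 'a) module. fg_projective R M},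
     mult = (\<lambda>C D. \<Union>M\<in>C. \<Union>N\<in>D. iso_class R (module_sum M N)),
     one = iso_class R (free_module R ({} :: nat set))\<rparr>"

definition grothendieck_rel :: "('a, 'm) monoid_scheme \<Rightarrow> (('a \<times> 'a) \<times> ('a \<times> 'a)) set" where
  "grothendieck_rel V =
     {((a, b), (c, d)) | a b c d. {a, b, c, d} \<subseteq> carrier V \<and>
        (\<exists>k\<in>carrier V. a \<otimes>\<^bsub>V\<^esub> d \<otimes>\<^bsub>V\<^esub> k = c \<otimes>\<^bsub>V\<^esub> b \<otimes>\<^bsub>V\<^esub> k)}"

text \<open>The Grothendieck group of a commutative monoid; the class of \<open>(a, b)\<close> stands for \<open>a - b\<close>.\<close>

definition grothendieck_group :: "('a, 'm) monoid_scheme \<Rightarrow> ('a \<times> 'a) set monoid" where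
  "grothendieck_group V = \<lparr>
     carrier = (carrier V \<times> carrier V) // grothendieck_rel V,
     mult = (\<lambda>X Y. \<Union>(a, b)\<in>X. \<Union>(c, d)\<in>Y. grothendieck_rel V `` {(a \<otimes>\<^bsub>V\<^esub> c, b \<otimes>\<^bsub>V\<^esub> d)}),
     one = grothendieck_rel V `` {(\<one>\<^bsub>V\<^esub>, \<one>\<^bsub>V\<^esub>)}\<rparr>"

text \<open>\<open>K\<^sub>0\<close> is written multiplicatively, as usual for groups in HOL-Algebra.\<close>

definition K0 ::
    "('a, 'r) ring_scheme \<Rightarrow>
     (('a, nat \<Rightarrow> 'a) module set \<times> ('a, nat \<Rightarrow> 'a) module set) set monoid" where
  "K0 R = grothendieck_group (proj_monoid R)"

definition K0_class ::
    "('a, 'r) ring_scheme \<Rightarrow> ('a, 'b, 'm) module_scheme \<Rightarrow>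
     (('a, nat \<Rightarrow> 'a) module set \<times> ('a, nat \<Rightarrow> 'a) module set) set" where
  "K0_class R M = grothendieck_rel (proj_monoid R) `` {(iso_class R M, \<one>\<^bsub>proj_monoid R\<^esub>)}"

end

theory Submission
  imports Defs
begin

text \<open>
  In the representation, \<open>\<alpha>\<close> and \<open>\<beta>\<close> act on \<open>l\<^sup>2(\<int>) \<otimes> l\<^sup>2(\<nat>)\<close> as weighted shifts. With \<open>e\<^sub>r \<otimes> e\<^sub>n\<close>
  placed in degree \<open>l r - n\<close>, an element of degree \<open>i\<close> raises degrees by \<open>i\<close> and commutes with the
  bilateral shift of the first factor. Let \<open>C\<^sub>i\<close> be the norm closure of the elements of degree \<open>i\<close>, so that
  \<open>C\<^sub>0\<close> is the algebra and \<open>C\<^sub>i\<close> are the modules (\<open>degree_closure i\<close> below). The closures contain more than the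
  polynomial algebra: the powers of \<open>\<beta>\<beta>\<^sup>*\<close> converge to the projection onto level \<open>n = 0\<close>, and from it one
  gets all matrix units compatible with the grading (\<open>matrix_unit_in_closure\<close>) and the unweighted shift
  \<open>S : e\<^sub>r \<otimes> e\<^sub>n \<mapsto> e\<^sub>r \<otimes> e\<^bsub>n+1\<^esub>\<close>, which has degree \<open>- 1\<close> (\<open>shift_in_closure\<close>).

  Projectivity. If \<open>\<Sum>\<^sub>k x\<^sub>k y\<^sub>k = 1\<close> with \<open>x\<^sub>k \<in> C\<^bsub>-i\<^esub>\<close> and \<open>y\<^sub>k \<in> C\<^sub>i\<close>, then \<open>T = \<Sum>\<^sub>k (T x\<^sub>k) y\<^sub>k\<close> exhibits a dual basis
  of \<open>C\<^sub>i\<close> over \<open>C\<^sub>0\<close>. For \<open>i = - j \<le> 0\<close> one summand \<open>S\<^sup>*\<^sup>j S\<^sup>j = 1\<close> is enough; for \<open>i = j > 0\<close> the difference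
  between \<open>1\<close> and \<open>S\<^sup>j S\<^sup>*\<^sup>j\<close>, the projection onto the levels below \<open>j\<close>, is a sum of products of matrix units.

  Generation of \<open>K\<^sub>0\<close>. Right multiplication by \<open>S\<^sup>*\<^sup>j\<close> identifies \<open>C\<^bsub>-j\<^esub>\<close> with \<open>C\<^sub>0 p\<^sub>j\<close>, where \<open>p\<^sub>j = S\<^sup>j S\<^sup>*\<^sup>j\<close> projects onto the
  levels \<open>n \<ge> j\<close>. As \<open>p\<^sub>n - p\<^bsub>n+1\<^esub>\<close> is the projection \<open>e\<^sub>n\<close> onto level \<open>n\<close>, the class of \<open>C\<^sub>0 e\<^sub>n\<close> is the difference
  of the classes of \<open>C\<^bsub>-n\<^esub>\<close> and \<open>C\<^bsub>-n-1\<^esub>\<close>. It remains to see that the modules \<open>C\<^sub>0 p\<^sub>j\<close> and \<open>C\<^sub>0 e\<^sub>n\<close> generate \<open>K\<^sub>0\<close>,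
  and this holds for every finitely generated projective module \<open>M\<close> over an extension of \<open>\<complex>\<close> by an ideal
  \<open>J\<close> of compact type (\<open>K0_class_in_subgroup\<close>). The idea is to split off one summand at a time
  (\<open>split_off\<close>): if a functional on \<open>M\<close> takes an idempotent value \<open>a\<close> at \<open>v = a v\<close>, then \<open>M\<close> is the
  direct sum of a copy of \<open>C\<^sub>0 a\<close> and the kernel of the functional. Splitting off copies of \<open>C\<^sub>0 p\<^sub>j\<close> lowers the number of
  generators of \<open>M\<close> modulo \<open>J M\<close> until \<open>M = J M\<close>. Then Nakayama's argument, in which small norm replaces membership in the
  radical, shows that finitely many elements fixed by projections \<open>e\<^sub>n\<close> generate \<open>M\<close>, and \<open>M\<close> is exhausted by
  splitting off copies of the simple modules \<open>C\<^sub>0 e\<^sub>n\<close>. The only analytic input to these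
  steps is the Neumann series in the closed algebra \<open>C\<^sub>0\<close>.

  Three properties of \<open>C\<^sub>0\<close> enter, each verified on words in the generators and carried over to the norm closure:
  an operator of degree \<open>0\<close> is a scalar up to an operator that is small on high levels (\<open>nearly_scalar_closure\<close>),
  its rows decay (\<open>below_above_small\<close>), and between two levels it is a multiple of one matrix unit
  (\<open>level_corner\<close>). To reduce to words one needs that the coaction reads off the homogeneous
  components of an element (\<open>SU2_degree_eq\<close>), as the defining ideal is graded (\<open>component_I\<close>), and that the representation is
  well defined (\<open>rep_cs\<close>).
\<close>

section \<open>Dual bases of left modules\<close>

definition left_linear ::
    "('a, 'r) ring_scheme \<Rightarrow> ('a, 'b, 'm) module_scheme \<Rightarrow> ('a, 'c, 'n) module_scheme \<Rightarrow> ('b \<Rightarrow> 'c) \<Rightarrow> bool" where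
  "left_linear R M N f \<longleftrightarrow> (\<forall>x\<in>carrier M. f x \<in> carrier N) \<and>
     (\<forall>x\<in>carrier M. \<forall>y\<in>carrier M. f (x \<oplus>\<^bsub>M\<^esub> y) = f x \<oplus>\<^bsub>N\<^esub> f y) \<and>
     (\<forall>a\<in>carrier R. \<forall>x\<in>carrier M. f (a \<odot>\<^bsub>M\<^esub> x) = a \<odot>\<^bsub>N\<^esub> f x)"

definition regular_module :: "('a, 'r) ring_scheme \<Rightarrow> ('a, 'a) module" where
  "regular_module R = \<lparr>carrier = carrier R, mult = undefined, one = undefined,
     zero = \<zero>\<^bsub>R\<^esub>, add = (\<oplus>\<^bsub>R\<^esub>), smult = (\<otimes>\<^bsub>R\<^esub>)\<rparr>"

abbreviation functional ::
    "('a, 'r) ring_scheme \<Rightarrow> ('a, 'b, 'm) module_scheme \<Rightarrow> ('b \<Rightarrow> 'a) \<Rightarrow> bool" where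
  "functional R M \<equiv> left_linear R M (regular_module R)"

text \<open>Having a finite dual basis is equivalent to being finitely generated projective. Unlike a complement in a
  free module, a dual basis is easily transported along isomorphisms, to direct sums and to direct summands.\<close>

definition dual_basis ::
    "('a, 'r) ring_scheme \<Rightarrow> ('a, 'b, 'm) module_scheme \<Rightarrow> 'k set \<Rightarrow> ('k \<Rightarrow> 'b) \<Rightarrow> ('k \<Rightarrow> 'b \<Rightarrow> 'a) \<Rightarrow> bool" where
  "dual_basis R M K y \<phi> \<longleftrightarrow> finite K \<and> (\<forall>k\<in>K. y k \<in> carrier M \<and> functional R M (\<phi> k)) \<and>
     (\<forall>x\<in>carrier M. x = (\<Oplus>\<^bsub>M\<^esub>k\<in>K. \<phi> k x \<odot>\<^bsub>M\<^esub> y k))"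

lemma left_linearI:
  assumes "\<And>x. x \<in> carrier M \<Longrightarrow> f x \<in> carrier N"
    and "\<And>x y. \<lbrakk>x \<in> carrier M; y \<in> carrier M\<rbrakk> \<Longrightarrow> f (x \<oplus>\<^bsub>M\<^esub> y) = f x \<oplus>\<^bsub>N\<^esub> f y"
    and "\<And>a x. \<lbrakk>a \<in> carrier R; x \<in> carrier M\<rbrakk> \<Longrightarrow> f (a \<odot>\<^bsub>M\<^esub> x) = a \<odot>\<^bsub>N\<^esub> f x"
  shows "left_linear R M N f"
  using assms by (auto simp: left_linear_def)

lemma left_linearD:
  assumes "left_linear R M N f"
  shows "x \<in> carrier M \<Longrightarrow> f x \<in> carrier N"
    and "\<lbrakk>x \<in> carrier M; y \<in> carrier M\<rbrakk> \<Longrightarrow> f (x \<oplus>\<^bsub>M\<^esub> y) = f x \<oplus>\<^bsub>N\<^esub> f y"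
    and "\<lbrakk>a \<in> carrier R; x \<in> carrier M\<rbrakk> \<Longrightarrow> f (a \<odot>\<^bsub>M\<^esub> x) = a \<odot>\<^bsub>N\<^esub> f x"
  using assms by (auto simp: left_linear_def)

lemma regular_module_simps [simp]:
  "carrier (regular_module R) = carrier R" "zero (regular_module R) = \<zero>\<^bsub>R\<^esub>"
  "add (regular_module R) = (\<oplus>\<^bsub>R\<^esub>)" "smult (regular_module R) = (\<otimes>\<^bsub>R\<^esub>)"
  by (simp_all add: regular_module_def)

lemma free_module_simps [simp]:
  "carrier (free_module R X) = {f. range f \<subseteq> carrier R \<and> finite {x. f x \<noteq> \<zero>\<^bsub>R\<^esub>} \<and> {x. f x \<noteq> \<zero>\<^bsub>R\<^esub>} \<subseteq> X}"
  "zero (free_module R X) = (\<lambda>x. \<zero>\<^bsub>R\<^esub>)"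
  "add (free_module R X) = (\<lambda>f g x. f x \<oplus>\<^bsub>R\<^esub> g x)"
  "smult (free_module R X) = (\<lambda>a f x. a \<otimes>\<^bsub>R\<^esub> f x)"
  by (simp_all add: free_module_def)

lemma module_sum_simps [simp]:
  "carrier (module_sum M N) = carrier M \<times> carrier N"
  "zero (module_sum M N) = (\<zero>\<^bsub>M\<^esub>, \<zero>\<^bsub>N\<^esub>)"
  "add (module_sum M N) = (\<lambda>(x, y) (x', y'). (x \<oplus>\<^bsub>M\<^esub> x', y \<oplus>\<^bsub>N\<^esub> y'))"
  "smult (module_sum M N) = (\<lambda>a (x, y). (a \<odot>\<^bsub>M\<^esub> x, a \<odot>\<^bsub>N\<^esub> y))"
  by (simp_all add: module_sum_def)

text \<open>Multiplication by the scalar \<open>-1\<close> provides the additive inverses.\<close>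

lemma (in ring) left_moduleI:
  fixes M :: "('a, 'c, 'm) module_scheme"
  assumes add: "\<And>x y. \<lbrakk>x \<in> carrier M; y \<in> carrier M\<rbrakk> \<Longrightarrow> x \<oplus>\<^bsub>M\<^esub> y \<in> carrier M"
    and zero: "\<zero>\<^bsub>M\<^esub> \<in> carrier M"
    and smult: "\<And>a x. \<lbrakk>a \<in> carrier R; x \<in> carrier M\<rbrakk> \<Longrightarrow> a \<odot>\<^bsub>M\<^esub> x \<in> carrier M"
    and assoc: "\<And>x y z. \<lbrakk>x \<in> carrier M; y \<in> carrier M; z \<in> carrier M\<rbrakk> \<Longrightarrow>
        x \<oplus>\<^bsub>M\<^esub> y \<oplus>\<^bsub>M\<^esub> z = x \<oplus>\<^bsub>M\<^esub> (y \<oplus>\<^bsub>M\<^esub> z)"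
    and comm: "\<And>x y. \<lbrakk>x \<in> carrier M; y \<in> carrier M\<rbrakk> \<Longrightarrow> x \<oplus>\<^bsub>M\<^esub> y = y \<oplus>\<^bsub>M\<^esub> x"
    and l_zero: "\<And>x. x \<in> carrier M \<Longrightarrow> \<zero>\<^bsub>M\<^esub> \<oplus>\<^bsub>M\<^esub> x = x"
    and zero_smult: "\<And>x. x \<in> carrier M \<Longrightarrow> \<zero> \<odot>\<^bsub>M\<^esub> x = \<zero>\<^bsub>M\<^esub>"
    and l_distr: "\<And>a b x. \<lbrakk>a \<in> carrier R; b \<in> carrier R; x \<in> carrier M\<rbrakk> \<Longrightarrow>
        (a \<oplus> b) \<odot>\<^bsub>M\<^esub> x = a \<odot>\<^bsub>M\<^esub> x \<oplus>\<^bsub>M\<^esub> b \<odot>\<^bsub>M\<^esub> x"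
    and r_distr: "\<And>a x y. \<lbrakk>a \<in> carrier R; x \<in> carrier M; y \<in> carrier M\<rbrakk> \<Longrightarrow>
        a \<odot>\<^bsub>M\<^esub> (x \<oplus>\<^bsub>M\<^esub> y) = a \<odot>\<^bsub>M\<^esub> x \<oplus>\<^bsub>M\<^esub> a \<odot>\<^bsub>M\<^esub> y"
    and smult_assoc: "\<And>a b x. \<lbrakk>a \<in> carrier R; b \<in> carrier R; x \<in> carrier M\<rbrakk> \<Longrightarrow>
        (a \<otimes> b) \<odot>\<^bsub>M\<^esub> x = a \<odot>\<^bsub>M\<^esub> (b \<odot>\<^bsub>M\<^esub> x)"
    and one: "\<And>x. x \<in> carrier M \<Longrightarrow> \<one> \<odot>\<^bsub>M\<^esub> x = x"
  shows "left_module R M"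
proof -
  have "abelian_group M"
  proof (rule abelian_groupI)
    fix x assume x: "x \<in> carrier M"
    have "(\<ominus> \<one>) \<odot>\<^bsub>M\<^esub> x \<oplus>\<^bsub>M\<^esub> \<one> \<odot>\<^bsub>M\<^esub> x = \<zero>\<^bsub>M\<^esub>"
      using x by (simp add: l_distr[symmetric] l_neg zero_smult)
    then show "\<exists>y\<in>carrier M. y \<oplus>\<^bsub>M\<^esub> x = \<zero>\<^bsub>M\<^esub>"
      using x one smult by (intro bexI[of _ "(\<ominus> \<one>) \<odot>\<^bsub>M\<^esub> x"]) auto
  qed (use assms in auto)
  then show ?thesis
    using assms ring_axioms by (intro left_module.intro left_module_axioms.intro) auto
qed

context left_module
begin

lemma smult_l_null [simp]: "x \<in> carrier M \<Longrightarrow> \<zero> \<odot>\<^bsub>M\<^esub> x = \<zero>\<^bsub>M\<^esub>"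
  using smult_l_distr[of \<zero> \<zero> x] smult_closed[of \<zero> x]
  by (metis R.l_zero R.zero_closed M.add.r_cancel_one')

lemma smult_r_null [simp]: "a \<in> carrier R \<Longrightarrow> a \<odot>\<^bsub>M\<^esub> \<zero>\<^bsub>M\<^esub> = \<zero>\<^bsub>M\<^esub>"
  using smult_r_distr[of a "\<zero>\<^bsub>M\<^esub>" "\<zero>\<^bsub>M\<^esub>"] smult_closed[of a "\<zero>\<^bsub>M\<^esub>"]
  by (metis M.l_zero M.zero_closed M.add.r_cancel_one')

lemma smult_minus:
  assumes "a \<in> carrier R" "x \<in> carrier M"
  shows "(\<ominus> a) \<odot>\<^bsub>M\<^esub> x = \<ominus>\<^bsub>M\<^esub> (a \<odot>\<^bsub>M\<^esub> x)"
proof -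
  have "(\<ominus> a) \<odot>\<^bsub>M\<^esub> x \<oplus>\<^bsub>M\<^esub> a \<odot>\<^bsub>M\<^esub> x = \<zero>\<^bsub>M\<^esub>"
    using assms by (simp add: smult_l_distr[symmetric] R.l_neg)
  then show ?thesis
    using assms by (simp add: M.minus_equality smult_closed)
qed

lemma smult_minus_one: "x \<in> carrier M \<Longrightarrow> (\<ominus> \<one>) \<odot>\<^bsub>M\<^esub> x = \<ominus>\<^bsub>M\<^esub> x"
  by (simp add: smult_minus smult_one)

lemma finsum_smult_r:
  assumes "finite A" "a \<in> carrier R" "f \<in> A \<rightarrow> carrier M"
  shows "a \<odot>\<^bsub>M\<^esub> (\<Oplus>\<^bsub>M\<^esub>i\<in>A. f i) = (\<Oplus>\<^bsub>M\<^esub>i\<in>A. a \<odot>\<^bsub>M\<^esub> f i)"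
  using assms(1,3)
proof (induction A)
  case (insert i A)
  then have "f i \<in> carrier M" "f \<in> A \<rightarrow> carrier M" by auto
  with insert show ?case
    using assms(2) by (simp add: smult_r_distr smult_closed Pi_iff)
qed (use assms(2) in simp)

lemma finsum_smult_l:
  assumes "finite A" "x \<in> carrier M" "f \<in> A \<rightarrow> carrier R"
  shows "(\<Oplus>i\<in>A. f i) \<odot>\<^bsub>M\<^esub> x = (\<Oplus>\<^bsub>M\<^esub>i\<in>A. f i \<odot>\<^bsub>M\<^esub> x)"
  using assms(1,3)
proof (induction A)
  case (insert i A)
  then have "f i \<in> carrier R" "f \<in> A \<rightarrow> carrier R" by auto
  with insert show ?case
    using assms(2) by (simp add: smult_l_distr smult_closed Pi_iff)
qed (use assms(2) in simp)

lemma left_module_self: "left_module R M" ..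

lemma left_linear_zero:
  assumes "left_module R N" "left_linear R M N f"
  shows "f \<zero>\<^bsub>M\<^esub> = \<zero>\<^bsub>N\<^esub>"
proof -
  interpret N: left_module R N by fact
  have "f (\<zero> \<odot>\<^bsub>M\<^esub> \<zero>\<^bsub>M\<^esub>) = \<zero> \<odot>\<^bsub>N\<^esub> f \<zero>\<^bsub>M\<^esub>"
    by (rule left_linearD(3)[OF assms(2)]) simp_all
  then show ?thesis
    using left_linearD(1)[OF assms(2), of "\<zero>\<^bsub>M\<^esub>"] by simp
qed

lemma left_linear_minus:
  assumes "left_module R N" "left_linear R M N f" "x \<in> carrier M"
  shows "f (\<ominus>\<^bsub>M\<^esub> x) = \<ominus>\<^bsub>N\<^esub> f x"
proof -
  interpret N: left_module R N by fact
  have "f ((\<ominus> \<one>) \<odot>\<^bsub>M\<^esub> x) = (\<ominus> \<one>) \<odot>\<^bsub>N\<^esub> f x"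
    using assms by (simp add: left_linearD)
  then show ?thesis
    using assms left_linearD(1)[OF assms(2)] by (simp add: smult_minus_one N.smult_minus_one)
qed

lemma left_linear_diff:
  assumes "left_module R N" "left_linear R M N f" "x \<in> carrier M" "y \<in> carrier M"
  shows "f (x \<ominus>\<^bsub>M\<^esub> y) = f x \<ominus>\<^bsub>N\<^esub> f y"
proof -
  interpret N: left_module R N by fact
  show ?thesis
    using assms by (simp add: a_minus_def left_linearD left_linear_minus[OF assms(1,2)])
qed

lemma left_linear_finsum:
  assumes "left_module R N" "left_linear R M N f" "finite A" "g \<in> A \<rightarrow> carrier M"
  shows "f (\<Oplus>\<^bsub>M\<^esub>i\<in>A. g i) = (\<Oplus>\<^bsub>N\<^esub>i\<in>A. f (g i))"
  using assms(3,4)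
proof (induction A)
  case empty
  interpret N: left_module R N by fact
  show ?case using left_linear_zero[OF assms(1,2)] by simp
next
  case (insert i A)
  interpret N: left_module R N by fact
  have "g i \<in> carrier M" "g \<in> A \<rightarrow> carrier M" using insert by auto
  then show ?case
    using insert left_linearD[OF assms(2)] by (simp add: Pi_iff)
qed

end

lemma (in ring) left_module_regular: "left_module R (regular_module R)"
  by (rule left_moduleI) (simp_all add: add.m_ac l_distr r_distr m_assoc)

lemma (in ring) left_module_free: "left_module R (free_module R X)"
proof (rule left_moduleI)
  fix f g assume f: "f \<in> carrier (free_module R X)" and g: "g \<in> carrier (free_module R X)"
  have fc: "f x \<in> carrier R" "g x \<in> carrier R" for x using f g by auto
  have sub: "{x. f x \<oplus> g x \<noteq> \<zero>} \<subseteq> {x. f x \<noteq> \<zero>} \<union> {x. g x \<noteq> \<zero>}" by auto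
  then have "finite {x. f x \<oplus> g x \<noteq> \<zero>}"
    using f g by (auto intro: finite_subset)
  moreover have "{x. f x \<oplus> g x \<noteq> \<zero>} \<subseteq> X"
  proof -
    have "{x. f x \<noteq> \<zero>} \<subseteq> X" "{x. g x \<noteq> \<zero>} \<subseteq> X" using f g by simp_all
    then show ?thesis using sub by (meson Un_least order_trans)
  qed
  ultimately show "f \<oplus>\<^bsub>free_module R X\<^esub> g \<in> carrier (free_module R X)"
    using fc by auto
next
  fix a f assume a: "a \<in> carrier R" and f: "f \<in> carrier (free_module R X)"
  have sub: "{x. a \<otimes> f x \<noteq> \<zero>} \<subseteq> {x. f x \<noteq> \<zero>}" using a by auto
  then have "finite {x. a \<otimes> f x \<noteq> \<zero>}" "{x. a \<otimes> f x \<noteq> \<zero>} \<subseteq> X"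
    using f by (auto intro: finite_subset)
  then show "a \<odot>\<^bsub>free_module R X\<^esub> f \<in> carrier (free_module R X)"
    using a f by auto
next
  fix f g h assume "f \<in> carrier (free_module R X)" "g \<in> carrier (free_module R X)"
    "h \<in> carrier (free_module R X)"
  then have "f x \<in> carrier R" "g x \<in> carrier R" "h x \<in> carrier R" for x by auto
  then show "f \<oplus>\<^bsub>free_module R X\<^esub> g \<oplus>\<^bsub>free_module R X\<^esub> h
      = f \<oplus>\<^bsub>free_module R X\<^esub> (g \<oplus>\<^bsub>free_module R X\<^esub> h)"
    by (simp add: a_assoc)
next
  fix f g assume "f \<in> carrier (free_module R X)" "g \<in> carrier (free_module R X)"
  then have "f x \<in> carrier R" "g x \<in> carrier R" for x by auto
  then show "f \<oplus>\<^bsub>free_module R X\<^esub> g = g \<oplus>\<^bsub>free_module R X\<^esub> f"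
    by (simp add: a_comm)
next
  fix a b f assume ab: "a \<in> carrier R" "b \<in> carrier R" and "f \<in> carrier (free_module R X)"
  then have "f x \<in> carrier R" for x by auto
  then show "(a \<oplus> b) \<odot>\<^bsub>free_module R X\<^esub> f
      = a \<odot>\<^bsub>free_module R X\<^esub> f \<oplus>\<^bsub>free_module R X\<^esub> b \<odot>\<^bsub>free_module R X\<^esub> f"
    "(a \<otimes> b) \<odot>\<^bsub>free_module R X\<^esub> f = a \<odot>\<^bsub>free_module R X\<^esub> (b \<odot>\<^bsub>free_module R X\<^esub> f)"
    using ab by (simp_all add: l_distr m_assoc)
next
  fix a f g assume a: "a \<in> carrier R" and "f \<in> carrier (free_module R X)" "g \<in> carrier (free_module R X)"
  then have "f x \<in> carrier R" "g x \<in> carrier R" for x by auto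
  then show "a \<odot>\<^bsub>free_module R X\<^esub> (f \<oplus>\<^bsub>free_module R X\<^esub> g)
      = a \<odot>\<^bsub>free_module R X\<^esub> f \<oplus>\<^bsub>free_module R X\<^esub> a \<odot>\<^bsub>free_module R X\<^esub> g"
    using a by (simp add: r_distr)
next
  fix f assume "f \<in> carrier (free_module R X)"
  then have "f x \<in> carrier R" for x by auto
  then show "\<zero>\<^bsub>free_module R X\<^esub> \<oplus>\<^bsub>free_module R X\<^esub> f = f"
    "\<zero> \<odot>\<^bsub>free_module R X\<^esub> f = \<zero>\<^bsub>free_module R X\<^esub>" "\<one> \<odot>\<^bsub>free_module R X\<^esub> f = f"
    by simp_all
qed auto

lemma (in ring) left_module_sum:
  assumes "left_module R M" "left_module R N"
  shows "left_module R (module_sum M N)"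
proof -
  interpret M: left_module R M by fact
  interpret N: left_module R N by fact
  show ?thesis
    by (rule left_moduleI)
      (auto simp: M.smult_closed N.smult_closed M.M.add.m_ac N.M.add.m_ac M.smult_l_distr N.smult_l_distr
        M.smult_r_distr N.smult_r_distr M.smult_assoc N.smult_assoc M.smult_one N.smult_one)
qed

lemma (in left_module) left_module_submodule:
  assumes "N \<subseteq> carrier M" "\<zero>\<^bsub>M\<^esub> \<in> N" "\<And>x y. \<lbrakk>x \<in> N; y \<in> N\<rbrakk> \<Longrightarrow> x \<oplus>\<^bsub>M\<^esub> y \<in> N"
    "\<And>a x. \<lbrakk>a \<in> carrier R; x \<in> N\<rbrakk> \<Longrightarrow> a \<odot>\<^bsub>M\<^esub> x \<in> N"
  shows "left_module R (M\<lparr>carrier := N\<rparr>)"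
proof -
  have "x \<in> carrier M" if "x \<in> N" for x using assms that by auto
  then show ?thesis
    using assms by (intro R.left_moduleI)
      (simp_all add: M.add.m_ac smult_l_distr smult_r_distr smult_assoc smult_one)
qed

lemma (in left_module) finsum_submodule:
  assumes "N \<subseteq> carrier M" "\<zero>\<^bsub>M\<^esub> \<in> N" "\<And>x y. \<lbrakk>x \<in> N; y \<in> N\<rbrakk> \<Longrightarrow> x \<oplus>\<^bsub>M\<^esub> y \<in> N"
    and "\<And>i. i \<in> A \<Longrightarrow> f i \<in> N"
  shows "(\<Oplus>\<^bsub>M\<^esub>i\<in>A. f i) \<in> N"
proof (cases "finite A")
  case True
  then show ?thesis using assms(4)
  proof (induction A)
    case (insert i A)
    then have "f \<in> A \<rightarrow> carrier M" "f i \<in> carrier M" using assms(1) by auto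
    then show ?case using insert assms(3) by simp
  qed (use assms in simp)
qed (use assms in simp)

section \<open>Module isomorphisms\<close>

lemma module_isoE:
  assumes "module_iso R M N"
  obtains h where "bij_betw h (carrier M) (carrier N)" "left_linear R M N h"
  using assms unfolding module_iso_def left_linear_def bij_betw_def by blast

lemma module_isoI:
  assumes "bij_betw h (carrier M) (carrier N)" "left_linear R M N h"
  shows "module_iso R M N"
  using assms unfolding module_iso_def left_linear_def by blast

lemma module_isoI_inverse:
  assumes "left_linear R M N f"
    and "\<And>y. y \<in> carrier N \<Longrightarrow> g y \<in> carrier M"
    and "\<And>x. x \<in> carrier M \<Longrightarrow> g (f x) = x"
    and "\<And>y. y \<in> carrier N \<Longrightarrow> f (g y) = y"
  shows "module_iso R M N"
  by (rule module_isoI[OF bij_betw_byWitness[where f' = g]])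
    (use assms left_linearD(1)[OF assms(1)] in auto)

lemma left_linear_comp:
  assumes "left_linear R M N f" "left_linear R N P g"
  shows "left_linear R M P (\<lambda>x. g (f x))"
  using assms by (auto simp: left_linear_def)

lemma (in left_module) left_linear_the_inv_into:
  assumes "bij_betw h (carrier M) (carrier N)" "left_linear R M N h"
  shows "left_linear R N M (the_inv_into (carrier M) h)"
proof (rule left_linearI)
  let ?g = "the_inv_into (carrier M) h"
  have inj: "inj_on h (carrier M)" using assms by (simp add: bij_betw_def)
  have g: "?g y \<in> carrier M" "h (?g y) = y" if "y \<in> carrier N" for y
    using bij_betwE[OF bij_betw_the_inv_into[OF assms(1)]] f_the_inv_into_f_bij_betw[OF assms(1)] that by auto
  show "?g y \<in> carrier M" if "y \<in> carrier N" for y using g that by simp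
  show "?g (x \<oplus>\<^bsub>N\<^esub> y) = ?g x \<oplus>\<^bsub>M\<^esub> ?g y" if "x \<in> carrier N" "y \<in> carrier N" for x y
    by (rule the_inv_into_f_eq[OF inj]) (use that g left_linearD(2)[OF assms(2)] in auto)
  show "?g (a \<odot>\<^bsub>N\<^esub> x) = a \<odot>\<^bsub>M\<^esub> ?g x" if "a \<in> carrier R" "x \<in> carrier N" for a x
    by (rule the_inv_into_f_eq[OF inj]) (use that g left_linearD(3)[OF assms(2)] smult_closed in auto)
qed

lemma module_iso_sym:
  assumes "left_module R M" "module_iso R M N"
  shows "module_iso R N M"
proof -
  obtain h where h: "bij_betw h (carrier M) (carrier N)" "left_linear R M N h"
    using assms(2) by (rule module_isoE)
  show ?thesis
    by (rule module_isoI[OF bij_betw_the_inv_into[OF h(1)] left_module.left_linear_the_inv_into[OF assms(1) h]])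
qed

lemma module_iso_trans:
  assumes "module_iso R M N" "module_iso R N P"
  shows "module_iso R M P"
proof -
  obtain f where f: "bij_betw f (carrier M) (carrier N)" "left_linear R M N f"
    using assms(1) by (rule module_isoE)
  obtain g where g: "bij_betw g (carrier N) (carrier P)" "left_linear R N P g"
    using assms(2) by (rule module_isoE)
  show ?thesis
    using bij_betw_trans[OF f(1) g(1)] left_linear_comp[OF f(2) g(2)]
    by (intro module_isoI) (simp_all add: comp_def)
qed

lemma module_iso_sum:
  assumes "module_iso R M M'" "module_iso R N N'"
  shows "module_iso R (module_sum M N) (module_sum M' N')"
proof -
  obtain f where f: "bij_betw f (carrier M) (carrier M')" "left_linear R M M' f"
    using assms(1) by (rule module_isoE)
  obtain g where g: "bij_betw g (carrier N) (carrier N')" "left_linear R N N' g"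
    using assms(2) by (rule module_isoE)
  have "bij_betw (map_prod f g) (carrier M \<times> carrier N) (carrier M' \<times> carrier N')"
    using f(1) g(1) by (rule bij_betw_map_prod)
  moreover have "left_linear R (module_sum M N) (module_sum M' N') (map_prod f g)"
    using f(2) g(2) by (auto simp: left_linear_def)
  ultimately show ?thesis by (intro module_isoI) simp_all
qed

lemma module_iso_sum_commute:
  "module_iso R (module_sum M N) (module_sum N M)"
  by (rule module_isoI_inverse[where f = "\<lambda>(x, y). (y, x)" and g = "\<lambda>(x, y). (y, x)"])
    (auto simp: left_linear_def)

lemma module_iso_sum_assoc:
  "module_iso R (module_sum (module_sum M N) P) (module_sum M (module_sum N P))"
  by (rule module_isoI_inverse[where f = "\<lambda>((x, y), z). (x, y, z)" and g = "\<lambda>(x, y, z). ((x, y), z)"])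
    (auto simp: left_linear_def)

lemma module_iso_sum_zero:
  assumes "left_module R M" "left_module R N" "carrier N = {\<zero>\<^bsub>N\<^esub>}"
  shows "module_iso R (module_sum N M) M"
proof -
  interpret M: left_module R M by fact
  interpret N: left_module R N by fact
  show ?thesis
    by (rule module_isoI_inverse[where f = snd and g = "\<lambda>x. (\<zero>\<^bsub>N\<^esub>, x)"])
      (auto simp: left_linear_def assms(3))
qed

lemma (in left_module) left_module_transport:
  assumes h: "bij_betw h (carrier M) (carrier N)" "left_linear R M N h" and "h \<zero>\<^bsub>M\<^esub> = \<zero>\<^bsub>N\<^esub>"
  shows "left_module R N"
proof -
  have N: "carrier N = h ` carrier M" using h(1) by (simp add: bij_betw_def)
  note hom = left_linearD[OF h(2)]
  have add: "h x \<oplus>\<^bsub>N\<^esub> h y = h (x \<oplus>\<^bsub>M\<^esub> y)" if "x \<in> carrier M" "y \<in> carrier M" for x y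
    using hom(2) that by simp
  have smult: "a \<odot>\<^bsub>N\<^esub> h x = h (a \<odot>\<^bsub>M\<^esub> x)" if "a \<in> carrier R" "x \<in> carrier M" for a x
    using hom(3) that by simp
  show ?thesis
    by (rule R.left_moduleI)
      (auto simp: N add smult assms(3)[symmetric] M.add.m_ac smult_closed smult_assoc smult_one
        smult_l_distr smult_r_distr)
qed

section \<open>Finitely generated projective modules have finite dual bases\<close>

lemma (in left_module) dual_basisD:
  assumes "dual_basis R M K y \<phi>"
  shows "finite K" "k \<in> K \<Longrightarrow> y k \<in> carrier M" "k \<in> K \<Longrightarrow> functional R M (\<phi> k)"
    "\<lbrakk>k \<in> K; x \<in> carrier M\<rbrakk> \<Longrightarrow> \<phi> k x \<in> carrier R"
    "x \<in> carrier M \<Longrightarrow> (\<Oplus>\<^bsub>M\<^esub>k\<in>K. \<phi> k x \<odot>\<^bsub>M\<^esub> y k) = x"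
  using assms by (auto simp: dual_basis_def left_linear_def)

lemma (in left_module) dual_basis_reindex:
  assumes "dual_basis R M K y \<phi>" "bij_betw g L K"
  shows "dual_basis R M L (\<lambda>l. y (g l)) (\<lambda>l. \<phi> (g l))"
proof -
  note D = dual_basisD[OF assms(1)]
  have g: "g ` L = K" "inj_on g L" using assms(2) by (auto simp: bij_betw_def)
  have "(\<Oplus>\<^bsub>M\<^esub>l\<in>L. \<phi> (g l) x \<odot>\<^bsub>M\<^esub> y (g l)) = x" if x: "x \<in> carrier M" for x
  proof -
    have "(\<Oplus>\<^bsub>M\<^esub>k\<in>g ` L. \<phi> k x \<odot>\<^bsub>M\<^esub> y k) = (\<Oplus>\<^bsub>M\<^esub>l\<in>L. \<phi> (g l) x \<odot>\<^bsub>M\<^esub> y (g l))"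
      by (rule M.finsum_reindex) (use D x g in \<open>auto intro: smult_closed\<close>)
    then show ?thesis using D(5)[OF x] g by simp
  qed
  then show ?thesis
    using D(1-3) g assms(2) by (auto simp: dual_basis_def bij_betw_finite)
qed

lemma (in left_module) dual_basis_transport:
  assumes N: "left_module R N" and f: "left_linear R M N f" and g: "left_linear R N M g"
    and fg: "\<And>x. x \<in> carrier N \<Longrightarrow> f (g x) = x" and D: "dual_basis R M K y \<phi>"
  shows "dual_basis R N K (\<lambda>k. f (y k)) (\<lambda>k x. \<phi> k (g x))"
proof -
  note D = dual_basisD[OF D]
  note [simp] = left_linearD[OF f] left_linearD[OF g]
  have "(\<Oplus>\<^bsub>N\<^esub>k\<in>K. \<phi> k (g x) \<odot>\<^bsub>N\<^esub> f (y k)) = x" if x: "x \<in> carrier N" for x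
  proof -
    interpret N: left_module R N by fact
    have "x = f (\<Oplus>\<^bsub>M\<^esub>k\<in>K. \<phi> k (g x) \<odot>\<^bsub>M\<^esub> y k)"
      using D(5)[of "g x"] fg x by simp
    also have "\<dots> = (\<Oplus>\<^bsub>N\<^esub>k\<in>K. f (\<phi> k (g x) \<odot>\<^bsub>M\<^esub> y k))"
      by (rule left_linear_finsum[OF N f]) (use D x in \<open>auto intro: smult_closed\<close>)
    also have "\<dots> = (\<Oplus>\<^bsub>N\<^esub>k\<in>K. \<phi> k (g x) \<odot>\<^bsub>N\<^esub> f (y k))"
      by (rule N.M.finsum_cong') (use D x in \<open>auto intro: N.smult_closed\<close>)
    finally show ?thesis by simp
  qed
  then show ?thesis
    using D(1,2) left_linear_comp[OF g D(3)] by (auto simp: dual_basis_def)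
qed

lemma (in ring) dual_basis_sum:
  assumes M: "left_module R M" and N: "left_module R N"
    and DM: "dual_basis R M K y \<phi>" and DN: "dual_basis R N L z \<psi>"
  shows "dual_basis R (module_sum M N) (K <+> L)
    (case_sum (\<lambda>k. (y k, \<zero>\<^bsub>N\<^esub>)) (\<lambda>l. (\<zero>\<^bsub>M\<^esub>, z l)))
    (case_sum (\<lambda>k x. \<phi> k (fst x)) (\<lambda>l x. \<psi> l (snd x)))"
    (is "dual_basis _ ?S _ ?y ?\<phi>")
proof -
  interpret M: left_module R M by fact
  interpret N: left_module R N by fact
  interpret S: left_module R ?S using M N by (rule left_module_sum)
  note DM = M.dual_basisD[OF DM] and DN = N.dual_basisD[OF DN]
  have inc: "left_linear R M ?S (\<lambda>x. (x, \<zero>\<^bsub>N\<^esub>))" "left_linear R N ?S (\<lambda>x. (\<zero>\<^bsub>M\<^esub>, x))"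
    by (auto simp: left_linear_def)
  have "(\<Oplus>\<^bsub>?S\<^esub>k\<in>K <+> L. ?\<phi> k x \<odot>\<^bsub>?S\<^esub> ?y k) = x" if x: "x \<in> carrier ?S" for x
  proof -
    obtain u v where uv: "x = (u, v)" "u \<in> carrier M" "v \<in> carrier N" using x by auto
    have "(\<Oplus>\<^bsub>?S\<^esub>k\<in>K <+> L. ?\<phi> k x \<odot>\<^bsub>?S\<^esub> ?y k)
      = (\<Oplus>\<^bsub>?S\<^esub>k\<in>Inl ` K. ?\<phi> k x \<odot>\<^bsub>?S\<^esub> ?y k) \<oplus>\<^bsub>?S\<^esub> (\<Oplus>\<^bsub>?S\<^esub>k\<in>Inr ` L. ?\<phi> k x \<odot>\<^bsub>?S\<^esub> ?y k)"
      unfolding Plus_def by (rule S.M.finsum_Un_disjoint)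
        (use DM DN uv in \<open>auto simp: M.smult_closed N.smult_closed\<close>)
    also have "(\<Oplus>\<^bsub>?S\<^esub>k\<in>Inl ` K. ?\<phi> k x \<odot>\<^bsub>?S\<^esub> ?y k) = (\<Oplus>\<^bsub>?S\<^esub>k\<in>K. (\<phi> k u \<odot>\<^bsub>M\<^esub> y k, \<zero>\<^bsub>N\<^esub>))"
      by (subst S.M.finsum_reindex)
        (use DM uv in \<open>auto simp: M.smult_closed intro!: S.M.finsum_cong'\<close>)
    also have "\<dots> = (\<Oplus>\<^bsub>M\<^esub>k\<in>K. \<phi> k u \<odot>\<^bsub>M\<^esub> y k, \<zero>\<^bsub>N\<^esub>)"
      by (rule M.left_linear_finsum[OF S.left_module_self inc(1), symmetric])
        (use DM uv in \<open>auto simp: M.smult_closed\<close>)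
    also have "(\<Oplus>\<^bsub>?S\<^esub>k\<in>Inr ` L. ?\<phi> k x \<odot>\<^bsub>?S\<^esub> ?y k) = (\<Oplus>\<^bsub>?S\<^esub>k\<in>L. (\<zero>\<^bsub>M\<^esub>, \<psi> k v \<odot>\<^bsub>N\<^esub> z k))"
      by (subst S.M.finsum_reindex)
        (use DN uv in \<open>auto simp: N.smult_closed intro!: S.M.finsum_cong'\<close>)
    also have "\<dots> = (\<zero>\<^bsub>M\<^esub>, \<Oplus>\<^bsub>N\<^esub>k\<in>L. \<psi> k v \<odot>\<^bsub>N\<^esub> z k)"
      by (rule N.left_linear_finsum[OF S.left_module_self inc(2), symmetric])
        (use DN uv in \<open>auto simp: N.smult_closed\<close>)
    finally show ?thesis using DM(5) DN(5) uv by simp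
  qed
  moreover have "?y k \<in> carrier ?S \<and> functional R ?S (?\<phi> k)" if "k \<in> K <+> L" for k
    using that DM(2,3) DN(2,3) by (auto simp: left_linear_def)
  ultimately show ?thesis using DM(1) DN(1) by (auto simp: dual_basis_def)
qed

text \<open>A dual basis embeds \<open>M\<close> into the free module on the index set; the complement consists of the
  relations between the \<open>y k\<close>. Projectivity refers to free modules on sets of elements of the type of \<open>M\<close>, so
  this type has to be infinite to hold a copy of the index set.\<close>

lemma fg_projectiveI:
  fixes R (structure) and M :: "('a, 'c, 'm) module_scheme"
  assumes "left_module R M" and D: "dual_basis R M K y \<phi>" and inf: "infinite (UNIV :: 'c set)"
  shows "fg_projective R M"
proof -
  interpret left_module R M by fact
  obtain X :: "'c set" where X: "finite X" "card X = card K"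
    using infinite_arbitrarily_large[OF inf] by blast
  obtain g where g: "bij_betw g X K"
    using X D finite_same_card_bij[of X K] dual_basisD(1) by metis
  define z where "z = (\<lambda>l. y (g l))"
  define \<psi> where "\<psi> = (\<lambda>l. \<phi> (g l))"
  have DX: "dual_basis R M X z \<psi>"
    unfolding z_def \<psi>_def using D g by (rule dual_basis_reindex)
  note DX = dual_basisD[OF DX]
  let ?F = "free_module R X"
  define p where "p = (\<lambda>f. \<Oplus>\<^bsub>M\<^esub>k\<in>X. f k \<odot>\<^bsub>M\<^esub> z k)"
  define e where "e = (\<lambda>x k. if k \<in> X then \<psi> k x else \<zero>)"
  interpret F: left_module R ?F by (rule R.left_module_free)
  have F_val: "f k \<in> carrier R" if "f \<in> carrier ?F" for f k using that by auto
  have p: "left_linear R ?F M p"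
  proof (rule left_linearI)
    fix f assume f: "f \<in> carrier ?F"
    show "p f \<in> carrier M"
      unfolding p_def using F_val[OF f] DX(2) by (intro M.finsum_closed) (auto intro: smult_closed)
    show "p (a \<odot>\<^bsub>?F\<^esub> f) = a \<odot>\<^bsub>M\<^esub> p f" if a: "a \<in> carrier R" for a
      unfolding p_def using F_val[OF f] DX(1,2) a
      by (subst finsum_smult_r) (auto simp: smult_assoc smult_closed intro!: M.finsum_cong')
    show "p (f \<oplus>\<^bsub>?F\<^esub> f') = p f \<oplus>\<^bsub>M\<^esub> p f'" if f': "f' \<in> carrier ?F" for f'
    proof -
      have "p (f \<oplus>\<^bsub>?F\<^esub> f') = (\<Oplus>\<^bsub>M\<^esub>k\<in>X. f k \<odot>\<^bsub>M\<^esub> z k \<oplus>\<^bsub>M\<^esub> f' k \<odot>\<^bsub>M\<^esub> z k)"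
        unfolding p_def free_module_simps using F_val[OF f] F_val[OF f'] DX(1,2)
        by (intro M.finsum_cong') (auto simp: smult_l_distr smult_closed)
      also have "\<dots> = p f \<oplus>\<^bsub>M\<^esub> p f'"
        unfolding p_def using F_val[OF f] F_val[OF f'] DX(1,2)
        by (intro M.finsum_addf) (auto simp: smult_closed)
      finally show ?thesis .
    qed
  qed
  have e: "left_linear R M ?F e"
    using DX left_linearD(2,3)[OF DX(3)]
    by (intro left_linearI) (auto simp: e_def fun_eq_iff intro: finite_subset[OF _ DX(1)] split: if_splits)
  have pe: "p (e x) = x" if x: "x \<in> carrier M" for x
  proof -
    have "p (e x) = (\<Oplus>\<^bsub>M\<^esub>k\<in>X. \<psi> k x \<odot>\<^bsub>M\<^esub> z k)"
      unfolding p_def e_def by (rule M.finsum_cong') (use DX x in \<open>auto intro: smult_closed\<close>)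
    then show ?thesis using DX(5) x by simp
  qed
  define N where "N = (?F\<lparr>carrier := {f \<in> carrier ?F. p f = \<zero>\<^bsub>M\<^esub>}\<rparr>)"
  have N: "left_module R N"
    unfolding N_def
    by (rule F.left_module_submodule)
      (use F.left_linear_zero[OF left_module_self p] left_linearD[OF p] F.smult_closed F.M.a_closed in
        \<open>auto simp del: free_module_simps\<close>)
  have "module_iso R (module_sum M N) ?F"
  proof (rule module_isoI_inverse[where f = "\<lambda>(x, f). e x \<oplus>\<^bsub>?F\<^esub> f" and g = "\<lambda>f. (p f, f \<ominus>\<^bsub>?F\<^esub> e (p f))"])
    note [simp del] = free_module_simps
    have N_simps: "carrier N = {f \<in> carrier ?F. p f = \<zero>\<^bsub>M\<^esub>}" "add N = add ?F" "smult N = smult ?F"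
      by (simp_all add: N_def)
    note pD = left_linearD[OF p] and eD = left_linearD[OF e]
    show "left_linear R (module_sum M N) ?F (\<lambda>(x, f). e x \<oplus>\<^bsub>?F\<^esub> f)"
      by (rule left_linearI) (auto simp: N_simps eD F.M.add.m_ac F.smult_r_distr F.smult_closed)
    show "(p f, f \<ominus>\<^bsub>?F\<^esub> e (p f)) \<in> carrier (module_sum M N)" if "f \<in> carrier ?F" for f
    proof -
      have "p (f \<ominus>\<^bsub>?F\<^esub> e (p f)) = p f \<ominus>\<^bsub>M\<^esub> p (e (p f))"
        using that pD(1) eD(1) by (intro F.left_linear_diff[OF left_module_self p]) auto
      also have "\<dots> = \<zero>\<^bsub>M\<^esub>"
        using that pD(1) pe by (simp add: a_minus_def M.r_neg)
      finally show ?thesis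
        using that pD(1) eD(1) by (simp add: N_simps)
    qed
    show "(p ((\<lambda>(x, f). e x \<oplus>\<^bsub>?F\<^esub> f) x), (\<lambda>(x, f). e x \<oplus>\<^bsub>?F\<^esub> f) x \<ominus>\<^bsub>?F\<^esub> e (p ((\<lambda>(x, f). e x \<oplus>\<^bsub>?F\<^esub> f) x))) = x"
      if "x \<in> carrier (module_sum M N)" for x
      using that pD eD pe by (auto simp: N_simps a_minus_def F.M.add.m_ac F.M.r_neg F.M.r_neg1 F.M.r_neg2)
    show "(\<lambda>(x, f). e x \<oplus>\<^bsub>?F\<^esub> f) (p f, f \<ominus>\<^bsub>?F\<^esub> e (p f)) = f" if "f \<in> carrier ?F" for f
      using that pD eD by (simp add: a_minus_def F.M.add.m_lcomm F.M.r_neg)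
  qed
  then have "projective_module R M"
    unfolding projective_module_def using N left_module_self by blast
  moreover have "finitely_generated R M"
    unfolding finitely_generated_def
  proof (intro exI conjI ballI)
    show "finite (z ` X)" "z ` X \<subseteq> carrier M" using DX by auto
    fix x assume x: "x \<in> carrier M"
    define a where "a = (\<lambda>s. \<Oplus>k\<in>{k \<in> X. z k = s}. \<psi> k x)"
    have a: "a \<in> z ` X \<rightarrow> carrier R"
      unfolding a_def using DX(4)[OF _ x] by (auto intro!: R.finsum_closed)
    have "(\<Oplus>\<^bsub>M\<^esub>s\<in>z ` X. a s \<odot>\<^bsub>M\<^esub> s) = (\<Oplus>\<^bsub>M\<^esub>s\<in>z ` X. \<Oplus>\<^bsub>M\<^esub>k\<in>{k \<in> X. z k = s}. \<psi> k x \<odot>\<^bsub>M\<^esub> z k)"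
    proof (rule M.finsum_cong', simp)
      show "(\<lambda>s. \<Oplus>\<^bsub>M\<^esub>k\<in>{k \<in> X. z k = s}. \<psi> k x \<odot>\<^bsub>M\<^esub> z k) \<in> z ` X \<rightarrow> carrier M"
        using DX x by (auto intro!: M.finsum_closed smult_closed)
      fix s assume s: "s \<in> z ` X"
      have "a s \<odot>\<^bsub>M\<^esub> s = (\<Oplus>\<^bsub>M\<^esub>k\<in>{k \<in> X. z k = s}. \<psi> k x \<odot>\<^bsub>M\<^esub> s)"
        unfolding a_def by (rule finsum_smult_l) (use DX x s in auto)
      also have "\<dots> = (\<Oplus>\<^bsub>M\<^esub>k\<in>{k \<in> X. z k = s}. \<psi> k x \<odot>\<^bsub>M\<^esub> z k)"
        by (rule M.finsum_cong') (use DX x in \<open>auto intro: smult_closed\<close>)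
      finally show "a s \<odot>\<^bsub>M\<^esub> s = (\<Oplus>\<^bsub>M\<^esub>k\<in>{k \<in> X. z k = s}. \<psi> k x \<odot>\<^bsub>M\<^esub> z k)" .
    qed
    also have "\<dots> = (\<Oplus>\<^bsub>M\<^esub>k\<in>(\<Union>s\<in>z ` X. {k \<in> X. z k = s}). \<psi> k x \<odot>\<^bsub>M\<^esub> z k)"
      by (rule M.add.finprod_UN_disjoint[symmetric]) (use DX x in \<open>auto intro: smult_closed simp: pairwise_def disjnt_def\<close>)
    also have "(\<Union>s\<in>z ` X. {k \<in> X. z k = s}) = X" by auto
    finally show "\<exists>a\<in>z ` X \<rightarrow> carrier R. x = (\<Oplus>\<^bsub>M\<^esub>s\<in>z ` X. a s \<odot>\<^bsub>M\<^esub> s)"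
      using a DX(5)[OF x] by auto
  qed
  ultimately show ?thesis by (simp add: fg_projective_def)
qed

lemma (in left_module) dual_basis_nat:
  assumes "dual_basis R M K y \<phi>"
  obtains n :: nat and y' \<phi>' where "dual_basis R M {..<n} y' \<phi>'"
proof -
  obtain g where "bij_betw g {0..<card K} K"
    using ex_bij_betw_nat_finite[OF dual_basisD(1)[OF assms]] by blast
  then show thesis
    using dual_basis_reindex[OF assms, of g "{..<card K}"] that by (simp add: atLeast0LessThan)
qed

text \<open>Only finitely many coordinates of the ambient free module are non-zero on a finitely generated
  summand; the projections of the corresponding unit vectors form the dual basis.\<close>

lemma (in ring) fg_projective_dual_basis:
  fixes M :: "('a, 'c, 'm) module_scheme"
  assumes "fg_projective R M"
  obtains n :: nat and y \<phi> where "dual_basis R M {..<n} y \<phi>"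
proof -
  from assms obtain X :: "'c set" and N :: "('a, 'c \<Rightarrow> 'a) module" where
    M: "left_module R M" and N: "left_module R N" and iso: "module_iso R (module_sum M N) (free_module R X)"
    by (auto simp: fg_projective_def projective_module_def)
  interpret M: left_module R M by fact
  interpret N: left_module R N by fact
  interpret S: left_module R "module_sum M N" using M N by (rule left_module_sum)
  let ?F = "free_module R X"
  interpret F: left_module R ?F by (rule left_module_free)
  obtain S where S: "finite S" "S \<subseteq> carrier M"
    and gen: "\<And>x. x \<in> carrier M \<Longrightarrow> \<exists>a\<in>S \<rightarrow> carrier R. x = (\<Oplus>\<^bsub>M\<^esub>s\<in>S. a s \<odot>\<^bsub>M\<^esub> s)"
    using assms by (auto simp: fg_projective_def finitely_generated_def)
  obtain h where h: "bij_betw h (carrier (module_sum M N)) (carrier ?F)" "left_linear R (module_sum M N) ?F h"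
    using iso by (rule module_isoE)
  have "left_linear R M (module_sum M N) (\<lambda>x. (x, \<zero>\<^bsub>N\<^esub>))"
    by (auto simp: left_linear_def)
  then have e: "left_linear R M ?F (\<lambda>x. h (x, \<zero>\<^bsub>N\<^esub>))"
    using h(2) by (rule left_linear_comp)
  define g where "g = (\<lambda>f. fst (the_inv_into (carrier (module_sum M N)) h f))"
  have "left_linear R (module_sum M N) M fst"
    by (auto simp: left_linear_def)
  then have g: "left_linear R ?F M g"
    unfolding g_def by (rule left_linear_comp[OF S.left_linear_the_inv_into[OF h]])
  have ge: "g (h (x, \<zero>\<^bsub>N\<^esub>)) = x" if "x \<in> carrier M" for x
    using that h(1) by (simp add: g_def the_inv_into_f_f bij_betw_def)
  define supp where "supp = (\<lambda>f :: 'c \<Rightarrow> 'a. {k. f k \<noteq> \<zero>})"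
  define U where "U = (\<Union>s\<in>S. supp (h (s, \<zero>\<^bsub>N\<^esub>)))"
  have e_val: "h (x, \<zero>\<^bsub>N\<^esub>) \<in> carrier ?F" if "x \<in> carrier M" for x
    using left_linearD(1)[OF e] that by simp
  have U: "finite U" "U \<subseteq> X"
    using S e_val by (auto simp: U_def supp_def subset_iff)
  have FU: "h (x, \<zero>\<^bsub>N\<^esub>) \<in> {f \<in> carrier ?F. supp f \<subseteq> U}" if x: "x \<in> carrier M" for x
  proof -
    obtain a where a: "a \<in> S \<rightarrow> carrier R" and xa: "x = (\<Oplus>\<^bsub>M\<^esub>s\<in>S. a s \<odot>\<^bsub>M\<^esub> s)"
      using gen[OF x] by blast
    have "h (x, \<zero>\<^bsub>N\<^esub>) = (\<Oplus>\<^bsub>?F\<^esub>s\<in>S. h (a s \<odot>\<^bsub>M\<^esub> s, \<zero>\<^bsub>N\<^esub>))"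
      unfolding xa by (rule M.left_linear_finsum[OF F.left_module_self e S(1)])
        (use a S in \<open>auto intro!: M.smult_closed\<close>)
    also have "\<dots> \<in> {f \<in> carrier ?F. supp f \<subseteq> U}"
    proof (rule F.finsum_submodule)
      show "f \<oplus>\<^bsub>?F\<^esub> f' \<in> {f \<in> carrier ?F. supp f \<subseteq> U}"
        if f: "f \<in> {f \<in> carrier ?F. supp f \<subseteq> U}" "f' \<in> {f \<in> carrier ?F. supp f \<subseteq> U}" for f f'
      proof -
        have "supp (f \<oplus>\<^bsub>?F\<^esub> f') \<subseteq> supp f \<union> supp f'" by (auto simp: supp_def)
        then show ?thesis using f F.M.a_closed[of f f'] by (auto simp del: free_module_simps)
      qed
      show "h (a s \<odot>\<^bsub>M\<^esub> s, \<zero>\<^bsub>N\<^esub>) \<in> {f \<in> carrier ?F. supp f \<subseteq> U}" if s: "s \<in> S" for s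
      proof -
        have as: "a s \<in> carrier R" "s \<in> carrier M" using a S s by auto
        have "h (a s \<odot>\<^bsub>M\<^esub> s, \<zero>\<^bsub>N\<^esub>) = a s \<odot>\<^bsub>?F\<^esub> h (s, \<zero>\<^bsub>N\<^esub>)"
          using left_linearD(3)[OF e as] .
        moreover have "supp (a s \<odot>\<^bsub>?F\<^esub> h (s, \<zero>\<^bsub>N\<^esub>)) \<subseteq> supp (h (s, \<zero>\<^bsub>N\<^esub>))"
          using as by (auto simp: supp_def)
        ultimately show ?thesis
          using s as e_val[of "a s \<odot>\<^bsub>M\<^esub> s"] M.smult_closed by (auto simp: U_def simp del: free_module_simps)
      qed
    qed (auto simp: supp_def)
    finally show ?thesis .
  qed
  define \<delta> where "\<delta> = (\<lambda>(k :: 'c) j. if j = k then \<one> else \<zero>)"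
  have \<delta>: "\<delta> k \<in> carrier ?F" if "k \<in> X" for k
    using that by (auto simp: \<delta>_def intro: finite_subset[of _ "{k}"])
  have expand: "g f = (\<Oplus>\<^bsub>M\<^esub>k\<in>V. f k \<odot>\<^bsub>M\<^esub> g (\<delta> k))"
    if "finite V" "V \<subseteq> X" "f \<in> carrier ?F" "supp f \<subseteq> V" for f V
    using that
  proof (induction V arbitrary: f)
    case empty
    then have "f = \<zero>\<^bsub>?F\<^esub>" by (auto simp: supp_def)
    then show ?case using F.left_linear_zero[OF M g] by simp
  next
    case (insert k V)
    define f' where "f' = f(k := \<zero>)"
    have fv: "f j \<in> carrier R" for j using insert by auto
    have "{x. f' x \<noteq> \<zero>} \<subseteq> {x. f x \<noteq> \<zero>}" by (auto simp: f'_def)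
    moreover have "supp f' \<subseteq> V" using insert.prems(3) by (auto simp: f'_def supp_def)
    ultimately have f': "f' \<in> carrier ?F" "supp f' \<subseteq> V"
      using insert.prems fv by (auto simp: f'_def intro: finite_subset)
    have fdec: "f = (f k \<odot>\<^bsub>?F\<^esub> \<delta> k) \<oplus>\<^bsub>?F\<^esub> f'"
      using fv by (auto simp: f'_def \<delta>_def fun_eq_iff)
    have k: "k \<in> X" "V \<subseteq> X" using insert by auto
    have gd: "g (\<delta> j) \<in> carrier M" if "j \<in> X" for j
      using \<delta>[OF that] left_linearD(1)[OF g] by blast
    have fk: "f k \<odot>\<^bsub>?F\<^esub> \<delta> k \<in> carrier ?F"
      using F.smult_closed[OF fv \<delta>[OF k(1)]] .
    have "g f = f k \<odot>\<^bsub>M\<^esub> g (\<delta> k) \<oplus>\<^bsub>M\<^esub> g f'"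
      by (subst fdec) (simp only: left_linearD(2)[OF g fk f'(1)] left_linearD(3)[OF g fv \<delta>[OF k(1)]])
    also have "g f' = (\<Oplus>\<^bsub>M\<^esub>j\<in>V. f' j \<odot>\<^bsub>M\<^esub> g (\<delta> j))"
      using insert.IH[OF k(2) f'] .
    also have "\<dots> = (\<Oplus>\<^bsub>M\<^esub>j\<in>V. f j \<odot>\<^bsub>M\<^esub> g (\<delta> j))"
      using fv gd k insert.hyps by (intro M.M.finsum_cong') (auto simp: f'_def intro!: M.smult_closed)
    finally show ?case
      using insert.hyps fv gd k by (subst M.M.finsum_insert) (auto intro!: M.smult_closed)
  qed
  have coord: "left_linear R ?F (regular_module R) (\<lambda>f. f k)" for k
    by (auto simp: left_linear_def)
  have "dual_basis R M U (\<lambda>k. g (\<delta> k)) (\<lambda>k x. h (x, \<zero>\<^bsub>N\<^esub>) k)"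
    unfolding dual_basis_def
  proof (intro conjI ballI)
    show "g (\<delta> k) \<in> carrier M" if "k \<in> U" for k
      using left_linearD(1)[OF g \<delta>] that U by auto
    show "functional R M (\<lambda>x. h (x, \<zero>\<^bsub>N\<^esub>) k)" for k
      by (rule left_linear_comp[OF e coord])
    show "x = (\<Oplus>\<^bsub>M\<^esub>k\<in>U. h (x, \<zero>\<^bsub>N\<^esub>) k \<odot>\<^bsub>M\<^esub> g (\<delta> k))" if "x \<in> carrier M" for x
      using expand[OF U, of "h (x, \<zero>\<^bsub>N\<^esub>)"] FU[OF that] ge[OF that] by simp
  qed (rule U)
  from M.dual_basis_nat[OF this] show thesis using that by blast
qed

text \<open>An infinite type of scalars makes the type \<open>nat \<Rightarrow> 'a\<close>, on which the representatives of isomorphism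
  classes live, large enough for free modules of any finite rank.\<close>

locale infinite_ring = ring R for R :: "('a, 'r) ring_scheme" (structure) +
  assumes infinite_type: "infinite (UNIV :: 'a set)"
begin

lemma infinite_fun: "infinite (UNIV :: (nat \<Rightarrow> 'a) set)"
proof
  assume "finite (UNIV :: (nat \<Rightarrow> 'a) set)"
  then have "finite ((\<lambda>f. f 0) ` (UNIV :: (nat \<Rightarrow> 'a) set))" by (rule finite_imageI)
  also have "(\<lambda>f. f 0) ` (UNIV :: (nat \<Rightarrow> 'a) set) = UNIV"
    by (auto intro: image_eqI[of _ _ "\<lambda>_. _"])
  finally show False using infinite_type by simp
qed

text \<open>Coordinates with respect to a dual basis move a module of any type to the type over which isomorphism
  classes range. This makes the isomorphism class of every finitely generated projective module non-empty.\<close>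

lemma fg_projective_representative:
  assumes "left_module R M" "dual_basis R M K y \<phi>"
  obtains N :: "('a, nat \<Rightarrow> 'a) module" where "fg_projective R N" "module_iso R M N"
proof -
  interpret M: left_module R M by fact
  obtain n :: nat and y \<phi> where D': "dual_basis R M {..<n} y \<phi>"
    using M.dual_basis_nat[OF assms(2)] .
  note D = M.dual_basisD[OF D']
  define e where "e = (\<lambda>x k. if k < n then \<phi> k x else \<zero>)"
  define N where "N = (free_module R (UNIV :: nat set))\<lparr>carrier := e ` carrier M\<rparr>"
  have val: "\<phi> k x \<in> carrier R" if "k < n" "x \<in> carrier M" for k x using D(4) that by simp
  have "inj_on e (carrier M)"
  proof (rule inj_onI)
    fix x x' assume x: "x \<in> carrier M" "x' \<in> carrier M" "e x = e x'"
    have "\<phi> k x = \<phi> k x'" if "k < n" for k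
      using fun_cong[OF x(3), of k] that by (simp add: e_def)
    then have "(\<Oplus>\<^bsub>M\<^esub>k\<in>{..<n}. \<phi> k x \<odot>\<^bsub>M\<^esub> y k) = (\<Oplus>\<^bsub>M\<^esub>k\<in>{..<n}. \<phi> k x' \<odot>\<^bsub>M\<^esub> y k)"
      using D(2) val x by (intro M.M.finsum_cong') (auto intro!: M.smult_closed)
    then show "x = x'" using D(5) x by simp
  qed
  then have bij: "bij_betw e (carrier M) (carrier N)"
    by (simp add: N_def bij_betw_def)
  have lin: "left_linear R M N e"
    using left_linearD(2,3)[OF D(3)] val
    by (intro left_linearI) (auto simp: N_def e_def fun_eq_iff)
  have "e \<zero>\<^bsub>M\<^esub> = \<zero>\<^bsub>N\<^esub>"
    using M.left_linear_zero[OF left_module_regular D(3)] by (auto simp: N_def e_def)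
  then have N: "left_module R N" by (rule M.left_module_transport[OF bij lin])
  have iso: "module_iso R M N" using bij lin by (rule module_isoI)
  have "dual_basis R N {..<n} (\<lambda>k. e (y k)) (\<lambda>k x. \<phi> k (the_inv_into (carrier M) e x))"
    by (rule M.dual_basis_transport[OF N lin M.left_linear_the_inv_into[OF bij lin] _ D'])
      (use bij in \<open>simp add: f_the_inv_into_f_bij_betw\<close>)
  then have "fg_projective R N"
    by (rule fg_projectiveI[OF N _ infinite_fun])
  then show thesis using iso by (rule that)
qed

lemma fg_projective_left_module: "fg_projective R M \<Longrightarrow> left_module R M"
  by (simp add: fg_projective_def projective_module_def)

lemma infinite_Times_type:
  assumes "infinite (UNIV :: 'b set)"
  shows "infinite (UNIV :: ('b \<times> 'c) set)"
  using assms finite_prod by metis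

lemma fg_projective_sum:
  fixes M :: "('a, 'b, 'm) module_scheme"
  assumes "fg_projective R M" "fg_projective R N" "infinite (UNIV :: 'b set)"
  shows "fg_projective R (module_sum M N)"
proof -
  note lm = fg_projective_left_module[OF assms(1)] fg_projective_left_module[OF assms(2)]
  obtain n :: nat and y \<phi> where D: "dual_basis R M {..<n} y \<phi>"
    using fg_projective_dual_basis[OF assms(1)] .
  obtain m :: nat and z \<psi> where D': "dual_basis R N {..<m} z \<psi>"
    using fg_projective_dual_basis[OF assms(2)] .
  show ?thesis
    by (rule fg_projectiveI[OF left_module_sum[OF lm] dual_basis_sum[OF lm D D'] infinite_Times_type[OF assms(3)]])
qed

end

section \<open>The group of differences of a commutative monoid\<close>

context comm_monoid
begin

abbreviation diff_class :: "'a \<Rightarrow> 'a \<Rightarrow> ('a \<times> 'a) set" where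
  "diff_class a b \<equiv> grothendieck_rel G `` {(a, b)}"

lemma grothendieck_rel_iff:
  "((a, b), (c, d)) \<in> grothendieck_rel G \<longleftrightarrow> a \<in> carrier G \<and> b \<in> carrier G \<and> c \<in> carrier G \<and> d \<in> carrier G \<and>
     (\<exists>k\<in>carrier G. a \<otimes> d \<otimes> k = c \<otimes> b \<otimes> k)"
  by (auto simp: grothendieck_rel_def)

lemma equiv_grothendieck_rel: "equiv (carrier G \<times> carrier G) (grothendieck_rel G)"
proof (rule equivI)
  show "grothendieck_rel G \<subseteq> (carrier G \<times> carrier G) \<times> (carrier G \<times> carrier G)"
    by (auto simp: grothendieck_rel_def)
  show "refl_on (carrier G \<times> carrier G) (grothendieck_rel G)"
    by (auto simp: refl_on_def grothendieck_rel_iff)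
  show "sym (grothendieck_rel G)"
  proof (rule symI, clarify)
    fix a b c d assume "((a, b), (c, d)) \<in> grothendieck_rel G"
    then show "((c, d), (a, b)) \<in> grothendieck_rel G"
      unfolding grothendieck_rel_iff by metis
  qed
  show "trans (grothendieck_rel G)"
  proof (rule transI, clarify)
    fix a b c d e f
    assume "((a, b), (c, d)) \<in> grothendieck_rel G" "((c, d), (e, f)) \<in> grothendieck_rel G"
    then obtain k k' where *: "a \<in> carrier G" "b \<in> carrier G" "c \<in> carrier G" "d \<in> carrier G" "e \<in> carrier G"
        "f \<in> carrier G" "k \<in> carrier G" "k' \<in> carrier G"
      and eq: "a \<otimes> d \<otimes> k = c \<otimes> b \<otimes> k" "c \<otimes> f \<otimes> k' = e \<otimes> d \<otimes> k'"
      unfolding grothendieck_rel_iff by metis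
    have "a \<otimes> f \<otimes> (d \<otimes> k \<otimes> k') = (a \<otimes> d \<otimes> k) \<otimes> (f \<otimes> k')"
      using * by (simp add: m_ac)
    also have "\<dots> = (c \<otimes> f \<otimes> k') \<otimes> (b \<otimes> k)"
      unfolding eq(1) using * by (simp add: m_ac)
    also have "\<dots> = e \<otimes> b \<otimes> (d \<otimes> k \<otimes> k')"
      unfolding eq(2) using * by (simp add: m_ac)
    finally show "((a, b), (e, f)) \<in> grothendieck_rel G"
      unfolding grothendieck_rel_iff using * by (intro conjI bexI[of _ "d \<otimes> k \<otimes> k'"]) auto
  qed
qed

lemma diff_class_eqI:
  assumes "a \<in> carrier G" "b \<in> carrier G" "c \<in> carrier G" "d \<in> carrier G" "a \<otimes> d = c \<otimes> b"
  shows "diff_class a b = diff_class c d"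
  by (rule equiv_class_eq[OF equiv_grothendieck_rel]) (use assms in \<open>auto simp: grothendieck_rel_iff intro!: bexI[of _ \<one>]\<close>)

lemma grothendieck_mult:
  assumes "a \<in> carrier G" "b \<in> carrier G" "c \<in> carrier G" "d \<in> carrier G"
  shows "diff_class a b \<otimes>\<^bsub>grothendieck_group G\<^esub> diff_class c d = diff_class (a \<otimes> c) (b \<otimes> d)"
proof -
  have const: "diff_class (a' \<otimes> c') (b' \<otimes> d') = diff_class (a \<otimes> c) (b \<otimes> d)"
    if ab: "(a', b') \<in> diff_class a b" and cd: "(c', d') \<in> diff_class c d" for a' b' c' d'
  proof -
    obtain k l where *: "a' \<in> carrier G" "b' \<in> carrier G" "c' \<in> carrier G" "d' \<in> carrier G"
        "k \<in> carrier G" "l \<in> carrier G"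
      and eq: "a \<otimes> b' \<otimes> k = a' \<otimes> b \<otimes> k" "c \<otimes> d' \<otimes> l = c' \<otimes> d \<otimes> l"
      using ab cd by (auto simp: grothendieck_rel_iff)
    have "a \<otimes> c \<otimes> (b' \<otimes> d') \<otimes> (k \<otimes> l) = (a \<otimes> b' \<otimes> k) \<otimes> (c \<otimes> d' \<otimes> l)"
      using * assms by (simp add: m_ac)
    also have "\<dots> = a' \<otimes> c' \<otimes> (b \<otimes> d) \<otimes> (k \<otimes> l)"
      unfolding eq using * assms by (simp add: m_ac)
    finally have "((a \<otimes> c, b \<otimes> d), (a' \<otimes> c', b' \<otimes> d')) \<in> grothendieck_rel G"
      unfolding grothendieck_rel_iff using * assms by (intro conjI bexI[of _ "k \<otimes> l"]) auto
    then show ?thesis by (rule equiv_class_eq[OF equiv_grothendieck_rel, symmetric])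
  qed
  have self: "(a, b) \<in> diff_class a b" "(c, d) \<in> diff_class c d"
    using assms equiv_class_self[OF equiv_grothendieck_rel] by auto
  have "diff_class a b \<otimes>\<^bsub>grothendieck_group G\<^esub> diff_class c d
      = (\<Union>(a', b')\<in>diff_class a b. \<Union>(c', d')\<in>diff_class c d. diff_class (a' \<otimes> c') (b' \<otimes> d'))"
    by (simp add: grothendieck_group_def)
  also have "\<dots> = (\<Union>_\<in>diff_class a b. \<Union>_\<in>diff_class c d. diff_class (a \<otimes> c) (b \<otimes> d))"
  proof (intro SUP_cong refl)
    fix x assume "x \<in> diff_class a b"
    then have "diff_class (fst x \<otimes> fst y) (snd x \<otimes> snd y) = diff_class (a \<otimes> c) (b \<otimes> d)"
      if "y \<in> diff_class c d" for y
      using that by (intro const) simp_all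
    then have "(\<Union>y\<in>diff_class c d. diff_class (fst x \<otimes> fst y) (snd x \<otimes> snd y))
        = (\<Union>_\<in>diff_class c d. diff_class (a \<otimes> c) (b \<otimes> d))"
      by (intro SUP_cong refl)
    then show "(case x of (a', b') \<Rightarrow> \<Union>(c', d')\<in>diff_class c d. diff_class (a' \<otimes> c') (b' \<otimes> d'))
        = (\<Union>_\<in>diff_class c d. diff_class (a \<otimes> c) (b \<otimes> d))"
      by (simp add: case_prod_unfold)
  qed
  also have "\<dots> = diff_class (a \<otimes> c) (b \<otimes> d)"
    using self by blast
  finally show ?thesis .
qed

lemma diff_class_closed:
  "\<lbrakk>a \<in> carrier G; b \<in> carrier G\<rbrakk> \<Longrightarrow> diff_class a b \<in> carrier (grothendieck_group G)"
  by (auto simp: grothendieck_group_def intro: quotientI)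

lemma grothendieck_carrierE:
  assumes "x \<in> carrier (grothendieck_group G)"
  obtains a b where "a \<in> carrier G" "b \<in> carrier G" "x = diff_class a b"
  using assms by (auto simp: grothendieck_group_def elim!: quotientE)

lemma grothendieck_one: "\<one>\<^bsub>grothendieck_group G\<^esub> = diff_class \<one> \<one>"
  by (simp add: grothendieck_group_def)

lemma grothendieck_mult_swap:
  assumes "a \<in> carrier G" "b \<in> carrier G"
  shows "diff_class b a \<otimes>\<^bsub>grothendieck_group G\<^esub> diff_class a b = \<one>\<^bsub>grothendieck_group G\<^esub>"
  unfolding grothendieck_mult[OF assms(2,1,1,2)] grothendieck_one
  by (rule diff_class_eqI) (use assms in \<open>simp_all add: m_comm\<close>)

lemma comm_group_grothendieck: "comm_group (grothendieck_group G)"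
proof (rule comm_groupI)
  fix x y z assume x: "x \<in> carrier (grothendieck_group G)"
  then obtain a b where ab: "a \<in> carrier G" "b \<in> carrier G" "x = diff_class a b"
    by (rule grothendieck_carrierE)
  show "\<one>\<^bsub>grothendieck_group G\<^esub> \<otimes>\<^bsub>grothendieck_group G\<^esub> x = x"
    using ab by (simp add: grothendieck_one grothendieck_mult)
  show "\<exists>y\<in>carrier (grothendieck_group G). y \<otimes>\<^bsub>grothendieck_group G\<^esub> x = \<one>\<^bsub>grothendieck_group G\<^esub>"
    using ab grothendieck_mult_swap[of a b] diff_class_closed[of b a] by blast
  assume y: "y \<in> carrier (grothendieck_group G)"
  then obtain c d where cd: "c \<in> carrier G" "d \<in> carrier G" "y = diff_class c d"
    by (rule grothendieck_carrierE)
  show "x \<otimes>\<^bsub>grothendieck_group G\<^esub> y \<in> carrier (grothendieck_group G)"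
    "x \<otimes>\<^bsub>grothendieck_group G\<^esub> y = y \<otimes>\<^bsub>grothendieck_group G\<^esub> x"
    using ab cd by (simp_all add: grothendieck_mult diff_class_closed m_comm)
  assume z: "z \<in> carrier (grothendieck_group G)"
  then obtain e f where ef: "e \<in> carrier G" "f \<in> carrier G" "z = diff_class e f"
    by (rule grothendieck_carrierE)
  show "x \<otimes>\<^bsub>grothendieck_group G\<^esub> y \<otimes>\<^bsub>grothendieck_group G\<^esub> z
      = x \<otimes>\<^bsub>grothendieck_group G\<^esub> (y \<otimes>\<^bsub>grothendieck_group G\<^esub> z)"
    using ab cd ef by (simp add: grothendieck_mult m_assoc)
qed (simp add: grothendieck_one diff_class_closed)

lemma grothendieck_inv:
  assumes "a \<in> carrier G" "b \<in> carrier G"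
  shows "inv\<^bsub>grothendieck_group G\<^esub> (diff_class a b) = diff_class b a"
proof -
  interpret K: comm_group "grothendieck_group G" by (rule comm_group_grothendieck)
  show ?thesis
    by (rule K.inv_equality[OF grothendieck_mult_swap[OF assms]])
      (use assms in \<open>auto intro: diff_class_closed\<close>)
qed

end

section \<open>The group \<open>K\<^sub>0\<close>\<close>

context infinite_ring
begin

lemma iso_class_nonempty:
  assumes "fg_projective R M"
  obtains N :: "('a, nat \<Rightarrow> 'a) module" where "fg_projective R N" "module_iso R M N" "N \<in> iso_class R M"
proof -
  obtain n :: nat and y \<phi> where D: "dual_basis R M {..<n} y \<phi>"
    using fg_projective_dual_basis[OF assms] .
  show ?thesis
    using fg_projective_representative[OF fg_projective_left_module[OF assms] D] that
    by (auto simp: iso_class_def)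
qed

lemma iso_class_eqI:
  assumes "fg_projective R M" "fg_projective R N" "module_iso R M N"
  shows "iso_class R M = iso_class R N"
proof -
  note iso = assms(3) module_iso_sym[OF fg_projective_left_module[OF assms(1)] assms(3)]
  show ?thesis
    using iso by (auto simp: iso_class_def intro: module_iso_trans)
qed

lemma iso_class_in_carrier:
  assumes "fg_projective R M"
  shows "iso_class R M \<in> carrier (proj_monoid R)"
proof -
  obtain N :: "('a, nat \<Rightarrow> 'a) module" where N: "fg_projective R N" "module_iso R M N"
    using iso_class_nonempty[OF assms] .
  then show ?thesis
    using iso_class_eqI[OF assms N] by (simp add: proj_monoid_def)
qed

lemma proj_monoid_carrierE:
  assumes "C \<in> carrier (proj_monoid R)"
  obtains M :: "('a, nat \<Rightarrow> 'a) module" where "fg_projective R M" "C = iso_class R M"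
  using assms by (auto simp: proj_monoid_def)

lemma infinite_fun_times: "infinite (UNIV :: ((nat \<Rightarrow> 'a) \<times> 'x) set)"
  by (rule infinite_Times_type[OF infinite_fun])

lemma proj_mult:
  fixes M :: "('a, 'b, 'm) module_scheme" and N :: "('a, 'c, 'n) module_scheme"
  assumes M: "fg_projective R M" and N: "fg_projective R N" and inf: "infinite (UNIV :: 'b set)"
  shows "iso_class R M \<otimes>\<^bsub>proj_monoid R\<^esub> iso_class R N = iso_class R (module_sum M N)"
proof -
  have const: "iso_class R (module_sum M' N') = iso_class R (module_sum M N)"
    if "M' \<in> iso_class R M" "N' \<in> iso_class R N" for M' N' :: "('a, nat \<Rightarrow> 'a) module"
  proof -
    have "fg_projective R M'" "fg_projective R N'" "module_iso R M M'" "module_iso R N N'"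
      using that by (auto simp: iso_class_def)
    then show ?thesis
      by (intro iso_class_eqI[symmetric] fg_projective_sum[OF M N inf] fg_projective_sum[OF _ _ infinite_fun]
          module_iso_sum)
  qed
  obtain M' where M': "M' \<in> iso_class R M" using iso_class_nonempty[OF M] .
  obtain N' where N': "N' \<in> iso_class R N" using iso_class_nonempty[OF N] .
  have "iso_class R M \<otimes>\<^bsub>proj_monoid R\<^esub> iso_class R N
      = (\<Union>M'\<in>iso_class R M. \<Union>N'\<in>iso_class R N. iso_class R (module_sum M' N'))"
    by (simp add: proj_monoid_def)
  also have "\<dots> = (\<Union>_\<in>iso_class R M. \<Union>_\<in>iso_class R N. iso_class R (module_sum M N))"
    using const by (intro SUP_cong refl)
  also have "\<dots> = iso_class R (module_sum M N)"
    using M' N' by blast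
  finally show ?thesis .
qed

lemma fg_projective_zero:
  fixes M :: "('a, 'c, 'm) module_scheme"
  assumes "left_module R M" "carrier M = {\<zero>\<^bsub>M\<^esub>}" "infinite (UNIV :: 'c set)"
  shows "fg_projective R M"
proof -
  interpret M: left_module R M by fact
  have "dual_basis R M ({} :: nat set) (\<lambda>_. undefined) (\<lambda>_. undefined)"
    using assms(2) by (auto simp: dual_basis_def)
  then show ?thesis by (rule fg_projectiveI[OF assms(1) _ assms(3)])
qed

abbreviation "zero_module \<equiv> free_module R ({} :: nat set)"

lemma zero_module: "left_module R zero_module" "carrier zero_module = {\<zero>\<^bsub>zero_module\<^esub>}"
    "fg_projective R zero_module"
proof -
  show lm: "left_module R zero_module" by (rule left_module_free)
  show c: "carrier zero_module = {\<zero>\<^bsub>zero_module\<^esub>}" by auto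
  show "fg_projective R zero_module" by (rule fg_projective_zero[OF lm c infinite_fun])
qed

lemma proj_one: "\<one>\<^bsub>proj_monoid R\<^esub> = iso_class R zero_module"
  by (simp add: proj_monoid_def)

lemma comm_monoid_proj_monoid: "comm_monoid (proj_monoid R)"
proof (rule comm_monoidI)
  fix x y z assume "x \<in> carrier (proj_monoid R)" "y \<in> carrier (proj_monoid R)" "z \<in> carrier (proj_monoid R)"
  then obtain M N P :: "('a, nat \<Rightarrow> 'a) module" where
    fg: "fg_projective R M" "fg_projective R N" "fg_projective R P"
    and eq: "x = iso_class R M" "y = iso_class R N" "z = iso_class R P"
    by (elim proj_monoid_carrierE)
  note sums = fg_projective_sum[OF fg(1,2) infinite_fun] fg_projective_sum[OF fg(2,3) infinite_fun]
  show "x \<otimes>\<^bsub>proj_monoid R\<^esub> y \<otimes>\<^bsub>proj_monoid R\<^esub> z = x \<otimes>\<^bsub>proj_monoid R\<^esub> (y \<otimes>\<^bsub>proj_monoid R\<^esub> z)"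
    unfolding eq proj_mult[OF fg(1,2) infinite_fun] proj_mult[OF fg(2,3) infinite_fun]
      proj_mult[OF sums(1) fg(3) infinite_fun_times] proj_mult[OF fg(1) sums(2) infinite_fun]
    by (rule iso_class_eqI[OF fg_projective_sum[OF sums(1) fg(3) infinite_fun_times]
          fg_projective_sum[OF fg(1) sums(2) infinite_fun] module_iso_sum_assoc])
next
  fix x y assume "x \<in> carrier (proj_monoid R)" "y \<in> carrier (proj_monoid R)"
  then obtain M N :: "('a, nat \<Rightarrow> 'a) module" where
    fg: "fg_projective R M" "fg_projective R N" and eq: "x = iso_class R M" "y = iso_class R N"
    by (elim proj_monoid_carrierE)
  note sums = fg_projective_sum[OF fg(1,2) infinite_fun] fg_projective_sum[OF fg(2,1) infinite_fun]
  show "x \<otimes>\<^bsub>proj_monoid R\<^esub> y \<in> carrier (proj_monoid R)"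
    unfolding eq proj_mult[OF fg(1,2) infinite_fun] by (rule iso_class_in_carrier[OF sums(1)])
  show "x \<otimes>\<^bsub>proj_monoid R\<^esub> y = y \<otimes>\<^bsub>proj_monoid R\<^esub> x"
    unfolding eq proj_mult[OF fg(1,2) infinite_fun] proj_mult[OF fg(2,1) infinite_fun]
    by (rule iso_class_eqI[OF sums module_iso_sum_commute])
next
  fix x assume "x \<in> carrier (proj_monoid R)"
  then obtain M :: "('a, nat \<Rightarrow> 'a) module" where fg: "fg_projective R M" and eq: "x = iso_class R M"
    by (elim proj_monoid_carrierE)
  show "\<one>\<^bsub>proj_monoid R\<^esub> \<otimes>\<^bsub>proj_monoid R\<^esub> x = x"
    unfolding eq proj_one proj_mult[OF zero_module(3) fg infinite_fun]
    by (rule iso_class_eqI[OF fg_projective_sum[OF zero_module(3) fg infinite_fun] fg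
          module_iso_sum_zero[OF fg_projective_left_module[OF fg] zero_module(1,2)]])
next
  show "\<one>\<^bsub>proj_monoid R\<^esub> \<in> carrier (proj_monoid R)"
    unfolding proj_one by (rule iso_class_in_carrier[OF zero_module(3)])
qed

sublocale V: comm_monoid "proj_monoid R"
  by (rule comm_monoid_proj_monoid)

sublocale K: comm_group "K0 R"
  unfolding K0_def by (rule V.comm_group_grothendieck)

lemma K0_class_closed: "fg_projective R M \<Longrightarrow> K0_class R M \<in> carrier (K0 R)"
  unfolding K0_class_def K0_def by (intro V.diff_class_closed iso_class_in_carrier V.one_closed)

lemma K0_carrierE:
  assumes "x \<in> carrier (K0 R)"
  obtains M N :: "('a, nat \<Rightarrow> 'a) module"
  where "fg_projective R M" "fg_projective R N" "x = K0_class R M \<otimes>\<^bsub>K0 R\<^esub> inv\<^bsub>K0 R\<^esub> K0_class R N"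
proof -
  obtain a b where ab: "a \<in> carrier (proj_monoid R)" "b \<in> carrier (proj_monoid R)" "x = V.diff_class a b"
    using assms unfolding K0_def by (rule V.grothendieck_carrierE)
  obtain M N :: "('a, nat \<Rightarrow> 'a) module" where
    "fg_projective R M" "fg_projective R N" "a = iso_class R M" "b = iso_class R N"
    using ab by (elim proj_monoid_carrierE)
  then show thesis
    using ab by (intro that[of M N]) (simp_all add: K0_class_def K0_def V.grothendieck_inv V.grothendieck_mult)
qed

lemma K0_class_sum:
  fixes A :: "('a, 'b, 'm) module_scheme"
  assumes M: "fg_projective R M" and A: "fg_projective R A" and B: "fg_projective R B"
    and iso: "module_iso R M (module_sum A B)" and inf: "infinite (UNIV :: 'b set)"
  shows "K0_class R M = K0_class R A \<otimes>\<^bsub>K0 R\<^esub> K0_class R B"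
proof -
  have "iso_class R M = iso_class R A \<otimes>\<^bsub>proj_monoid R\<^esub> iso_class R B"
    unfolding proj_mult[OF A B inf] by (rule iso_class_eqI[OF M fg_projective_sum[OF A B inf] iso])
  then show ?thesis
    using iso_class_in_carrier[OF A] iso_class_in_carrier[OF B]
    by (simp add: K0_class_def K0_def V.grothendieck_mult)
qed

lemma K0_class_iso:
  assumes "fg_projective R M" "fg_projective R N" "module_iso R M N"
  shows "K0_class R M = K0_class R N"
  unfolding K0_class_def iso_class_eqI[OF assms] ..

lemma K0_class_zero:
  fixes M :: "('a, 'b, 'm) module_scheme"
  assumes "left_module R M" "carrier M = {\<zero>\<^bsub>M\<^esub>}" and inf: "infinite (UNIV :: 'b set)"
  shows "K0_class R M = \<one>\<^bsub>K0 R\<^esub>"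
proof -
  interpret M: left_module R M by fact
  have "module_iso R M zero_module"
    by (rule module_isoI_inverse[where f = "\<lambda>_ _. \<zero>" and g = "\<lambda>_. \<zero>\<^bsub>M\<^esub>"])
      (auto simp: left_linear_def assms(2))
  then have "iso_class R M = \<one>\<^bsub>proj_monoid R\<^esub>"
    unfolding proj_one by (rule iso_class_eqI[OF fg_projective_zero[OF assms] zero_module(3)])
  then show ?thesis by (simp add: K0_class_def K0_def V.grothendieck_one)
qed

end

section \<open>Splitting off modules generated by idempotents\<close>

definition corner_module :: "('a, 'r) ring_scheme \<Rightarrow> 'a \<Rightarrow> ('a, 'a) module" where
  "corner_module R a = (regular_module R)\<lparr>carrier := {x \<in> carrier R. x \<otimes>\<^bsub>R\<^esub> a = x}\<rparr>"

lemma corner_module_simps [simp]: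
  "carrier (corner_module R a) = {x \<in> carrier R. x \<otimes>\<^bsub>R\<^esub> a = x}" "zero (corner_module R a) = \<zero>\<^bsub>R\<^esub>"
  "add (corner_module R a) = (\<oplus>\<^bsub>R\<^esub>)" "smult (corner_module R a) = (\<otimes>\<^bsub>R\<^esub>)"
  by (simp_all add: corner_module_def)

text \<open>Spans of infinite sets occur, such as that of all products \<open>s x\<close> with \<open>s\<close> in an ideal and \<open>x\<close> in the
  module; an inductive set avoids choosing finite subfamilies.\<close>

inductive_set lin_span ::
    "('a, 'r) ring_scheme \<Rightarrow> ('a, 'b, 'm) module_scheme \<Rightarrow> 'b set \<Rightarrow> 'b set"
  for R and M and G where
  zero: "\<zero>\<^bsub>M\<^esub> \<in> lin_span R M G"
| step: "\<lbrakk>a \<in> carrier R; g \<in> G; x \<in> lin_span R M G\<rbrakk> \<Longrightarrow> a \<odot>\<^bsub>M\<^esub> g \<oplus>\<^bsub>M\<^esub> x \<in> lin_span R M G"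

context left_module
begin

lemma lin_span_minimal:
  assumes "x \<in> lin_span R M G" "\<zero>\<^bsub>M\<^esub> \<in> N"
    and "\<And>a g. \<lbrakk>a \<in> carrier R; g \<in> G\<rbrakk> \<Longrightarrow> a \<odot>\<^bsub>M\<^esub> g \<in> N"
    and "\<And>x y. \<lbrakk>x \<in> N; y \<in> N\<rbrakk> \<Longrightarrow> x \<oplus>\<^bsub>M\<^esub> y \<in> N"
  shows "x \<in> N"
  using assms(1) by induction (use assms in auto)

lemma lin_span_closed:
  assumes "G \<subseteq> carrier M" "x \<in> lin_span R M G"
  shows "x \<in> carrier M"
  using assms(2) by (rule lin_span_minimal) (use assms(1) in \<open>auto intro!: smult_closed\<close>)

lemma lin_span_smult:
  assumes "G \<subseteq> carrier M" "x \<in> lin_span R M G" "a \<in> carrier R"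
  shows "a \<odot>\<^bsub>M\<^esub> x \<in> lin_span R M G"
  using assms(2)
proof induction
  case zero
  show ?case using assms(3) lin_span.zero[of M R G] by simp
next
  case (step b g x)
  have "g \<in> carrier M" "x \<in> carrier M" using step assms(1) lin_span_closed by auto
  then have "a \<odot>\<^bsub>M\<^esub> (b \<odot>\<^bsub>M\<^esub> g \<oplus>\<^bsub>M\<^esub> x) = (a \<otimes> b) \<odot>\<^bsub>M\<^esub> g \<oplus>\<^bsub>M\<^esub> a \<odot>\<^bsub>M\<^esub> x"
    using step(1) assms(3) by (simp add: smult_r_distr smult_assoc smult_closed)
  then show ?case using step assms(3) by (simp add: lin_span.step)
qed

lemma lin_span_add:
  assumes "G \<subseteq> carrier M" "x \<in> lin_span R M G" "y \<in> lin_span R M G"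
  shows "x \<oplus>\<^bsub>M\<^esub> y \<in> lin_span R M G"
  using assms(2)
proof induction
  case zero
  show ?case using assms lin_span_closed by simp
next
  case (step b g x)
  have "g \<in> carrier M" "x \<in> carrier M" "y \<in> carrier M" using step assms lin_span_closed by auto
  then have "b \<odot>\<^bsub>M\<^esub> g \<oplus>\<^bsub>M\<^esub> x \<oplus>\<^bsub>M\<^esub> y = b \<odot>\<^bsub>M\<^esub> g \<oplus>\<^bsub>M\<^esub> (x \<oplus>\<^bsub>M\<^esub> y)"
    using step(1) by (simp add: M.a_assoc smult_closed)
  then show ?case using step by (simp add: lin_span.step)
qed

lemma lin_span_gen:
  assumes "G \<subseteq> carrier M" "g \<in> G"
  shows "g \<in> lin_span R M G"
  using lin_span.step[OF R.one_closed assms(2) lin_span.zero, of M] assms by (auto simp: smult_one)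

lemma lin_span_trans:
  assumes "G' \<subseteq> carrier M" "G \<subseteq> lin_span R M G'" "x \<in> lin_span R M G"
  shows "x \<in> lin_span R M G'"
  by (rule lin_span_minimal[OF assms(3)])
    (use assms in \<open>auto intro: lin_span.zero lin_span_add lin_span_smult\<close>)

lemma lin_span_mono:
  assumes "G \<subseteq> G'" "x \<in> lin_span R M G"
  shows "x \<in> lin_span R M G'"
  using assms(2) by induction (use assms(1) in \<open>auto intro: lin_span.intros\<close>)

lemma lin_span_linear_image:
  assumes "left_linear R M N f" "f \<zero>\<^bsub>M\<^esub> = \<zero>\<^bsub>N\<^esub>" "G \<subseteq> carrier M" "x \<in> lin_span R M G"
  shows "f x \<in> lin_span R N (f ` G)"
  using assms(4)
proof induction
  case zero
  show ?case using assms(2) lin_span.zero[of N R "f ` G"] by simp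
next
  case (step a g x)
  have "g \<in> carrier M" "x \<in> carrier M" using step assms(3) lin_span_closed by auto
  then have "f (a \<odot>\<^bsub>M\<^esub> g \<oplus>\<^bsub>M\<^esub> x) = a \<odot>\<^bsub>N\<^esub> f g \<oplus>\<^bsub>N\<^esub> f x"
    using left_linearD[OF assms(1)] step(1) by (simp add: smult_closed)
  then show ?case using step by (simp add: lin_span.step)
qed

lemma finsum_in_lin_span:
  assumes "G \<subseteq> carrier M" "\<And>i. i \<in> A \<Longrightarrow> f i \<in> lin_span R M G"
  shows "(\<Oplus>\<^bsub>M\<^esub>i\<in>A. f i) \<in> lin_span R M G"
  by (rule finsum_submodule) (use assms lin_span_closed in \<open>auto intro: lin_span.zero lin_span_add\<close>)

end

context infinite_ring
begin

lemma left_module_corner: "left_module R (corner_module R a)" if "a \<in> carrier R"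
proof -
  interpret left_module R "regular_module R" by (rule left_module_regular)
  show ?thesis
    unfolding corner_module_def
    by (rule left_module_submodule) (use that in \<open>auto simp: l_distr m_assoc\<close>)
qed

lemma fg_projective_corner:
  assumes a: "a \<in> carrier R" "a \<otimes> a = a"
  shows "fg_projective R (corner_module R a)"
proof -
  interpret C: left_module R "corner_module R a" using a(1) by (rule left_module_corner)
  have "dual_basis R (corner_module R a) {0 :: nat} (\<lambda>_. a) (\<lambda>_ x. x)"
    using a by (auto simp: dual_basis_def left_linear_def)
  then show ?thesis
    by (rule fg_projectiveI[OF C.left_module_self _ infinite_type])
qed

text \<open>If \<open>\<psi> v = a\<close> is idempotent, then \<open>x \<mapsto> \<psi> x v\<close> is an idempotent endomorphism of \<open>M\<close> with image
  \<open>R v \<cong> R a\<close>; the complementary projection carries a dual basis of \<open>M\<close> to one of the kernel of \<open>\<psi>\<close>.\<close>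

lemma split_off:
  fixes M :: "('a, 'b, 'm) module_scheme"
  assumes M: "left_module R M" and D: "dual_basis R M K y \<phi>" and inf: "infinite (UNIV :: 'b set)"
    and a: "a \<in> carrier R" "a \<otimes> a = a" and v: "v \<in> carrier M" "a \<odot>\<^bsub>M\<^esub> v = v"
    and f: "functional R M f" and z: "z \<in> carrier R" "f v \<otimes> z = a"
  obtains N :: "('a, 'b, 'm) module_scheme" and \<pi>
  where "left_module R N" "dual_basis R N K (\<lambda>k. \<pi> (y k)) \<phi>" "left_linear R M N \<pi>" "\<pi> v = \<zero>\<^bsub>N\<^esub>"
    "carrier N \<subseteq> carrier M" "\<And>x. x \<in> carrier N \<Longrightarrow> \<pi> x = x"
    "K0_class R M = K0_class R (corner_module R a) \<otimes>\<^bsub>K0 R\<^esub> K0_class R N"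
proof -
  interpret M: left_module R M by fact
  note D = M.dual_basisD[OF D]
  note fD = left_linearD[OF f, simplified]
  define \<psi> where "\<psi> = (\<lambda>x. f x \<otimes> z \<otimes> a)"
  have \<psi>: "functional R M \<psi>"
    unfolding \<psi>_def using fD z a by (intro left_linearI) (auto simp: l_distr m_assoc)
  note \<psi>D = left_linearD[OF \<psi>, simplified]
  have \<psi>v: "\<psi> v = a" using z a v fD by (simp add: \<psi>_def)
  have \<psi>a: "\<psi> x \<otimes> a = \<psi> x" if "x \<in> carrier M" for x
    using that fD z a by (simp add: \<psi>_def m_assoc)
  define N where "N = M\<lparr>carrier := {x \<in> carrier M. \<psi> x = \<zero>}\<rparr>"
  have \<psi>0: "\<psi> \<zero>\<^bsub>M\<^esub> = \<zero>" using M.left_linear_zero[OF left_module_regular \<psi>] by simp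
  have N: "left_module R N"
    unfolding N_def by (rule M.left_module_submodule) (use \<psi>D \<psi>0 in \<open>auto intro: M.smult_closed\<close>)
  have N_simps: "carrier N = {x \<in> carrier M. \<psi> x = \<zero>}" "zero N = \<zero>\<^bsub>M\<^esub>" "add N = add M" "smult N = smult M"
    by (simp_all add: N_def)
  interpret N: left_module R N by fact
  define \<pi> where "\<pi> = (\<lambda>x. x \<oplus>\<^bsub>M\<^esub> (\<ominus> \<psi> x) \<odot>\<^bsub>M\<^esub> v)"
  have \<pi>: "left_linear R M N \<pi>"
  proof (rule left_linearI)
    fix x assume x: "x \<in> carrier M"
    show "\<pi> x \<in> carrier N"
      using x \<psi>D v a \<psi>v \<psi>a[OF x] by (simp add: N_simps \<pi>_def M.smult_closed l_minus r_neg)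
    show "\<pi> (x \<oplus>\<^bsub>M\<^esub> x') = \<pi> x \<oplus>\<^bsub>N\<^esub> \<pi> x'" if "x' \<in> carrier M" for x'
      using x that \<psi>D v by (simp add: N_simps \<pi>_def M.smult_l_distr M.smult_closed minus_add M.M.add.m_ac)
    show "\<pi> (b \<odot>\<^bsub>M\<^esub> x) = b \<odot>\<^bsub>N\<^esub> \<pi> x" if "b \<in> carrier R" for b
      using x that \<psi>D v
      by (simp add: N_simps \<pi>_def M.smult_r_distr M.smult_closed M.smult_assoc[symmetric] r_minus)
  qed
  have \<pi>N: "\<pi> x = x" if "x \<in> carrier N" for x
    using that v by (simp add: N_simps \<pi>_def)
  have inc: "left_linear R N M (\<lambda>x. x)" by (auto simp: left_linear_def N_simps)
  have \<pi>v: "\<pi> v = \<zero>\<^bsub>N\<^esub>"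
    using v a by (simp add: \<pi>_def \<psi>v N_simps M.smult_minus M.M.r_neg)
  have DN: "dual_basis R N K (\<lambda>k. \<pi> (y k)) \<phi>"
    using M.dual_basis_transport[OF N \<pi> inc \<pi>N assms(2)] .
  have "module_iso R M (module_sum (corner_module R a) N)"
  proof (rule module_isoI_inverse[where f = "\<lambda>x. (\<psi> x, \<pi> x)" and g = "\<lambda>(r, n). r \<odot>\<^bsub>M\<^esub> v \<oplus>\<^bsub>M\<^esub> n"])
    show "left_linear R M (module_sum (corner_module R a) N) (\<lambda>x. (\<psi> x, \<pi> x))"
      using \<psi>D \<psi>a left_linearD[OF \<pi>] by (intro left_linearI) auto
    fix w assume "w \<in> carrier (module_sum (corner_module R a) N)"
    then obtain r n where w: "w = (r, n)" "r \<in> carrier R" "r \<otimes> a = r" "n \<in> carrier N" by auto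
    then have n: "n \<in> carrier M" "\<psi> n = \<zero>" by (simp_all add: N_simps)
    show "(case w of (r, n) \<Rightarrow> r \<odot>\<^bsub>M\<^esub> v \<oplus>\<^bsub>M\<^esub> n) \<in> carrier M"
      using w n v by (simp add: M.smult_closed)
    have 1: "\<psi> (r \<odot>\<^bsub>M\<^esub> v \<oplus>\<^bsub>M\<^esub> n) = r"
      using w n v \<psi>D \<psi>v by (simp add: M.smult_closed)
    have "\<pi> (r \<odot>\<^bsub>M\<^esub> v \<oplus>\<^bsub>M\<^esub> n) = r \<odot>\<^bsub>N\<^esub> \<pi> v \<oplus>\<^bsub>N\<^esub> \<pi> n"
      using left_linearD[OF \<pi>] w n v by (simp add: M.smult_closed)
    then have 2: "\<pi> (r \<odot>\<^bsub>M\<^esub> v \<oplus>\<^bsub>M\<^esub> n) = n"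
      using w \<pi>v \<pi>N[OF w(4)] by simp
    show "(\<psi> (case w of (r, n) \<Rightarrow> r \<odot>\<^bsub>M\<^esub> v \<oplus>\<^bsub>M\<^esub> n), \<pi> (case w of (r, n) \<Rightarrow> r \<odot>\<^bsub>M\<^esub> v \<oplus>\<^bsub>M\<^esub> n)) = w"
      using 1 2 w by simp
  next
    fix x assume x: "x \<in> carrier M"
    have "\<psi> x \<odot>\<^bsub>M\<^esub> v \<oplus>\<^bsub>M\<^esub> (x \<oplus>\<^bsub>M\<^esub> (\<ominus> \<psi> x) \<odot>\<^bsub>M\<^esub> v) = x \<oplus>\<^bsub>M\<^esub> (\<psi> x \<oplus> \<ominus> \<psi> x) \<odot>\<^bsub>M\<^esub> v"
      using x \<psi>D v by (subst M.smult_l_distr) (simp_all add: M.smult_closed M.M.add.m_ac)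
    then show "(case (\<psi> x, \<pi> x) of (r, n) \<Rightarrow> r \<odot>\<^bsub>M\<^esub> v \<oplus>\<^bsub>M\<^esub> n) = x"
      using x \<psi>D v by (simp add: \<pi>_def r_neg)
  qed
  then have "K0_class R M = K0_class R (corner_module R a) \<otimes>\<^bsub>K0 R\<^esub> K0_class R N"
    by (intro K0_class_sum fg_projectiveI[OF M assms(2) inf] fg_projective_corner[OF a]
        fg_projectiveI[OF N DN inf] infinite_type)
  then show thesis
    using that[of N \<pi>] N DN \<pi> \<pi>v \<pi>N by (simp add: N_simps)
qed

end

section \<open>Generation of \<open>K\<^sub>0\<close> by idempotents\<close>

text \<open>The model is \<open>R = \<^bold>K + \<complex>\<close> with \<open>J = \<^bold>K\<close> the compact operators on a sum of copies of \<open>l\<^sup>2(\<nat>)\<close>, \<open>e n\<close> the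
  projection onto a basis vector and \<open>p j\<close> the projection onto all but the first \<open>j\<close> basis vectors. An
  operator outside \<open>J\<close> is a non-zero scalar plus a compact operator \<open>s\<close>, and \<open>s (p j)\<close> tends to \<open>0\<close> in norm: this gives
  \<open>unit_mod_J\<close> and \<open>small\<close>. The last axiom is the simplicity of \<open>R (e n)\<close>.\<close>

locale compact_extension = infinite_ring R for R :: "('a, 'r) ring_scheme" (structure) +
  fixes J :: "'a set" and p e :: "nat \<Rightarrow> 'a"
  assumes J: "ideal J R"
    and p_closed: "p j \<in> carrier R" and p_idem: "p j \<otimes> p j = p j"
    and e_closed: "e n \<in> carrier R" and e_idem: "e n \<otimes> e n = e n"
    and p_e: "p j \<oplus> (\<Oplus>n\<in>{..<j}. e n) = \<one>"
    and e_J: "e n \<in> J"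
    and unit_mod_J: "\<lbrakk>r \<in> carrier R; r \<notin> J\<rbrakk> \<Longrightarrow> \<exists>j. \<exists>z\<in>carrier R. p j \<otimes> r \<otimes> z = p j"
    and small: "s \<in> J \<Longrightarrow> \<exists>j. \<exists>t\<in>carrier R. t \<otimes> (\<one> \<ominus> s \<otimes> p j) = \<one>"
    and minimal: "\<lbrakk>r \<in> carrier R; e n \<otimes> r \<noteq> \<zero>\<rbrakk> \<Longrightarrow> \<exists>z\<in>carrier R. e n \<otimes> r \<otimes> z = e n"
begin

interpretation J: ideal J R by (rule J)

lemma J_subset: "s \<in> J \<Longrightarrow> s \<in> carrier R"
  by (rule J.a_Hcarr)

lemma smult_p_e:
  assumes "left_module R M" "x \<in> carrier M"
  shows "p j \<odot>\<^bsub>M\<^esub> x \<oplus>\<^bsub>M\<^esub> (\<Oplus>\<^bsub>M\<^esub>n\<in>{..<j}. e n \<odot>\<^bsub>M\<^esub> x) = x"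
proof -
  interpret M: left_module R M by fact
  have "(p j \<oplus> (\<Oplus>n\<in>{..<j}. e n)) \<odot>\<^bsub>M\<^esub> x = x"
    unfolding p_e using assms(2) by (rule M.smult_one)
  then show ?thesis
    using assms(2) p_closed e_closed by (simp add: M.smult_l_distr M.finsum_smult_l Pi_iff)
qed

definition J_part :: "('a, 'b, 'm) module_scheme \<Rightarrow> 'b set" where
  "J_part M = {s \<odot>\<^bsub>M\<^esub> x |s x. s \<in> J \<and> x \<in> carrier M}"

lemma J_part_subset: "left_module R M \<Longrightarrow> J_part M \<subseteq> carrier M"
  using left_module.smult_closed J_subset by (fastforce simp: J_part_def)

text \<open>Once \<open>M\<close> is spanned by elements fixed by the minimal idempotents \<open>e n\<close>, each non-zero one of these
  splits off as a summand \<open>R (e n)\<close>, because some functional does not vanish on it.\<close>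

lemma K0_class_minimal_generators:
  fixes M :: "('a, 'b, 'm) module_scheme"
  assumes H: "subgroup H (K0 R)" and e_H: "\<And>n. K0_class R (corner_module R (e n)) \<in> H"
    and inf: "infinite (UNIV :: 'b set)"
    and "left_module R M" "dual_basis R M K y \<phi>" "finite Y" "Y \<subseteq> carrier M"
    and "\<And>g. g \<in> Y \<Longrightarrow> \<exists>n. e n \<odot>\<^bsub>M\<^esub> g = g" and "carrier M \<subseteq> lin_span R M Y"
  shows "K0_class R M \<in> H"
  using assms(4-)
proof (induction "card Y" arbitrary: M Y y rule: less_induct)
  case less
  interpret M: left_module R M by fact
  note D = M.dual_basisD[OF less.prems(2)]
  show ?case
  proof (cases "Y = {}")
    case True
    have "x = \<zero>\<^bsub>M\<^esub>" if "x \<in> lin_span R M {}" for x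
      using that by cases auto
    then have "carrier M = {\<zero>\<^bsub>M\<^esub>}" using less.prems(6) True by auto
    then show ?thesis
      using K0_class_zero[OF less.prems(1) _ inf] subgroup.one_closed[OF H] by simp
  next
    case False
    then obtain g where g: "g \<in> Y" "g \<in> carrier M" using less.prems(4) by auto
    have card: "card (Y - {g}) < card Y"
      using g less.prems(3) by (meson card_Diff1_less)
    show ?thesis
    proof (cases "g = \<zero>\<^bsub>M\<^esub>")
      case True
      have "Y \<subseteq> lin_span R M (Y - {g})"
        using True M.lin_span_gen[of "Y - {g}"] less.prems(4) lin_span.zero[of M R "Y - {g}"] by blast
      then have "carrier M \<subseteq> lin_span R M (Y - {g})"
        using less.prems(4,6) by (meson Diff_subset M.lin_span_trans order_trans subsetD subsetI)
      then show ?thesis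
        using less.prems card by (intro less.hyps[OF card less.prems(1,2)]) auto
    next
      case g0: False
      obtain n where n: "e n \<odot>\<^bsub>M\<^esub> g = g" using less.prems(5)[OF g(1)] by blast
      have "\<exists>k\<in>K. \<phi> k g \<noteq> \<zero>"
      proof (rule ccontr)
        assume "\<not> (\<exists>k\<in>K. \<phi> k g \<noteq> \<zero>)"
        then have "(\<Oplus>\<^bsub>M\<^esub>k\<in>K. \<phi> k g \<odot>\<^bsub>M\<^esub> y k) = (\<Oplus>\<^bsub>M\<^esub>k\<in>K. \<zero>\<^bsub>M\<^esub>)"
          using D(2) by (intro M.M.finsum_cong') auto
        then show False using g0 D(5)[OF g(2)] by simp
      qed
      then obtain k where k: "k \<in> K" "\<phi> k g \<noteq> \<zero>" by blast
      note fk = left_linearD[OF D(3)[OF k(1)], simplified]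
      have eg: "e n \<otimes> \<phi> k g = \<phi> k g" using fk(3)[OF e_closed g(2), of n] n by simp
      then obtain z where z: "z \<in> carrier R" "\<phi> k g \<otimes> z = e n"
        using minimal[OF fk(1)[OF g(2)], of n] k(2) by auto
      obtain N :: "('a, 'b, 'm) module_scheme" and \<pi> where
        N: "left_module R N" and DN: "dual_basis R N K (\<lambda>k. \<pi> (y k)) \<phi>"
        and \<pi>: "left_linear R M N \<pi>" "\<pi> g = \<zero>\<^bsub>N\<^esub>"
        and NM: "carrier N \<subseteq> carrier M" "\<And>x. x \<in> carrier N \<Longrightarrow> \<pi> x = x"
        and K0: "K0_class R M = K0_class R (corner_module R (e n)) \<otimes>\<^bsub>K0 R\<^esub> K0_class R N"
        using split_off[OF less.prems(1,2) inf e_closed e_idem g(2) n D(3)[OF k(1)] z] by metis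
      interpret N: left_module R N by fact
      let ?Y = "\<pi> ` (Y - {g})"
      have Y: "?Y \<subseteq> carrier N" using left_linearD(1)[OF \<pi>(1)] less.prems(4) by auto
      have "\<pi> ` Y \<subseteq> lin_span R N ?Y"
      proof (rule image_subsetI)
        fix g' assume "g' \<in> Y"
        then show "\<pi> g' \<in> lin_span R N ?Y"
          using \<pi>(2) N.lin_span_gen[OF Y] lin_span.zero[of N R ?Y] by (cases "g' = g") auto
      qed
      moreover have "x \<in> lin_span R N (\<pi> ` Y)" if "x \<in> carrier N" for x
        using M.lin_span_linear_image[OF \<pi>(1) M.left_linear_zero[OF N \<pi>(1)] less.prems(4)] that NM less.prems(6)
        by (metis subsetD)
      ultimately have "carrier N \<subseteq> lin_span R N ?Y"
        using N.lin_span_trans[OF Y] by blast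
      moreover have "\<exists>m. e m \<odot>\<^bsub>N\<^esub> g' = g'" if "g' \<in> ?Y" for g'
        using that less.prems(4,5) left_linearD(3)[OF \<pi>(1) e_closed] by (metis DiffD1 imageE subsetD)
      moreover have "card ?Y < card Y"
        using card card_image_le[of "Y - {g}" \<pi>] less.prems(3) by simp
      ultimately have "K0_class R N \<in> H"
        using less.prems(3) Y by (intro less.hyps[OF _ N DN]) auto
      then show ?thesis
        unfolding K0 using e_H by (intro subgroup.m_closed[OF H])
    qed
  qed
qed

text \<open>Nakayama: an element \<open>x\<close> of \<open>J M\<close> is \<open>s x\<close> plus a combination of the other generators, with \<open>s \<in> J\<close>.
  As \<open>1 - s (p j)\<close> is invertible for some \<open>j\<close>, the elements \<open>(e n) x\<close> with \<open>n < j\<close> can replace \<open>x\<close>.\<close>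

lemma minimal_generators:
  fixes M :: "('a, 'b, 'm) module_scheme"
  assumes M: "left_module R M" and JM: "carrier M \<subseteq> lin_span R M (J_part M)"
    and "finite X" "X \<subseteq> carrier M" "finite Y" "Y \<subseteq> carrier M"
    and "\<And>g. g \<in> Y \<Longrightarrow> \<exists>n. e n \<odot>\<^bsub>M\<^esub> g = g" and "carrier M \<subseteq> lin_span R M (X \<union> Y)"
  shows "\<exists>Y. finite Y \<and> Y \<subseteq> carrier M \<and> (\<forall>g\<in>Y. \<exists>n. e n \<odot>\<^bsub>M\<^esub> g = g) \<and> carrier M \<subseteq> lin_span R M Y"
  using assms(3-)
proof (induction X arbitrary: Y)
  case empty
  then show ?case by auto
next
  case (insert x X)
  interpret M: left_module R M by fact
  have x: "x \<in> carrier M" and XY: "X \<union> Y \<subseteq> carrier M" using insert.prems by auto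
  let ?L = "lin_span R M (X \<union> Y)"
  define S where "S = {m \<in> carrier M. \<exists>s\<in>J. \<exists>w\<in>?L. m = s \<odot>\<^bsub>M\<^esub> x \<oplus>\<^bsub>M\<^esub> w}"
  have SI: "s \<odot>\<^bsub>M\<^esub> x \<oplus>\<^bsub>M\<^esub> w \<in> S" if "s \<in> J" "w \<in> ?L" for s w
    using that x J_subset M.lin_span_closed[OF XY] by (auto simp: S_def M.smult_closed)
  have S0: "\<zero>\<^bsub>M\<^esub> \<in> S"
    using SI[OF J.zero_closed lin_span.zero] x by simp
  have S_add: "m \<oplus>\<^bsub>M\<^esub> m' \<in> S" if m: "m \<in> S" "m' \<in> S" for m m'
  proof -
    obtain s w s' w' where *: "s \<in> J" "w \<in> ?L" "s' \<in> J" "w' \<in> ?L"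
      "m = s \<odot>\<^bsub>M\<^esub> x \<oplus>\<^bsub>M\<^esub> w" "m' = s' \<odot>\<^bsub>M\<^esub> x \<oplus>\<^bsub>M\<^esub> w'"
      using m unfolding S_def by blast
    have "m \<oplus>\<^bsub>M\<^esub> m' = (s \<oplus> s') \<odot>\<^bsub>M\<^esub> x \<oplus>\<^bsub>M\<^esub> (w \<oplus>\<^bsub>M\<^esub> w')"
      using * x J_subset M.lin_span_closed[OF XY]
      by (simp add: M.smult_l_distr M.smult_closed M.M.add.m_ac)
    then show ?thesis
      using * SI M.lin_span_add[OF XY] J.a_closed by simp
  qed
  have S_smult: "a \<odot>\<^bsub>M\<^esub> m \<in> S" if a: "a \<in> carrier R" and m: "m \<in> S" for a m
  proof -
    obtain s w where *: "s \<in> J" "w \<in> ?L" "m = s \<odot>\<^bsub>M\<^esub> x \<oplus>\<^bsub>M\<^esub> w"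
      using m unfolding S_def by blast
    have "a \<odot>\<^bsub>M\<^esub> m = (a \<otimes> s) \<odot>\<^bsub>M\<^esub> x \<oplus>\<^bsub>M\<^esub> a \<odot>\<^bsub>M\<^esub> w"
      using * x a J_subset M.lin_span_closed[OF XY]
      by (simp add: M.smult_r_distr M.smult_assoc M.smult_closed)
    then show ?thesis
      using * a SI M.lin_span_smult[OF XY] J.I_l_closed by simp
  qed
  have J_S: "s \<odot>\<^bsub>M\<^esub> m \<in> S" if s: "s \<in> J" and m: "m \<in> lin_span R M (insert x X \<union> Y)" for s m
    using m
  proof induction
    case zero
    show ?case using S0 s J_subset by simp
  next
    case (step a g m)
    have g: "g \<in> carrier M" "m \<in> carrier M"
      using step x XY M.lin_span_closed[of "insert x X \<union> Y" m] by auto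
    have "(s \<otimes> a) \<odot>\<^bsub>M\<^esub> g \<in> S"
    proof (cases "g = x")
      case True
      then show ?thesis
        using SI[of "s \<otimes> a" "\<zero>\<^bsub>M\<^esub>"] s step(1) x J_subset J.I_r_closed lin_span.zero[of M R]
        by (simp add: M.smult_closed)
    next
      case False
      then have "g \<in> X \<union> Y" using step by auto
      then have "(s \<otimes> a) \<odot>\<^bsub>M\<^esub> g \<in> ?L"
        using M.lin_span_smult[OF XY M.lin_span_gen[OF XY]] s step(1) J_subset by simp
      then show ?thesis
        using SI[of \<zero> "(s \<otimes> a) \<odot>\<^bsub>M\<^esub> g"] x s step(1) g J_subset by (simp add: M.smult_closed)
    qed
    moreover have "s \<odot>\<^bsub>M\<^esub> (a \<odot>\<^bsub>M\<^esub> g \<oplus>\<^bsub>M\<^esub> m) = (s \<otimes> a) \<odot>\<^bsub>M\<^esub> g \<oplus>\<^bsub>M\<^esub> s \<odot>\<^bsub>M\<^esub> m"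
      using s step(1) g J_subset by (simp add: M.smult_r_distr M.smult_assoc M.smult_closed)
    ultimately show ?case using S_add step by simp
  qed
  have "x \<in> S"
  proof (rule M.lin_span_minimal[OF subsetD[OF JM x] S0 _ S_add])
    fix a g assume a: "a \<in> carrier R" and "g \<in> J_part M"
    then obtain s m where "g = s \<odot>\<^bsub>M\<^esub> m" "s \<in> J" "m \<in> carrier M" by (auto simp: J_part_def)
    then show "a \<odot>\<^bsub>M\<^esub> g \<in> S"
      using S_smult[OF a J_S[of s m]] insert.prems(5) by auto
  qed
  then obtain s w where s: "s \<in> J" "w \<in> ?L" and xw: "x = s \<odot>\<^bsub>M\<^esub> x \<oplus>\<^bsub>M\<^esub> w"
    unfolding S_def by blast
  have sR: "s \<in> carrier R" and w: "w \<in> carrier M" using s J_subset M.lin_span_closed[OF XY] by auto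
  obtain j t where t: "t \<in> carrier R" "t \<otimes> (\<one> \<ominus> s \<otimes> p j) = \<one>"
    using small[OF s(1)] by blast
  let ?E = "(\<lambda>n. e n \<odot>\<^bsub>M\<^esub> x) ` {..<j}"
  let ?Y = "Y \<union> ?E"
  have E: "?E \<subseteq> carrier M" using x e_closed by (auto intro: M.smult_closed)
  have XY': "X \<union> ?Y \<subseteq> carrier M" using XY E by auto
  let ?L' = "lin_span R M (X \<union> ?Y)"
  define x' where "x' = (\<Oplus>\<^bsub>M\<^esub>n\<in>{..<j}. e n \<odot>\<^bsub>M\<^esub> x)"
  have x'L: "x' \<in> ?L'"
    unfolding x'_def by (rule M.finsum_in_lin_span[OF XY'], rule M.lin_span_gen[OF XY']) auto
  have x'M: "x' \<in> carrier M" using x'L M.lin_span_closed[OF XY'] by blast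
  have dec: "x = p j \<odot>\<^bsub>M\<^esub> x \<oplus>\<^bsub>M\<^esub> x'"
    unfolding x'_def using smult_p_e[OF M x, of j] by simp
  have sx: "s \<odot>\<^bsub>M\<^esub> x = (s \<otimes> p j) \<odot>\<^bsub>M\<^esub> x \<oplus>\<^bsub>M\<^esub> s \<odot>\<^bsub>M\<^esub> x'"
    by (subst dec) (use sR p_closed[of j] x x'M in \<open>simp add: M.smult_r_distr M.smult_assoc M.smult_closed\<close>)
  have "(\<one> \<ominus> s \<otimes> p j) \<odot>\<^bsub>M\<^esub> x = x \<ominus>\<^bsub>M\<^esub> (s \<otimes> p j) \<odot>\<^bsub>M\<^esub> x"
    using sR p_closed[of j] x by (simp add: a_minus_def M.smult_l_distr M.smult_minus M.smult_one)
  also have "\<dots> = ((s \<otimes> p j) \<odot>\<^bsub>M\<^esub> x \<oplus>\<^bsub>M\<^esub> (s \<odot>\<^bsub>M\<^esub> x' \<oplus>\<^bsub>M\<^esub> w)) \<ominus>\<^bsub>M\<^esub> (s \<otimes> p j) \<odot>\<^bsub>M\<^esub> x"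
    using xw sx sR p_closed[of j] x x'M w by (simp add: M.M.a_assoc M.smult_closed)
  also have "\<dots> = s \<odot>\<^bsub>M\<^esub> x' \<oplus>\<^bsub>M\<^esub> w"
    using sR p_closed[of j] x x'M w
    by (simp add: a_minus_def M.smult_closed M.M.add.m_ac M.M.r_neg M.M.r_neg1 M.M.r_neg2)
  finally have eq: "(\<one> \<ominus> s \<otimes> p j) \<odot>\<^bsub>M\<^esub> x = s \<odot>\<^bsub>M\<^esub> x' \<oplus>\<^bsub>M\<^esub> w" .
  have "x = (t \<otimes> (\<one> \<ominus> s \<otimes> p j)) \<odot>\<^bsub>M\<^esub> x"
    using t x by (simp add: M.smult_one)
  also have "\<dots> = t \<odot>\<^bsub>M\<^esub> (s \<odot>\<^bsub>M\<^esub> x' \<oplus>\<^bsub>M\<^esub> w)"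
    unfolding eq[symmetric] using t(1) sR p_closed[of j] x by (intro M.smult_assoc) auto
  finally have "x = t \<odot>\<^bsub>M\<^esub> (s \<odot>\<^bsub>M\<^esub> x' \<oplus>\<^bsub>M\<^esub> w)" .
  moreover have "w \<in> ?L'" by (rule M.lin_span_mono[OF _ s(2)]) auto
  ultimately have "x \<in> ?L'"
    using x'L M.lin_span_smult[OF XY'] M.lin_span_add[OF XY'] t(1) sR by metis
  then have "insert x X \<union> Y \<subseteq> ?L'"
    using M.lin_span_gen[OF XY'] by blast
  then have "carrier M \<subseteq> ?L'"
    using insert.prems(5) M.lin_span_trans[OF XY'] by blast
  moreover have "\<exists>n. e n \<odot>\<^bsub>M\<^esub> g = g" if g: "g \<in> ?Y" for g
  proof (cases "g \<in> Y")
    case False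
    then obtain n where "g = e n \<odot>\<^bsub>M\<^esub> x" using g by auto
    then show ?thesis
      using x e_closed e_idem by (intro exI[of _ n]) (simp add: M.smult_assoc[symmetric])
  qed (use insert.prems in auto)
  ultimately show ?case
    using insert.IH[of ?Y] insert.prems XY' by auto
qed

text \<open>The generators outside \<open>J M\<close> are removed one at a time: if some functional takes a value outside
  \<open>J\<close> on \<open>x\<close>, a summand \<open>R (p j)\<close> splits off that contains \<open>x\<close> up to \<open>J M\<close>; otherwise \<open>x \<in> J M\<close>.\<close>

theorem K0_class_in_subgroup:
  fixes M :: "('a, 'b, 'm) module_scheme"
  assumes H: "subgroup H (K0 R)" and p_H: "\<And>j. K0_class R (corner_module R (p j)) \<in> H"
    and e_H: "\<And>n. K0_class R (corner_module R (e n)) \<in> H"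
    and inf: "infinite (UNIV :: 'b set)" and "fg_projective R M"
  shows "K0_class R M \<in> H"
proof -
  have gen: "K0_class R M \<in> H"
    if "left_module R M" "dual_basis R M K y \<phi>" "finite X" "X \<subseteq> carrier M"
      "carrier M \<subseteq> lin_span R M (X \<union> J_part M)"
    for M :: "('a, 'b, 'm) module_scheme" and K :: "nat set" and y \<phi> X
    using that
  proof (induction "card X" arbitrary: M X y rule: less_induct)
    case less
    interpret M: left_module R M by fact
    note D = M.dual_basisD[OF less.prems(2)]
    note JM = J_part_subset[OF less.prems(1)]
    show ?case
    proof (cases "X = {}")
      case True
      have "carrier M \<subseteq> lin_span R M (y ` K \<union> {})"
      proof
        fix x assume x: "x \<in> carrier M"
        have yK: "y ` K \<subseteq> carrier M" using D(2) by auto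
        have "(\<Oplus>\<^bsub>M\<^esub>k\<in>K. \<phi> k x \<odot>\<^bsub>M\<^esub> y k) \<in> lin_span R M (y ` K)"
          using D(4) x by (intro M.finsum_in_lin_span[OF yK] M.lin_span_smult[OF yK M.lin_span_gen[OF yK]]) auto
        then show "x \<in> lin_span R M (y ` K \<union> {})" using D(5)[OF x] by simp
      qed
      then obtain Y where "finite Y" "Y \<subseteq> carrier M" "\<forall>g\<in>Y. \<exists>n. e n \<odot>\<^bsub>M\<^esub> g = g" "carrier M \<subseteq> lin_span R M Y"
        using minimal_generators[OF less.prems(1), of "y ` K" "{}"] less.prems(5) True D(1,2) by auto
      then show ?thesis
        using K0_class_minimal_generators[OF H e_H inf less.prems(1,2)] by blast
    next
      case False
      then obtain x where x: "x \<in> X" "x \<in> carrier M" using less.prems(4) by auto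
      have card: "card (X - {x}) < card X" using x less.prems(3) by (meson card_Diff1_less)
      show ?thesis
      proof (cases "\<forall>k\<in>K. \<phi> k x \<in> J")
        case True
        let ?G = "(X - {x}) \<union> J_part M"
        have G: "?G \<subseteq> carrier M" using less.prems(4) JM by auto
        have "(\<Oplus>\<^bsub>M\<^esub>k\<in>K. \<phi> k x \<odot>\<^bsub>M\<^esub> y k) \<in> lin_span R M ?G"
          using True D(2) by (intro M.finsum_in_lin_span[OF G] M.lin_span_gen[OF G]) (auto simp: J_part_def)
        then have "x \<in> lin_span R M ?G" using D(5)[OF x(2)] by simp
        then have "X \<union> J_part M \<subseteq> lin_span R M ?G" using M.lin_span_gen[OF G] by blast
        then have "carrier M \<subseteq> lin_span R M ?G" using less.prems(5) M.lin_span_trans[OF G] by blast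
        then show ?thesis
          using less.prems(3,4) by (intro less.hyps[OF card less.prems(1,2)]) auto
      next
        case False
        then obtain k where k: "k \<in> K" "\<phi> k x \<notin> J" by blast
        note fk = left_linearD[OF D(3)[OF k(1)], simplified]
        obtain j z where z: "z \<in> carrier R" "p j \<otimes> \<phi> k x \<otimes> z = p j"
          using unit_mod_J[OF fk(1)[OF x(2)] k(2)] by blast
        let ?v = "p j \<odot>\<^bsub>M\<^esub> x"
        have v: "?v \<in> carrier M" "p j \<odot>\<^bsub>M\<^esub> ?v = ?v"
          using x(2) p_closed[of j] p_idem[of j] by (simp_all add: M.smult_closed M.smult_assoc[symmetric])
        have fz: "\<phi> k ?v \<otimes> z = p j" using z fk(3)[OF p_closed x(2)] by simp
        obtain N :: "('a, 'b, 'm) module_scheme" and \<pi> where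
          N: "left_module R N" and DN: "dual_basis R N K (\<lambda>k. \<pi> (y k)) \<phi>"
          and \<pi>: "left_linear R M N \<pi>" "\<pi> ?v = \<zero>\<^bsub>N\<^esub>"
          and NM: "carrier N \<subseteq> carrier M" "\<And>x. x \<in> carrier N \<Longrightarrow> \<pi> x = x"
          and K0: "K0_class R M = K0_class R (corner_module R (p j)) \<otimes>\<^bsub>K0 R\<^esub> K0_class R N"
          using split_off[OF less.prems(1,2) inf p_closed p_idem v D(3)[OF k(1)] z(1) fz] by metis
        interpret N: left_module R N by fact
        note \<pi>D = left_linearD[OF \<pi>(1)]
        let ?X = "\<pi> ` (X - {x})"
        let ?G = "?X \<union> J_part N"
        have X: "?X \<subseteq> carrier N" using \<pi>D(1) less.prems(4) by auto
        then have G: "?G \<subseteq> carrier N" using J_part_subset[OF N] by auto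
        have "\<pi> x = \<pi> (p j \<odot>\<^bsub>M\<^esub> x \<oplus>\<^bsub>M\<^esub> (\<Oplus>\<^bsub>M\<^esub>n\<in>{..<j}. e n \<odot>\<^bsub>M\<^esub> x))"
          using smult_p_e[OF less.prems(1) x(2), of j] by simp
        also have "\<dots> = \<pi> ?v \<oplus>\<^bsub>N\<^esub> \<pi> (\<Oplus>\<^bsub>M\<^esub>n\<in>{..<j}. e n \<odot>\<^bsub>M\<^esub> x)"
          using v x(2) e_closed by (intro \<pi>D(2) M.M.finsum_closed) (auto intro: M.smult_closed)
        also have "\<pi> (\<Oplus>\<^bsub>M\<^esub>n\<in>{..<j}. e n \<odot>\<^bsub>M\<^esub> x) = (\<Oplus>\<^bsub>N\<^esub>n\<in>{..<j}. \<pi> (e n \<odot>\<^bsub>M\<^esub> x))"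
          using x(2) e_closed by (intro M.left_linear_finsum[OF N \<pi>(1)]) (auto intro: M.smult_closed)
        finally have \<pi>x: "\<pi> x = \<zero>\<^bsub>N\<^esub> \<oplus>\<^bsub>N\<^esub> (\<Oplus>\<^bsub>N\<^esub>n\<in>{..<j}. \<pi> (e n \<odot>\<^bsub>M\<^esub> x))" by (simp add: \<pi>(2))
        have \<pi>J: "\<pi> (s \<odot>\<^bsub>M\<^esub> m) \<in> J_part N" if "s \<in> J" "m \<in> carrier M" for s m
          using that \<pi>D(1,3) J_subset by (auto simp: J_part_def)
        have "\<pi> x \<in> lin_span R N ?G"
          unfolding \<pi>x using x(2) e_J \<pi>J
          by (intro N.lin_span_add[OF G lin_span.zero] N.finsum_in_lin_span[OF G] N.lin_span_gen[OF G]) auto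
        moreover have "\<pi> g \<in> lin_span R N ?G" if "g \<in> X \<union> J_part M" "g \<noteq> x" for g
        proof (rule N.lin_span_gen[OF G])
          show "\<pi> g \<in> ?G" using that \<pi>J by (auto simp: J_part_def[of M])
        qed
        ultimately have "\<pi> ` (X \<union> J_part M) \<subseteq> lin_span R N ?G" by blast
        moreover have "w \<in> lin_span R N (\<pi> ` (X \<union> J_part M))" if "w \<in> carrier N" for w
          using M.lin_span_linear_image[OF \<pi>(1) M.left_linear_zero[OF N \<pi>(1)], of "X \<union> J_part M" w]
            that NM less.prems(4,5) JM by auto
        ultimately have "carrier N \<subseteq> lin_span R N ?G"
          using N.lin_span_trans[OF G] by blast
        moreover have "card ?X < card X"
          using card card_image_le[of "X - {x}" \<pi>] less.prems(3) by simp
        ultimately have "K0_class R N \<in> H"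
          using less.prems(3) X by (intro less.hyps[OF _ N DN]) auto
        then show ?thesis
          unfolding K0 using p_H by (intro subgroup.m_closed[OF H])
      qed
    qed
  qed
  have M: "left_module R M" using assms(5) by (rule fg_projective_left_module)
  interpret M: left_module R M by fact
  obtain n :: nat and y \<phi> where D: "dual_basis R M {..<n} y \<phi>"
    using fg_projective_dual_basis[OF assms(5)] .
  note D' = M.dual_basisD[OF D]
  let ?G = "y ` {..<n} \<union> J_part M"
  have G: "?G \<subseteq> carrier M" using D'(2) J_part_subset[OF M] by auto
  have "carrier M \<subseteq> lin_span R M ?G"
  proof
    fix x assume x: "x \<in> carrier M"
    have "(\<Oplus>\<^bsub>M\<^esub>k\<in>{..<n}. \<phi> k x \<odot>\<^bsub>M\<^esub> y k) \<in> lin_span R M ?G"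
      using D'(4) x by (intro M.finsum_in_lin_span[OF G] M.lin_span_smult[OF G M.lin_span_gen[OF G]]) auto
    then show "x \<in> lin_span R M ?G" using D'(5)[OF x] by simp
  qed
  then show ?thesis
    using gen[OF M D, of "y ` {..<n}"] D'(2) by auto
qed

end

section \<open>The free *-algebra\<close>

type_synonym 'g word = "('g \<times> bool) list"

abbreviation F :: "('g word \<Rightarrow> complex) star_algebra" where "F \<equiv> free_star_algebra"

definition word_star :: "'g word \<Rightarrow> 'g word" where
  "word_star w = rev (map (\<lambda>(g, s). (g, \<not> s)) w)"

lemma F_simps [simp]:
  "carrier F = {f. finite {w. f w \<noteq> 0}}" "zero F = (\<lambda>w. 0)"
  "one F = (\<lambda>w. if w = [] then 1 else 0)" "add F = (\<lambda>f g w. f w + g w)"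
  "smult F = (\<lambda>c f w. c * f w)" "mult F = (\<lambda>f g w. \<Sum>k\<le>length w. f (take k w) * g (drop k w))"
  "star F = (\<lambda>f w. cnj (f (word_star w)))"
  by (simp_all add: free_star_algebra_def word_star_def)

definition monomial :: "complex \<Rightarrow> 'g word \<Rightarrow> 'g word \<Rightarrow> complex" where
  "monomial c w = (\<lambda>v. if v = w then c else 0)"

lemma word_star_word_star [simp]: "word_star (word_star w) = w"
  by (simp add: word_star_def rev_map[symmetric] comp_def case_prod_unfold)

lemma length_word_star [simp]: "length (word_star w) = length w"
  by (simp add: word_star_def)

lemma take_word_star: "take k (word_star w) = word_star (drop (length w - k) w)"
  by (simp add: word_star_def take_rev drop_map)

lemma drop_word_star: "drop k (word_star w) = word_star (take (length w - k) w)"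
  by (simp add: word_star_def drop_rev take_map)

lemma monomial_closed: "monomial c w \<in> carrier F"
  by (simp add: monomial_def)

lemma F_mult_closed:
  assumes "f \<in> carrier F" "g \<in> carrier F"
  shows "f \<otimes>\<^bsub>F\<^esub> g \<in> carrier F"
proof -
  have "{w. (f \<otimes>\<^bsub>F\<^esub> g) w \<noteq> 0} \<subseteq> (\<lambda>(u, v). u @ v) ` ({w. f w \<noteq> 0} \<times> {w. g w \<noteq> 0})"
  proof
    fix w assume "w \<in> {w. (f \<otimes>\<^bsub>F\<^esub> g) w \<noteq> 0}"
    then obtain k where "f (take k w) * g (drop k w) \<noteq> 0"
      using sum.not_neutral_contains_not_neutral[of "\<lambda>k. f (take k w) * g (drop k w)"] by auto
    then show "w \<in> (\<lambda>(u, v). u @ v) ` ({w. f w \<noteq> 0} \<times> {w. g w \<noteq> 0})"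
      by (intro image_eqI[of _ _ "(take k w, drop k w)"]) auto
  qed
  moreover have "finite ((\<lambda>(u, v). u @ v) ` ({w. f w \<noteq> 0} \<times> {w. g w \<noteq> 0}))"
    using assms by simp
  ultimately show ?thesis by (simp add: finite_subset)
qed

lemma F_add_closed:
  assumes "f \<in> carrier F" "g \<in> carrier F"
  shows "f \<oplus>\<^bsub>F\<^esub> g \<in> carrier F"
proof -
  have "{w. f w + g w \<noteq> 0} \<subseteq> {w. f w \<noteq> 0} \<union> {w. g w \<noteq> 0}" by auto
  moreover have "finite ({w. f w \<noteq> 0} \<union> {w. g w \<noteq> 0})" using assms by simp
  ultimately show ?thesis by (simp add: finite_subset)
qed

lemma F_mult_assoc: "f \<otimes>\<^bsub>F\<^esub> g \<otimes>\<^bsub>F\<^esub> h = f \<otimes>\<^bsub>F\<^esub> (g \<otimes>\<^bsub>F\<^esub> h)"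
proof
  fix w :: "'a word"
  let ?n = "length w"
  let ?t = "\<lambda>j k. f (take j w) * g (take (k - j) (drop j w)) * h (drop k w)"
  have "(f \<otimes>\<^bsub>F\<^esub> g \<otimes>\<^bsub>F\<^esub> h) w = (\<Sum>k\<le>?n. \<Sum>j\<le>k. ?t j k)"
    by (auto simp: sum_distrib_right min_def drop_take intro!: sum.cong)
  also have "\<dots> = (\<Sum>(k, j)\<in>(SIGMA k:{..?n}. {..k}). ?t j k)"
    by (simp add: sum.Sigma)
  also have "\<dots> = (\<Sum>(j, i)\<in>(SIGMA j:{..?n}. {..?n - j}). ?t j (j + i))"
    by (rule sum.reindex_bij_witness[where i = "\<lambda>(j, i). (j + i, j)" and j = "\<lambda>(k, j). (j, k - j)"]) auto
  also have "\<dots> = (\<Sum>j\<le>?n. \<Sum>i\<le>?n - j. ?t j (j + i))"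
    by (simp add: sum.Sigma)
  also have "\<dots> = (f \<otimes>\<^bsub>F\<^esub> (g \<otimes>\<^bsub>F\<^esub> h)) w"
    by (auto simp: sum_distrib_left mult.assoc add.commute intro!: sum.cong)
  finally show "(f \<otimes>\<^bsub>F\<^esub> g \<otimes>\<^bsub>F\<^esub> h) w = (f \<otimes>\<^bsub>F\<^esub> (g \<otimes>\<^bsub>F\<^esub> h)) w" .
qed

lemma monomial_empty_mult: "monomial c [] \<otimes>\<^bsub>F\<^esub> f = c \<odot>\<^bsub>F\<^esub> f"
proof
  fix w :: "'a word"
  have "(monomial c [] \<otimes>\<^bsub>F\<^esub> f) w = (\<Sum>k\<le>length w. if k = 0 then c * f w else 0)"
    unfolding F_simps by (rule sum.cong) (auto simp: monomial_def)
  then show "(monomial c [] \<otimes>\<^bsub>F\<^esub> f) w = (c \<odot>\<^bsub>F\<^esub> f) w" by simp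
qed

lemma mult_mono_empty: "f \<otimes>\<^bsub>F\<^esub> monomial c [] = c \<odot>\<^bsub>F\<^esub> f"
proof
  fix w :: "'a word"
  have "(f \<otimes>\<^bsub>F\<^esub> monomial c []) w = (\<Sum>k\<le>length w. if k = length w then c * f w else 0)"
    unfolding F_simps by (rule sum.cong) (auto simp: monomial_def)
  then show "(f \<otimes>\<^bsub>F\<^esub> monomial c []) w = (c \<odot>\<^bsub>F\<^esub> f) w" by simp
qed

lemma F_one: "\<one>\<^bsub>F\<^esub> = monomial 1 []"
  by (simp add: monomial_def)

lemma monomial_mult: "monomial c u \<otimes>\<^bsub>F\<^esub> monomial d v = monomial (c * d) (u @ v)"
proof
  fix w :: "'a word"
  have "(monomial c u \<otimes>\<^bsub>F\<^esub> monomial d v) w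
      = (\<Sum>k\<le>length w. if k = length u then (if w = u @ v then c * d else 0) else 0)"
    unfolding F_simps
  proof (rule sum.cong[OF refl])
    fix k assume "k \<in> {..length w}"
    then have k: "length (take k w) = k" by simp
    have iff: "take k w = u \<and> drop k w = v \<longleftrightarrow> k = length u \<and> w = u @ v"
      using k append_take_drop_id[of k w] by (auto simp del: length_take)
    have "monomial c u (take k w) * monomial d v (drop k w) = (if take k w = u \<and> drop k w = v then c * d else 0)"
      by (simp add: monomial_def)
    then show "monomial c u (take k w) * monomial d v (drop k w)
        = (if k = length u then (if w = u @ v then c * d else 0) else 0)"
      unfolding iff by simp
  qed
  then show "(monomial c u \<otimes>\<^bsub>F\<^esub> monomial d v) w = monomial (c * d) (u @ v) w"
    by (auto simp: monomial_def)
qed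

lemma ring_F: "ring F"
proof (intro ringI abelian_groupI monoidI)
  fix f :: "'a word \<Rightarrow> complex" assume f: "f \<in> carrier F"
  show "\<one>\<^bsub>F\<^esub> \<otimes>\<^bsub>F\<^esub> f = f" "f \<otimes>\<^bsub>F\<^esub> \<one>\<^bsub>F\<^esub> = f"
    unfolding F_one by (simp_all only: monomial_empty_mult mult_mono_empty) simp_all
  show "\<exists>g\<in>carrier F. g \<oplus>\<^bsub>F\<^esub> f = \<zero>\<^bsub>F\<^esub>"
    using f by (intro bexI[of _ "\<lambda>w. - f w"]) auto
qed (simp_all only: F_add_closed F_mult_closed F_mult_assoc,
     simp_all add: fun_eq_iff sum.distrib algebra_simps)

interpretation F: ring F by (rule ring_F)

lemma F_minus:
  assumes "f \<in> carrier F" "g \<in> carrier F"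
  shows "f \<ominus>\<^bsub>F\<^esub> g = (\<lambda>w. f w - g w)"
proof -
  have "\<ominus>\<^bsub>F\<^esub> g = (\<lambda>w. - g w)"
    by (rule F.minus_equality) (use assms in auto)
  then show ?thesis by (simp add: a_minus_def)
qed

lemma F_smult_closed: "f \<in> carrier F \<Longrightarrow> c \<odot>\<^bsub>F\<^esub> f \<in> carrier F"
  using F_mult_closed[OF monomial_closed[of c "[]"], of f] by (simp only: monomial_empty_mult)

lemma F_star_closed: "f \<in> carrier F \<Longrightarrow> star F f \<in> carrier F"
proof -
  assume "f \<in> carrier F"
  moreover have "{w. cnj (f (word_star w)) \<noteq> 0} = word_star ` {w. f w \<noteq> 0}"
    by (auto intro: image_eqI[of _ word_star "word_star _"])
  ultimately show ?thesis unfolding F_simps by simp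
qed

lemma F_star_mult: "star F (f \<otimes>\<^bsub>F\<^esub> g) = star F g \<otimes>\<^bsub>F\<^esub> star F f"
proof
  fix w :: "'a word"
  have "star F (f \<otimes>\<^bsub>F\<^esub> g) w
      = (\<Sum>k\<le>length w. cnj (f (word_star (drop (length w - k) w))) * cnj (g (word_star (take (length w - k) w))))"
    unfolding F_simps by (simp add: take_word_star drop_word_star)
  also have "\<dots> = (\<Sum>k\<le>length w. cnj (f (word_star (drop k w))) * cnj (g (word_star (take k w))))"
    by (rule sum.reindex_bij_witness[where i = "\<lambda>k. length w - k" and j = "\<lambda>k. length w - k"]) auto
  finally show "star F (f \<otimes>\<^bsub>F\<^esub> g) w = (star F g \<otimes>\<^bsub>F\<^esub> star F f) w"
    unfolding F_simps by (simp add: mult.commute)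
qed

lemma F_star_star: "star F (star F f) = f"
  unfolding F_simps by simp

lemma F_star_add: "star F (f \<oplus>\<^bsub>F\<^esub> g) = star F f \<oplus>\<^bsub>F\<^esub> star F g"
  unfolding F_simps by simp

lemma F_star_monomial: "star F (monomial c w) = monomial (cnj c) (word_star w)"
  unfolding F_simps monomial_def by (auto simp: fun_eq_iff)

text \<open>Additive statements about finitely supported functions reduce to multiples of words.\<close>

lemma F_induct [consumes 1, case_names zero add]:
  assumes "f \<in> carrier F" "P (\<lambda>_. 0)"
    and "\<And>c w f. \<lbrakk>f \<in> carrier F; P f\<rbrakk> \<Longrightarrow> P (monomial c w \<oplus>\<^bsub>F\<^esub> f)"
  shows "P f"
proof -
  have "\<And>f. {w. f w \<noteq> 0} = A \<Longrightarrow> P f" if "finite A" for A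
    using that
  proof (induction A)
    case empty
    then have "f = (\<lambda>_. 0)" by auto
    then show ?case using assms(2) by simp
  next
    case (insert w A)
    let ?g = "f(w := 0)"
    have g: "{v. ?g v \<noteq> 0} = A" using insert by auto
    then have "P (monomial (f w) w \<oplus>\<^bsub>F\<^esub> ?g)"
      using insert by (intro assms(3)) auto
    also have "monomial (f w) w \<oplus>\<^bsub>F\<^esub> ?g = f" by (auto simp: monomial_def)
    finally show ?case .
  qed
  then show ?thesis using assms(1) by simp
qed

lemma additive_mult_closed:
  assumes "\<And>f g. \<lbrakk>f \<in> N; g \<in> N\<rbrakk> \<Longrightarrow> f \<oplus>\<^bsub>F\<^esub> g \<in> N" "(\<lambda>_. 0) \<in> N" "N \<subseteq> carrier F"
    and x: "x \<in> carrier F" and f: "f \<in> N"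
  shows "(\<And>c w. monomial c w \<otimes>\<^bsub>F\<^esub> f \<in> N) \<Longrightarrow> x \<otimes>\<^bsub>F\<^esub> f \<in> N"
    and "(\<And>c w. f \<otimes>\<^bsub>F\<^esub> monomial c w \<in> N) \<Longrightarrow> f \<otimes>\<^bsub>F\<^esub> x \<in> N"
proof -
  have fF: "f \<in> carrier F" using assms by auto
  have 0: "(\<lambda>_. 0) \<otimes>\<^bsub>F\<^esub> f = (\<lambda>_. 0)" "f \<otimes>\<^bsub>F\<^esub> (\<lambda>_. 0) = (\<lambda>_. 0)" by simp_all
  show "x \<otimes>\<^bsub>F\<^esub> f \<in> N" if "\<And>c w. monomial c w \<otimes>\<^bsub>F\<^esub> f \<in> N"
    using x
  proof (induction rule: F_induct)
    case (add c w g)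
    then show ?case
      using F.l_distr[OF monomial_closed add(1) fF] assms(1) that by metis
  qed (use 0 assms(2) in metis)
  show "f \<otimes>\<^bsub>F\<^esub> x \<in> N" if "\<And>c w. f \<otimes>\<^bsub>F\<^esub> monomial c w \<in> N"
    using x
  proof (induction rule: F_induct)
    case (add c w g)
    then show ?case
      using F.r_distr[OF monomial_closed add(1) fF] assms(1) that by metis
  qed (use 0 assms(2) in metis)
qed

text \<open>Multiples of words suffice as multipliers because they span the free algebra; among them, the multiple
  \<open>-1\<close> of the empty word provides negation.\<close>

lemma F_idealI:
  assumes "N \<subseteq> carrier F" "(\<lambda>_. 0) \<in> N" "\<And>f g. \<lbrakk>f \<in> N; g \<in> N\<rbrakk> \<Longrightarrow> f \<oplus>\<^bsub>F\<^esub> g \<in> N"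
    and "\<And>c w f. f \<in> N \<Longrightarrow> monomial c w \<otimes>\<^bsub>F\<^esub> f \<in> N" "\<And>c w f. f \<in> N \<Longrightarrow> f \<otimes>\<^bsub>F\<^esub> monomial c w \<in> N"
  shows "ideal N F"
proof (rule idealI[OF ring_F])
  show "subgroup N (add_monoid F)"
  proof (rule F.add.subgroupI)
    fix f assume f: "f \<in> N"
    have "\<ominus>\<^bsub>F\<^esub> f = monomial (-1) [] \<otimes>\<^bsub>F\<^esub> f"
      unfolding monomial_empty_mult by (rule F.minus_equality) (use f assms(1) in auto)
    then show "\<ominus>\<^bsub>F\<^esub> f \<in> N" using assms(4)[OF f] by simp
  qed (use assms in auto)
  fix f x :: "'a word \<Rightarrow> complex" assume f: "f \<in> N" and x: "x \<in> carrier F"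
  show "x \<otimes>\<^bsub>F\<^esub> f \<in> N"
    by (rule additive_mult_closed(1)[OF assms(3,2,1) x f assms(4)[OF f]])
  show "f \<otimes>\<^bsub>F\<^esub> x \<in> N"
    by (rule additive_mult_closed(2)[OF assms(3,2,1) x f assms(5)[OF f]])
qed

section \<open>Quotients by *-ideals\<close>

locale star_quotient =
  fixes X :: "('g word \<Rightarrow> complex) set"
  assumes X_closed: "X \<subseteq> carrier F"
begin

definition I :: "('g word \<Rightarrow> complex) set" where "I = star_ideal F X"

abbreviation S :: "('g word \<Rightarrow> complex) set star_algebra" where
  "S \<equiv> quot_star_algebra F I"

abbreviation cs :: "('g word \<Rightarrow> complex) \<Rightarrow> ('g word \<Rightarrow> complex) set" where
  "cs f \<equiv> I +>\<^bsub>F\<^esub> f"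

lemma gens_closed: "X \<union> star F ` X \<subseteq> carrier F"
  using X_closed F_star_closed by (auto simp del: F_simps)

lemma ideal_I: "ideal I F"
  unfolding I_def star_ideal_def by (rule F.genideal_ideal[OF gens_closed])

sublocale I: ideal I F by (rule ideal_I)

lemma gens_in_I: "X \<subseteq> I" "star F ` X \<subseteq> I"
  using F.genideal_self[OF gens_closed] by (auto simp: I_def star_ideal_def)

lemma I_minimal:
  assumes "ideal N F" "X \<subseteq> N" "star F ` X \<subseteq> N"
  shows "I \<subseteq> N"
  unfolding I_def star_ideal_def by (rule F.genideal_minimal) (use assms in auto)

lemma I_smult: "f \<in> I \<Longrightarrow> c \<odot>\<^bsub>F\<^esub> f \<in> I"
  using I.I_l_closed[OF _ monomial_closed[of c "[]"], of f] by (simp only: monomial_empty_mult)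

text \<open>The elements whose adjoint lies in \<open>I\<close> form an ideal, and it contains the generators of \<open>I\<close> because these are
  closed under the star.\<close>

lemma I_star: "f \<in> I \<Longrightarrow> star F f \<in> I"
proof -
  let ?N = "{f \<in> carrier F. star F f \<in> I}"
  have "ideal ?N F"
  proof (rule F_idealI)
    have "star F (\<lambda>_. 0 :: complex) = \<zero>\<^bsub>F\<^esub>" by simp
    then show "(\<lambda>_. 0) \<in> ?N" using I.zero_closed by simp
    fix f g assume f: "f \<in> ?N" and g: "g \<in> ?N"
    show "f \<oplus>\<^bsub>F\<^esub> g \<in> ?N"
      using f g F.a_closed[of f g] I.a_closed[of "star F f" "star F g"] F_star_add[of f g]
      by (simp del: F_simps)
  next
    fix c and w :: "'g word" and f assume f: "f \<in> ?N"
    note closed = F.m_closed[OF monomial_closed] F.m_closed[OF _ monomial_closed] monomial_closed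
      I.I_r_closed[OF _ monomial_closed] I.I_l_closed[OF _ monomial_closed]
    show "monomial c w \<otimes>\<^bsub>F\<^esub> f \<in> ?N" "f \<otimes>\<^bsub>F\<^esub> monomial c w \<in> ?N"
      using f by (simp_all del: F_simps add: F_star_mult F_star_monomial closed)
  qed auto
  moreover have "X \<subseteq> ?N" using X_closed gens_in_I by auto
  moreover have "star F ` X \<subseteq> ?N"
    using X_closed gens_in_I F_star_closed by (auto simp del: F_simps simp: F_star_star)
  ultimately show "f \<in> I \<Longrightarrow> star F f \<in> I" using I_minimal by blast
qed

lemma I_carrier: "f \<in> I \<Longrightarrow> f \<in> carrier F" by (rule I.a_Hcarr)

lemma cs_eq_iff:
  assumes "f \<in> carrier F" "g \<in> carrier F"
  shows "cs f = cs g \<longleftrightarrow> (\<lambda>w. f w - g w) \<in> I"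
  using F.quotient_eq_iff_same_a_r_cos[OF ideal_I assms] F_minus[OF assms] by simp

lemma mem_cs: "f \<in> carrier F \<Longrightarrow> f \<in> cs f"
  by (rule I.a_rcos_self)

lemma cs_memD:
  assumes "g \<in> cs f" "f \<in> carrier F"
  shows "g \<in> carrier F" "cs g = cs f" "(\<lambda>w. g w - f w) \<in> I"
proof -
  show g: "g \<in> carrier F"
    using assms F.a_r_coset_subset_G[OF I.a_subset assms(2)] by blast
  show "cs g = cs f"
    by (rule F.a_repr_independence[OF assms I.a_subgroup, symmetric])
  then show "(\<lambda>w. g w - f w) \<in> I" using cs_eq_iff[OF g assms(2)] by simp
qed

lemma S_simps:
  "carrier S = a_rcosets\<^bsub>F\<^esub> I" "zero S = I" "one S = cs \<one>\<^bsub>F\<^esub>"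
  by (simp_all add: quot_star_algebra_def FactRing_def)

lemma S_carrierE:
  assumes "x \<in> carrier S"
  obtains f where "f \<in> carrier F" "x = cs f"
  using assms unfolding S_simps by (auto simp: A_RCOSETS_def')
   
lemma cs_closed: "f \<in> carrier F \<Longrightarrow> cs f \<in> carrier S"
  unfolding S_simps by (rule F.a_rcosetsI[OF I.a_subset])

lemma cs_zero: "cs (\<lambda>_. 0) = \<zero>\<^bsub>S\<^esub>"
  unfolding S_simps using F.a_coset_add_zero[OF I.a_subset] by simp

lemma cs_add: "\<lbrakk>f \<in> carrier F; g \<in> carrier F\<rbrakk> \<Longrightarrow> cs f \<oplus>\<^bsub>S\<^esub> cs g = cs (f \<oplus>\<^bsub>F\<^esub> g)"
  using I.a_rcos_sum[of f g] by (simp add: quot_star_algebra_def FactRing_def)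

lemma cs_mult: "\<lbrakk>f \<in> carrier F; g \<in> carrier F\<rbrakk> \<Longrightarrow> cs f \<otimes>\<^bsub>S\<^esub> cs g = cs (f \<otimes>\<^bsub>F\<^esub> g)"
  using I.rcoset_mult_add[of f g] by (simp add: quot_star_algebra_def FactRing_def)

lemma cs_smult:
  assumes f: "f \<in> carrier F"
  shows "c \<odot>\<^bsub>S\<^esub> cs f = cs (c \<odot>\<^bsub>F\<^esub> f)"
proof -
  have "cs (c \<odot>\<^bsub>F\<^esub> g) = cs (c \<odot>\<^bsub>F\<^esub> f)" if g: "g \<in> cs f" for g
  proof -
    note gD = cs_memD[OF g f]
    have "(\<lambda>w. (c \<odot>\<^bsub>F\<^esub> g) w - (c \<odot>\<^bsub>F\<^esub> f) w) = c \<odot>\<^bsub>F\<^esub> (\<lambda>w. g w - f w)"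
      by (simp add: algebra_simps)
    then show ?thesis
      using I_smult[OF gD(3)] cs_eq_iff[OF F_smult_closed[OF gD(1)] F_smult_closed[OF f]] by simp
  qed
  then have "(\<Union>g\<in>cs f. cs (c \<odot>\<^bsub>F\<^esub> g)) = (\<Union>g\<in>cs f. cs (c \<odot>\<^bsub>F\<^esub> f))"
    by (intro SUP_cong refl)
  then show ?thesis using mem_cs[OF f] by (auto simp: quot_star_algebra_def)
qed

lemma cs_star:
  assumes f: "f \<in> carrier F"
  shows "star S (cs f) = cs (star F f)"
proof -
  have "cs (star F g) = cs (star F f)" if g: "g \<in> cs f" for g
  proof -
    note gD = cs_memD[OF g f]
    have "(\<lambda>w. star F g w - star F f w) = star F (\<lambda>w. g w - f w)"
      by simp
    then show ?thesis
      using I_star[OF gD(3)] cs_eq_iff[OF F_star_closed[OF gD(1)] F_star_closed[OF f]] by simp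
  qed
  then have "(\<Union>g\<in>cs f. cs (star F g)) = (\<Union>g\<in>cs f. cs (star F f))"
    by (intro SUP_cong refl)
  then show ?thesis using mem_cs[OF f] by (auto simp: quot_star_algebra_def)
qed

lemma abelian_monoid_S: "abelian_monoid S"
proof -
  interpret Q: ring "F Quot I" by (rule I.quotient_is_ring)
  show ?thesis
    using Q.zero_closed Q.a_closed Q.l_zero Q.a_assoc Q.a_comm
    by (intro abelian_monoidI) (simp_all add: quot_star_algebra_def)
qed

text \<open>The image of a coset under evaluation is a singleton as soon as evaluation is constant on this coset.\<close>

lemma induced_hom_cs:
  assumes f: "f \<in> carrier F"
    and "\<And>g. \<lbrakk>g \<in> carrier F; (\<lambda>w. g w - f w) \<in> I\<rbrakk> \<Longrightarrow> free_eval A x g = free_eval A x f"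
  shows "induced_hom A x (cs f) = free_eval A x f"
proof -
  have "free_eval A x ` cs f = {free_eval A x f}"
    using mem_cs[OF f] cs_memD[OF _ f] assms(2) by blast
  then show ?thesis by (simp add: induced_hom_def)
qed

end

section \<open>The grading of the algebra of quantum SU(2)\<close>

lemma free_gen_eq: "free_gen g = monomial 1 [(g, False)]"
  by (simp add: free_gen_def monomial_def)

lemma smult_monomial: "c \<odot>\<^bsub>F\<^esub> monomial d w = monomial (c * d) w"
  by (auto simp: monomial_def)

lemma SU2_relations_eq:
  "SU2_relations q =
    (let a = (Alpha, False); b = (Beta, False); a' = (Alpha, True); b' = (Beta, True); c = complex_of_real q
     in {\<lambda>w. monomial 1 [b, a] w - monomial c [a, b] w,
         \<lambda>w. monomial 1 [b', a] w - monomial c [a, b'] w,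
         \<lambda>w. monomial 1 [b, b'] w - monomial 1 [b', b] w,
         \<lambda>w. (monomial 1 [a, a'] w + monomial 1 [b, b'] w) - monomial 1 [] w,
         \<lambda>w. (monomial 1 [a', a] w + monomial (c\<^sup>2) [b', b] w) - monomial 1 [] w})"
proof -
  have add: "f \<oplus>\<^bsub>F\<^esub> g = (\<lambda>w. f w + g w)" for f g :: "su2_gen word \<Rightarrow> complex" by simp
  have star: "star F (monomial 1 [(g, False)]) = monomial 1 [(g, True)]" for g :: su2_gen
    unfolding F_star_monomial by (simp add: word_star_def)
  note closed = monomial_closed F_add_closed[OF monomial_closed monomial_closed]
  show ?thesis
    unfolding SU2_relations_def Let_def free_gen_eq star monomial_mult smult_monomial F_one
      F_minus[OF monomial_closed monomial_closed] F_minus[OF closed(2) monomial_closed] append.simps mult_1 mult_1_right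
    unfolding add ..
qed

locale su2 =
  fixes q :: real and l :: nat
  assumes q_pos: "0 < q" and q_less_1: "q < 1" and l_pos: "l \<ge> 1"

lemma SU2_relations_closed: "SU2_relations q \<subseteq> carrier F"
proof -
  have fin: "finite {v. monomial c w v \<noteq> 0}" for c and w :: "su2_gen word"
    using monomial_closed[of c w] by simp
  have "finite {v. (f v - g v :: complex) \<noteq> 0}" "finite {v. (f v + g v :: complex) \<noteq> 0}"
    if "finite {v. f v \<noteq> 0}" "finite {v. g v \<noteq> 0}" for f g :: "su2_gen word \<Rightarrow> complex"
    by (rule finite_subset[of _ "{v. f v \<noteq> 0} \<union> {v. g v \<noteq> 0}"]; use that in auto)+
  then show ?thesis
    unfolding SU2_relations_eq Let_def using fin by auto
qed

sublocale su2 \<subseteq> star_quotient "SU2_relations q"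
  by unfold_locales (rule SU2_relations_closed)

fun letter_degree :: "nat \<Rightarrow> su2_gen \<times> bool \<Rightarrow> int" where
  "letter_degree l (g, s) = (if s then - 1 else 1) * (case g of Alpha \<Rightarrow> - 1 | Beta \<Rightarrow> int l)"

definition word_degree :: "nat \<Rightarrow> su2_gen word \<Rightarrow> int" where
  "word_degree l w = sum_list (map (letter_degree l) w)"

lemma word_degree_simps [simp]:
  "word_degree l [] = 0" "word_degree l (x # w) = letter_degree l x + word_degree l w"
  "word_degree l (v @ w) = word_degree l v + word_degree l w"
  by (simp_all add: word_degree_def)

lemma word_degree_word_star: "word_degree l (word_star w) = - word_degree l w"
proof (induction w)
  case (Cons x w)
  obtain g s where "x = (g, s)" by fastforce
  then have "word_degree l (word_star (x # w)) = word_degree l (word_star w) - letter_degree l x"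
    by (simp add: word_star_def)
  then show ?case using Cons by simp
qed (simp add: word_star_def)

definition component :: "nat \<Rightarrow> int \<Rightarrow> (su2_gen word \<Rightarrow> complex) \<Rightarrow> su2_gen word \<Rightarrow> complex" where
  "component l j f = (\<lambda>w. if word_degree l w = j then f w else 0)"

lemma component_closed: "f \<in> carrier F \<Longrightarrow> component l j f \<in> carrier F"
  by (auto simp: component_def intro: finite_subset[of _ "{w. f w \<noteq> 0}"])

lemma component_monomial_mult: "component l j (monomial c u \<otimes>\<^bsub>F\<^esub> f) = monomial c u \<otimes>\<^bsub>F\<^esub> component l (j - word_degree l u) f"
  and component_mult_monomial: "component l j (f \<otimes>\<^bsub>F\<^esub> monomial c u) = component l (j - word_degree l u) f \<otimes>\<^bsub>F\<^esub> monomial c u"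
proof -
  have deg: "word_degree l w = word_degree l (take k w) + word_degree l (drop k w)" for k w
    by (metis append_take_drop_id word_degree_simps(3))
  have drop: "word_degree l (drop k w) = word_degree l w - word_degree l (take k w)"
    and take: "word_degree l (take k w) = word_degree l w - word_degree l (drop k w)" for k w
    using deg[of w k] by simp_all
  show "component l j (monomial c u \<otimes>\<^bsub>F\<^esub> f) = monomial c u \<otimes>\<^bsub>F\<^esub> component l (j - word_degree l u) f"
  proof
    fix w
    show "component l j (monomial c u \<otimes>\<^bsub>F\<^esub> f) w = (monomial c u \<otimes>\<^bsub>F\<^esub> component l (j - word_degree l u) f) w"
    proof (cases "word_degree l w = j")
      case True
      then show ?thesis
        unfolding component_def F_simps by (auto simp: monomial_def drop intro!: sum.cong)
    next
      case False
      then have "monomial c u (take k w) * component l (j - word_degree l u) f (drop k w) = 0" for k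
        using deg[of w k] by (auto simp: component_def monomial_def)
      then have "(monomial c u \<otimes>\<^bsub>F\<^esub> component l (j - word_degree l u) f) w = 0"
        unfolding F_simps by (simp only: sum.neutral_const)
      then show ?thesis using False by (simp only: component_def[of l j] if_False)
    qed
  qed
  show "component l j (f \<otimes>\<^bsub>F\<^esub> monomial c u) = component l (j - word_degree l u) f \<otimes>\<^bsub>F\<^esub> monomial c u"
  proof
    fix w
    show "component l j (f \<otimes>\<^bsub>F\<^esub> monomial c u) w = (component l (j - word_degree l u) f \<otimes>\<^bsub>F\<^esub> monomial c u) w"
    proof (cases "word_degree l w = j")
      case True
      then show ?thesis
        unfolding component_def F_simps by (auto simp: monomial_def take intro!: sum.cong)
    next
      case False
      then have "component l (j - word_degree l u) f (take k w) * monomial c u (drop k w) = 0" for k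
        using deg[of w k] by (auto simp: component_def monomial_def)
      then have "(component l (j - word_degree l u) f \<otimes>\<^bsub>F\<^esub> monomial c u) w = 0"
        unfolding F_simps by (simp only: sum.neutral_const)
      then show ?thesis using False by (simp only: component_def[of l j] if_False)
    qed
  qed
qed

context su2
begin

lemma SU2_eq: "SU2 q = S"
  by (simp add: SU2_def I_def)

lemma SU2_gen_eq: "SU2_gen q g = cs (monomial 1 [(g, False)])"
  by (simp add: SU2_gen_def I_def free_gen_eq)

lemma relations_homogeneous:
  assumes "f \<in> SU2_relations q \<union> star F ` SU2_relations q"
  obtains d where "\<And>w. f w \<noteq> 0 \<Longrightarrow> word_degree l w = d"
proof -
  have rel: "\<exists>d. \<forall>w. f w \<noteq> 0 \<longrightarrow> word_degree l w = d" if "f \<in> SU2_relations q" for f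
  proof -
    let ?h = "\<lambda>f d. \<forall>w. f w \<noteq> 0 \<longrightarrow> word_degree l w = (d :: int)"
    have "?h f (int l - 1) \<or> ?h f (- int l - 1) \<or> ?h f 0"
      using that unfolding SU2_relations_eq Let_def
      by (elim insertE emptyE) (simp_all add: monomial_def)
    then show ?thesis by blast
  qed
  have "\<exists>d. \<forall>w. f w \<noteq> 0 \<longrightarrow> word_degree l w = d"
    using assms
  proof
    assume "f \<in> star F ` SU2_relations q"
    then obtain g where g: "f = star F g" "g \<in> SU2_relations q" by blast
    obtain d where d: "\<And>w. g w \<noteq> 0 \<Longrightarrow> word_degree l w = d" using rel[OF g(2)] by blast
    have "word_degree l w = - d" if "f w \<noteq> 0" for w
      using d[of "word_star w"] that g(1) by (simp add: word_degree_word_star)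
    then show ?thesis by blast
  qed (rule rel)
  then show thesis using that by blast
qed

text \<open>The ideal is graded because it is generated by homogeneous elements: the elements with all components
  in \<open>I\<close> form an ideal that contains the generators.\<close>

lemma component_I: "f \<in> I \<Longrightarrow> component l j f \<in> I"
proof -
  let ?N = "{f \<in> carrier F. \<forall>j. component l j f \<in> I}"
  have zero: "(\<lambda>_. 0) \<in> I" using additive_subgroup.zero_closed[OF I.is_additive_subgroup] unfolding F_simps .
  have "ideal ?N F"
  proof (rule F_idealI)
    show "(\<lambda>_. 0) \<in> ?N" using zero by (simp add: component_def)
    fix f g assume f: "f \<in> ?N" and g: "g \<in> ?N"
    have "component l j (f \<oplus>\<^bsub>F\<^esub> g) = component l j f \<oplus>\<^bsub>F\<^esub> component l j g" for j by (auto simp: component_def)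
    then show "f \<oplus>\<^bsub>F\<^esub> g \<in> ?N"
      using f g F.a_closed[of f g] I.a_closed[of "component l j f" "component l j g" for j] by (simp del: F_simps)
  next
    fix c and w :: "su2_gen word" and f assume f: "f \<in> ?N"
    note closed = F.m_closed[OF monomial_closed] F.m_closed[OF _ monomial_closed] monomial_closed
      I.I_r_closed[OF _ monomial_closed] I.I_l_closed[OF _ monomial_closed]
    show "monomial c w \<otimes>\<^bsub>F\<^esub> f \<in> ?N" "f \<otimes>\<^bsub>F\<^esub> monomial c w \<in> ?N"
      using f by (simp_all del: F_simps add: component_monomial_mult component_mult_monomial closed)
  qed auto
  moreover have "f \<in> ?N" if rel: "f \<in> SU2_relations q \<union> star F ` SU2_relations q" for f
  proof -
    obtain d where d: "\<And>w. f w \<noteq> 0 \<Longrightarrow> word_degree l w = d" using rel by (rule relations_homogeneous) blast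
    have "component l j f = (if j = d then f else (\<lambda>_. 0))" for j using d by (auto simp: component_def fun_eq_iff)
    moreover have "f \<in> I" using gens_in_I rel by blast
    ultimately show ?thesis using zero I_carrier[of f] by simp
  qed
  ultimately show "f \<in> I \<Longrightarrow> component l j f \<in> I" using I_minimal by blast
qed

abbreviation "L \<equiv> laurent_tensor S"

sublocale S: abelian_monoid S by (rule abelian_monoid_S)

lemma L_simps:
  "carrier L = {t. range t \<subseteq> carrier S \<and> finite {j. t j \<noteq> \<zero>\<^bsub>S\<^esub>}}" "zero L = (\<lambda>j. \<zero>\<^bsub>S\<^esub>)"
  "add L = (\<lambda>t t' j. t j \<oplus>\<^bsub>S\<^esub> t' j)" "smult L = (\<lambda>c t j. c \<odot>\<^bsub>S\<^esub> t j)"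
  "one L = tensor_u S \<one>\<^bsub>S\<^esub> 0"
  "mult L = (\<lambda>t t' j. \<Oplus>\<^bsub>S\<^esub>k\<in>{k. t k \<noteq> \<zero>\<^bsub>S\<^esub>}. t k \<otimes>\<^bsub>S\<^esub> t' (j - k))"
  "star L = (\<lambda>t j. star S (t (- j)))"
  by (simp_all add: laurent_tensor_def tensor_u_def fun_eq_iff)

lemma abelian_monoid_L: "abelian_monoid L"
proof (rule abelian_monoidI)
  fix t t' assume t: "t \<in> carrier L" "t' \<in> carrier L"
  then have tv: "t j \<in> carrier S" "t' j \<in> carrier S" for j by (auto simp: L_simps)
  have "{j. t j \<oplus>\<^bsub>S\<^esub> t' j \<noteq> \<zero>\<^bsub>S\<^esub>} \<subseteq> {j. t j \<noteq> \<zero>\<^bsub>S\<^esub>} \<union> {j. t' j \<noteq> \<zero>\<^bsub>S\<^esub>}" by auto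
  then have "finite {j. t j \<oplus>\<^bsub>S\<^esub> t' j \<noteq> \<zero>\<^bsub>S\<^esub>}" using t by (auto simp: L_simps intro: finite_subset)
  then show "t \<oplus>\<^bsub>L\<^esub> t' \<in> carrier L" using tv by (auto simp: L_simps)
  show "t \<oplus>\<^bsub>L\<^esub> t' = t' \<oplus>\<^bsub>L\<^esub> t" using tv by (simp add: L_simps S.a_comm)
  show "\<zero>\<^bsub>L\<^esub> \<oplus>\<^bsub>L\<^esub> t = t" using tv by (simp add: L_simps)
  fix t'' assume t'': "t'' \<in> carrier L"
  then have "t'' j \<in> carrier S" for j by (auto simp: L_simps)
  then show "t \<oplus>\<^bsub>L\<^esub> t' \<oplus>\<^bsub>L\<^esub> t'' = t \<oplus>\<^bsub>L\<^esub> (t' \<oplus>\<^bsub>L\<^esub> t'')"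
    using tv by (simp add: L_simps S.a_assoc)
qed (auto simp: L_simps)

sublocale L: abelian_monoid L by (rule abelian_monoid_L)

lemma cs_mult_zero: "f \<in> carrier F \<Longrightarrow> cs f \<otimes>\<^bsub>S\<^esub> \<zero>\<^bsub>S\<^esub> = \<zero>\<^bsub>S\<^esub>" "f \<in> carrier F \<Longrightarrow> \<zero>\<^bsub>S\<^esub> \<otimes>\<^bsub>S\<^esub> cs f = \<zero>\<^bsub>S\<^esub>"
  using cs_mult[of f "\<lambda>_. 0"] cs_mult[of "\<lambda>_. 0" f] by (simp_all add: cs_zero)

lemma tensor_u_mult:
  assumes f: "f \<in> carrier F" and g: "g \<in> carrier F"
  shows "tensor_u S (cs f) i \<otimes>\<^bsub>L\<^esub> tensor_u S (cs g) j = tensor_u S (cs (f \<otimes>\<^bsub>F\<^esub> g)) (i + j)"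
proof
  fix k
  let ?term = "\<lambda>m. tensor_u S (cs f) i m \<otimes>\<^bsub>S\<^esub> tensor_u S (cs g) j (k - m)"
  have m: "?term i = tensor_u S (cs (f \<otimes>\<^bsub>F\<^esub> g)) (i + j) k"
    using cs_mult[OF f g] cs_mult_zero(1)[OF f] by (auto simp: tensor_u_def)
  have closed: "tensor_u S (cs (f \<otimes>\<^bsub>F\<^esub> g)) (i + j) k \<in> carrier S"
    using cs_closed[OF F_mult_closed[OF f g]] S.zero_closed by (simp add: tensor_u_def)
  show "(tensor_u S (cs f) i \<otimes>\<^bsub>L\<^esub> tensor_u S (cs g) j) k = tensor_u S (cs (f \<otimes>\<^bsub>F\<^esub> g)) (i + j) k"
  proof (cases "cs f = \<zero>\<^bsub>S\<^esub>")
    case True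
    then have "{k. tensor_u S (cs f) i k \<noteq> \<zero>\<^bsub>S\<^esub>} = {}" by (auto simp: tensor_u_def)
    moreover have "cs (f \<otimes>\<^bsub>F\<^esub> g) = \<zero>\<^bsub>S\<^esub>"
      using cs_mult[OF f g] True cs_mult_zero(2)[OF g] by simp
    ultimately show ?thesis by (simp add: L_simps) (simp add: tensor_u_def)
  next
    case False
    then have "{k. tensor_u S (cs f) i k \<noteq> \<zero>\<^bsub>S\<^esub>} = {i}" by (auto simp: tensor_u_def)
    then have "(tensor_u S (cs f) i \<otimes>\<^bsub>L\<^esub> tensor_u S (cs g) j) k = (\<Oplus>\<^bsub>S\<^esub>m\<in>{i}. ?term m)"
      by (simp only: L_simps)
    also have "\<dots> = ?term i"
      using closed by (subst S.finsum_insert) (simp_all add: m)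
    finally show ?thesis using m by simp
  qed
qed

abbreviation coaction_gen :: "su2_gen \<Rightarrow> int \<Rightarrow> (su2_gen word \<Rightarrow> complex) set" where
  "coaction_gen \<equiv> (\<lambda>g. case g of Alpha \<Rightarrow> tensor_u (SU2 q) (SU2_gen q Alpha) (- 1)
                  | Beta \<Rightarrow> tensor_u (SU2 q) (SU2_gen q Beta) (int l))"

lemma coaction_letter:
  "letter_eval L coaction_gen x = tensor_u S (cs (monomial 1 [x])) (letter_degree l x)"
proof -
  obtain g s where x: "x = (g, s)" by fastforce
  have star: "star S (cs (monomial 1 [(g, False)])) = cs (monomial 1 [(g, True)])" for g
    unfolding cs_star[OF monomial_closed] F_star_monomial by (simp add: word_star_def)
  have zero: "star S \<zero>\<^bsub>S\<^esub> = \<zero>\<^bsub>S\<^esub>"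
    using cs_star[of "\<lambda>_. 0"] by (simp add: cs_zero)
  show ?thesis
    unfolding x by (cases g) (auto simp: SU2_eq SU2_gen_eq L_simps star zero tensor_u_def fun_eq_iff)
qed

text \<open>Each word is mapped to itself tensored with the power of \<open>u\<close> given by its degree, so the coaction
  sorts an element by the degrees of its words.\<close>

lemma coaction_word:
  "foldr (\<lambda>a y. letter_eval L coaction_gen a \<otimes>\<^bsub>L\<^esub> y) w \<one>\<^bsub>L\<^esub> = tensor_u S (cs (monomial 1 w)) (word_degree l w)"
proof (induction w)
  case Nil
  show ?case by (simp add: L_simps(5) S_simps(3) F_one del: F_simps)
next
  case (Cons x w)
  then show ?case
    by (simp add: coaction_letter tensor_u_mult[OF monomial_closed monomial_closed] monomial_mult del: F_simps)
qed

lemma tensor_u_closed: "f \<in> carrier F \<Longrightarrow> tensor_u S (cs f) i \<in> carrier L"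
  using cs_closed[of f] S.zero_closed
  by (auto simp: L_simps tensor_u_def intro: finite_subset[of _ "{i}"])

lemma free_eval_coaction:
  assumes f: "f \<in> carrier F"
  shows "free_eval L coaction_gen f = (\<lambda>j. cs (component l j f))"
proof -
  have "(\<Oplus>\<^bsub>L\<^esub>w\<in>A. f w \<odot>\<^bsub>L\<^esub> tensor_u S (cs (monomial 1 w)) (word_degree l w))
      = (\<lambda>j. cs (component l j (\<lambda>w. if w \<in> A then f w else 0)))" if "finite A" for A
    using that
  proof (induction A)
    case empty
    show ?case by (simp add: component_def L_simps(2) cs_zero)
  next
    case (insert w A)
    have smult: "f w \<odot>\<^bsub>L\<^esub> tensor_u S (cs (monomial 1 w)) (word_degree l w) = tensor_u S (cs (monomial (f w) w)) (word_degree l w)" for w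
    proof
      fix j
      have "f w \<odot>\<^bsub>S\<^esub> cs (\<lambda>_. 0) = \<zero>\<^bsub>S\<^esub>"
        by (subst cs_smult) (simp_all add: cs_zero)
      then show "(f w \<odot>\<^bsub>L\<^esub> tensor_u S (cs (monomial 1 w)) (word_degree l w)) j = tensor_u S (cs (monomial (f w) w)) (word_degree l w) j"
        unfolding L_simps tensor_u_def using cs_smult[OF monomial_closed, of "f w" 1 w]
        by (simp add: cs_zero smult_monomial del: F_simps)
    qed
    have c: "component l j (\<lambda>w. if w \<in> A then f w else 0) \<in> carrier F" for j and A
      using f by (auto simp: component_def intro: finite_subset[of _ "{w. f w \<noteq> 0}"])
    have "(\<Oplus>\<^bsub>L\<^esub>w\<in>insert w A. f w \<odot>\<^bsub>L\<^esub> tensor_u S (cs (monomial 1 w)) (word_degree l w))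
      = tensor_u S (cs (monomial (f w) w)) (word_degree l w) \<oplus>\<^bsub>L\<^esub> (\<lambda>j. cs (component l j (\<lambda>w. if w \<in> A then f w else 0)))"
      using insert.hyps insert.IH
      by (subst L.finsum_insert) (auto simp: smult intro!: tensor_u_closed monomial_closed simp del: F_simps)
    also have "\<dots> = (\<lambda>j. cs (component l j (\<lambda>v. if v \<in> insert w A then f v else 0)))"
    proof
      fix j
      have t: "tensor_u S (cs (monomial (f w) w)) (word_degree l w) j = cs (component l j (monomial (f w) w))"
        by (cases "j = word_degree l w") (auto simp: tensor_u_def component_def monomial_def fun_eq_iff cs_zero[symmetric] intro!: arg_cong[of _ _ cs])
      have "component l j (monomial (f w) w) \<oplus>\<^bsub>F\<^esub> component l j (\<lambda>w. if w \<in> A then f w else 0)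
          = component l j (\<lambda>v. if v \<in> insert w A then f v else 0)"
        using insert.hyps by (auto simp: component_def monomial_def)
      then show "(tensor_u S (cs (monomial (f w) w)) (word_degree l w) \<oplus>\<^bsub>L\<^esub> (\<lambda>j. cs (component l j (\<lambda>w. if w \<in> A then f w else 0)))) j
          = cs (component l j (\<lambda>v. if v \<in> insert w A then f v else 0))"
        using cs_add[OF component_closed[OF monomial_closed[of "f w" w]] c[of j A], of l j] by (simp add: L_simps t del: F_simps)
    qed
    finally show ?case .
  qed
  moreover have "component l j (\<lambda>w. if w \<in> {w. f w \<noteq> 0} then f w else 0) = component l j f" for j
    by (auto simp: component_def)
  ultimately show ?thesis
    using f by (simp only: free_eval_def coaction_word F_simps mem_Collect_eq)
qed

lemma coaction_cs:
  assumes f: "f \<in> carrier F"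
  shows "coaction q l (cs f) = (\<lambda>j. cs (component l j f))"
proof -
  have "induced_hom L coaction_gen (cs f) = free_eval L coaction_gen f"
  proof (rule induced_hom_cs[OF f])
    fix g assume g: "g \<in> carrier F" "(\<lambda>w. g w - f w) \<in> I"
    have "cs (component l j g) = cs (component l j f)" for j
    proof -
      have "(\<lambda>w. component l j g w - component l j f w) = component l j (\<lambda>w. g w - f w)" by (auto simp: component_def)
      then show ?thesis
        using component_I[OF g(2)] cs_eq_iff[OF component_closed[OF g(1)] component_closed[OF f]] by simp
    qed
    then show "free_eval L coaction_gen g = free_eval L coaction_gen f"
      by (simp add: free_eval_coaction[OF g(1)] free_eval_coaction[OF f])
  qed
  then show ?thesis by (simp add: coaction_def SU2_eq free_eval_coaction[OF f])
qed

lemma SU2_degree_eq: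
  "SU2_degree q l i = {cs f |f. f \<in> carrier F \<and> (\<forall>w. f w \<noteq> 0 \<longrightarrow> word_degree l w = i)}"
proof (intro equalityI subsetI)
  fix t assume t: "t \<in> SU2_degree q l i"
  then obtain f where f: "f \<in> carrier F" "t = cs f"
    by (auto simp: SU2_degree_def SU2_eq elim: S_carrierE)
  have "cs (component l i f) = t"
    using t fun_cong[of "coaction q l t" "tensor_u S t i" i]
    unfolding f(2) coaction_cs[OF f(1)] by (simp add: SU2_degree_def SU2_eq coaction_cs[OF f(1)] tensor_u_def)
  then have "t = cs (component l i f) \<and> component l i f \<in> carrier F \<and> (\<forall>w. component l i f w \<noteq> 0 \<longrightarrow> word_degree l w = i)"
    using component_closed[OF f(1)] by (auto simp: component_def)
  then show "t \<in> {cs f |f. f \<in> carrier F \<and> (\<forall>w. f w \<noteq> 0 \<longrightarrow> word_degree l w = i)}" by blast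
next
  fix t assume "t \<in> {cs f |f. f \<in> carrier F \<and> (\<forall>w. f w \<noteq> 0 \<longrightarrow> word_degree l w = i)}"
  then obtain f where f: "f \<in> carrier F" "\<And>w. f w \<noteq> 0 \<Longrightarrow> word_degree l w = i" "t = cs f" by blast
  have "component l j f = (if j = i then f else (\<lambda>_. 0))" for j
    using f(2) by (auto simp: component_def fun_eq_iff)
  then have "coaction q l t = tensor_u S t i"
    unfolding f(3) coaction_cs[OF f(1)] by (intro ext) (simp add: tensor_u_def cs_zero)
  then show "t \<in> SU2_degree q l i"
    using cs_closed[OF f(1)] f(3) by (simp add: SU2_degree_def SU2_eq)
qed

end

section \<open>Square-summable families\<close>

lemma coord_simps [simp]:
  "ell2_coord (x + y) i = ell2_coord x i + ell2_coord y i" "ell2_coord 0 i = 0"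
  "ell2_coord (- x) i = - ell2_coord x i" "ell2_coord (scaleC_ell2 c x) i = c * ell2_coord x i"
  "ell2_coord (ket j) i = (if i = j then 1 else 0)"
  by (simp_all add: plus_ell2.rep_eq zero_ell2.rep_eq uminus_ell2.rep_eq scaleC_ell2.rep_eq ket.rep_eq)

lemma coord_diff [simp]: "ell2_coord (x - y) i = ell2_coord x i - ell2_coord y i"
  unfolding minus_ell2_def coord_simps by (rule add_uminus_conv_diff)

lemma coord_scaleR [simp]: "ell2_coord (c *\<^sub>R x) i = complex_of_real c * ell2_coord x i"
  by (simp add: scaleR_ell2_def)

lemma coord_sum: "ell2_coord (\<Sum>k\<in>A. f k) i = (\<Sum>k\<in>A. ell2_coord (f k) i)"
  by (induction A rule: infinite_finite_induct) auto

lemma ell2_eqI: "(\<And>i. ell2_coord x i = ell2_coord y i) \<Longrightarrow> x = y"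
  by (rule ell2_coord_inject[THEN iffD1], rule ext)

lemma ell2_summable: "(\<lambda>i. (cmod (ell2_coord x i))\<^sup>2) summable_on UNIV"
  using ell2_coord[of x] by simp

lemma cinner_summable: "(\<lambda>i. cnj (ell2_coord x i) * ell2_coord y i) summable_on UNIV"
  by (intro square_summable_mult ell2_summable)

lemma ell2_norm_sq: "(norm x)\<^sup>2 = (\<Sum>\<^sub>\<infinity>i. (cmod (ell2_coord x i))\<^sup>2)"
proof -
  have "(norm x)\<^sup>2 = Re (\<Sum>\<^sub>\<infinity>i. cnj (ell2_coord x i) * ell2_coord x i)"
    by (simp add: power2_norm_eq_inner inner_ell2_def cinner_ell2_def)
  also have "\<dots> = (\<Sum>\<^sub>\<infinity>i. Re (cnj (ell2_coord x i) * ell2_coord x i))"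
    using infsum_Re[OF cinner_summable[of x x]] by simp
  finally show ?thesis by (simp add: cmod_def power2_eq_square)
qed

lemma finite_sum_le_norm: "finite A \<Longrightarrow> (\<Sum>i\<in>A. (cmod (ell2_coord x i))\<^sup>2) \<le> (norm x)\<^sup>2"
  unfolding ell2_norm_sq by (rule finite_sum_le_infsum[OF ell2_summable]) auto

lemma coord_le_norm: "cmod (ell2_coord x i) \<le> norm x"
  using finite_sum_le_norm[of "{i}" x] by (simp add: power2_le_iff_abs_le)

lemma bounded_linear_coord: "bounded_linear (\<lambda>x. ell2_coord x i)"
  by (rule bounded_linear_intro[of _ 1]) (auto simp: coord_le_norm scaleR_conv_of_real)

lemma ell2_normI:
  assumes "\<And>A. finite A \<Longrightarrow> (\<Sum>i\<in>A. (cmod (f i))\<^sup>2) \<le> B\<^sup>2" "B \<ge> 0"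
  obtains x where "ell2_coord x = f" "norm x \<le> B"
proof -
  have s: "(\<lambda>i. (cmod (f i))\<^sup>2) summable_on UNIV"
    by (rule nonneg_bdd_above_summable_on) (use assms(1) in \<open>auto simp: bdd_above_def\<close>)
  define x where "x = Abs_ell2 f"
  have x: "ell2_coord x = f" using s by (simp add: x_def Abs_ell2_inverse)
  have "(norm x)\<^sup>2 \<le> B\<^sup>2"
    unfolding ell2_norm_sq x by (rule infsum_le_finite_sums[OF s]) (use assms(1) in auto)
  then have "norm x \<le> B" using assms(2) power2_le_imp_le by blast
  then show thesis using x that by blast
qed

text \<open>Bounds on finite partial sums pass to the coordinatewise limit of a Cauchy sequence.\<close>

instance ell2 :: (type) banach
proof
  fix X :: "nat \<Rightarrow> 'a ell2"
  assume X: "Cauchy X"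
  have "Cauchy (\<lambda>n. ell2_coord (X n) i)" for i
    using bounded_linear.Cauchy[OF bounded_linear_coord X] .
  then have "\<exists>f. \<forall>i. (\<lambda>n. ell2_coord (X n) i) \<longlonglongrightarrow> f i"
    by (intro choice allI) (simp add: Cauchy_convergent_iff convergent_def)
  then obtain f where f: "\<And>i. (\<lambda>n. ell2_coord (X n) i) \<longlonglongrightarrow> f i" by blast
  have bound: "\<exists>N. \<forall>m\<ge>N. \<forall>A. finite A \<longrightarrow> (\<Sum>i\<in>A. (cmod (f i - ell2_coord (X m) i))\<^sup>2) \<le> e\<^sup>2"
    if e: "e > 0" for e
  proof -
    obtain N where N: "\<And>m n. m \<ge> N \<Longrightarrow> n \<ge> N \<Longrightarrow> norm (X m - X n) < e"
      using CauchyD[OF X e] by blast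
    have "(\<Sum>i\<in>A. (cmod (f i - ell2_coord (X m) i))\<^sup>2) \<le> e\<^sup>2" if "m \<ge> N" "finite A" for m A
    proof (rule tendsto_upperbound)
      show "(\<lambda>n. \<Sum>i\<in>A. (cmod (ell2_coord (X n - X m) i))\<^sup>2) \<longlonglongrightarrow> (\<Sum>i\<in>A. (cmod (f i - ell2_coord (X m) i))\<^sup>2)"
        unfolding coord_diff by (intro tendsto_sum tendsto_power tendsto_norm tendsto_diff f tendsto_const)
      show "\<forall>\<^sub>F n in sequentially. (\<Sum>i\<in>A. (cmod (ell2_coord (X n - X m) i))\<^sup>2) \<le> e\<^sup>2"
      proof (rule eventually_sequentiallyI[of N])
        fix n assume n: "N \<le> n"
        have "(\<Sum>i\<in>A. (cmod (ell2_coord (X n - X m) i))\<^sup>2) \<le> (norm (X n - X m))\<^sup>2"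
          by (rule finite_sum_le_norm[OF that(2)])
        also have "\<dots> \<le> e\<^sup>2"
          by (rule power_mono[OF less_imp_le[OF N[OF n that(1)]] norm_ge_zero])
        finally show "(\<Sum>i\<in>A. (cmod (ell2_coord (X n - X m) i))\<^sup>2) \<le> e\<^sup>2" .
      qed
    qed simp
    then show ?thesis by (intro exI[of _ N] allI impI)
  qed
  obtain N where "\<forall>m\<ge>N. \<forall>A. finite A \<longrightarrow> (\<Sum>i\<in>A. (cmod (f i - ell2_coord (X m) i))\<^sup>2) \<le> 1\<^sup>2"
    using bound[OF zero_less_one] by (rule exE)
  then have N: "(\<Sum>i\<in>A. (cmod (f i - ell2_coord (X N) i))\<^sup>2) \<le> 1\<^sup>2" if "finite A" for A
    using that by (simp only: order_refl)
  obtain y where y: "ell2_coord y = (\<lambda>i. f i - ell2_coord (X N) i)"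
    by (rule ell2_normI[OF N]) auto
  define x where "x = X N + y"
  have x: "ell2_coord x i = f i" for i by (simp add: x_def y)
  have "X \<longlonglongrightarrow> x"
  proof (rule LIMSEQ_I)
    fix r :: real assume r: "r > 0"
    have "r/2 > 0" using r by simp
    from bound[OF this]
    obtain M where "\<forall>m\<ge>M. \<forall>A. finite A \<longrightarrow> (\<Sum>i\<in>A. (cmod (f i - ell2_coord (X m) i))\<^sup>2) \<le> (r/2)\<^sup>2"
      by (rule exE)
    then have M: "(\<Sum>i\<in>A. (cmod (f i - ell2_coord (X m) i))\<^sup>2) \<le> (r/2)\<^sup>2" if "m \<ge> M" "finite A" for m A
      using that by (simp only: order_refl)
    have "norm (X m - x) < r" if m: "m \<ge> M" for m
    proof -
      obtain z where z: "ell2_coord z = (\<lambda>i. f i - ell2_coord (X m) i)" "norm z \<le> r/2"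
        by (rule ell2_normI[OF M[OF m]]) (use r in auto)
      have "x - X m = z" by (rule ell2_eqI) (simp add: z x)
      then show ?thesis using z(2) r by (simp add: norm_minus_commute)
    qed
    then show "\<exists>no. \<forall>n\<ge>no. norm (X n - x) < r" by blast
  qed
  then show "convergent X" by (rule convergentI)
qed

lemma ket_approx:
  fixes x :: "'i ell2"
  assumes "e > 0"
  obtains A where "finite A" "norm (x - (\<Sum>i\<in>A. scaleC_ell2 (ell2_coord x i) (ket i))) < e"
proof -
  let ?f = "\<lambda>i. (cmod (ell2_coord x i))\<^sup>2"
  have "(?f has_sum (norm x)\<^sup>2) UNIV"
    unfolding ell2_norm_sq using ell2_summable by (rule has_sum_infsum)
  then have "\<forall>\<^sub>F A in finite_subsets_at_top UNIV. dist (sum ?f A) ((norm x)\<^sup>2) < e\<^sup>2"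
    unfolding has_sum_def by (rule tendstoD) (use assms in simp)
  then obtain A where A: "finite A" "dist (sum ?f A) ((norm x)\<^sup>2) < e\<^sup>2"
    by (auto simp: eventually_finite_subsets_at_top)
  let ?y = "x - (\<Sum>i\<in>A. scaleC_ell2 (ell2_coord x i) (ket i))"
  have y: "ell2_coord ?y i = (if i \<in> A then 0 else ell2_coord x i)" for i
  proof -
    have "(\<Sum>k\<in>A. ell2_coord x k * (if i = k then 1 else 0)) = (if i \<in> A then ell2_coord x i else 0)"
    proof -
      have "(\<Sum>k\<in>A. ell2_coord x k * (if i = k then 1 else 0)) = (\<Sum>k\<in>A. if k = i then ell2_coord x k else 0)"
        by (rule sum.cong) auto
      then show ?thesis using A(1) by simp
    qed
    then show ?thesis by (simp add: coord_sum)
  qed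
  have "(\<Sum>i\<in>A'. (cmod (ell2_coord ?y i))\<^sup>2) \<le> (norm x)\<^sup>2 - sum ?f A" if A': "finite A'" for A'
  proof -
    have "(\<Sum>i\<in>A'. (cmod (ell2_coord ?y i))\<^sup>2) = sum ?f (A' - A)"
      unfolding y using A' by (intro sum.mono_neutral_cong_right) auto
    moreover have "sum ?f (A' - A) + sum ?f A = sum ?f (A' - A \<union> A)"
      using A A' by (intro sum.union_disjoint[symmetric]) auto
    moreover have "\<dots> \<le> (norm x)\<^sup>2"
      using A A' by (intro finite_sum_le_norm) auto
    ultimately show ?thesis by simp
  qed
  then have "(norm ?y)\<^sup>2 \<le> (norm x)\<^sup>2 - sum ?f A"
    unfolding ell2_norm_sq[of ?y] by (intro infsum_le_finite_sums[OF ell2_summable]) auto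
  also have "\<dots> < e\<^sup>2" using A(2) by (simp add: dist_real_def)
  finally have "norm ?y < e" using assms by (simp add: power2_less_imp_less)
  then show thesis using A(1) that by blast
qed

text \<open>Finite combinations of the basis vectors are dense. This makes the operators that are prescribed on
  basis vectors unique.\<close>

lemma clinear_op_eqI:
  assumes S: "clinear_op S" and T: "clinear_op T" and "\<And>i. blinfun_apply S (ket i) = blinfun_apply T (ket i)"
  shows "S = T"
proof (rule blinfun_eqI)
  fix x
  let ?D = "S - T"
  have D: "blinfun_apply ?D (scaleC_ell2 c (ket i)) = 0" for c i
    using assms by (simp add: minus_blinfun.rep_eq clinear_op_def)
  have "norm (blinfun_apply ?D x) \<le> 0"
  proof (rule field_le_epsilon)
    fix e :: real assume e: "e > 0"
    have "0 < norm ?D + 1" by (rule add_nonneg_pos[OF norm_ge_zero zero_less_one])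
    then have "0 < e / (norm ?D + 1)" using e by (intro divide_pos_pos)
    then obtain A where A: "finite A" "norm (x - (\<Sum>i\<in>A. scaleC_ell2 (ell2_coord x i) (ket i))) < e / (norm ?D + 1)"
      by (rule ket_approx)
    let ?y = "\<Sum>i\<in>A. scaleC_ell2 (ell2_coord x i) (ket i)"
    have "blinfun_apply ?D ?y = 0"
      by (simp add: blinfun.sum_right D del: minus_blinfun.rep_eq)
    then have "blinfun_apply ?D x = blinfun_apply ?D (x - ?y)"
      by (simp add: blinfun.diff_right)
    then have "norm (blinfun_apply ?D x) \<le> norm ?D * norm (x - ?y)"
      using norm_blinfun[of ?D "x - ?y"] by simp
    also have "\<dots> \<le> norm ?D * (e / (norm ?D + 1))"
      using A(2) by (intro mult_left_mono) auto
    also have "\<dots> \<le> e"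
    proof -
      have "0 < norm ?D + 1" by (simp add: add_nonneg_pos)
      then show ?thesis using e by (simp add: divide_le_eq distrib_left mult.commute)
    qed
    finally show "norm (blinfun_apply ?D x) \<le> 0 + e" by simp
  qed
  then show "blinfun_apply S x = blinfun_apply T x" by (simp add: minus_blinfun.rep_eq)
qed

section \<open>Weighted shifts\<close>

definition bounded_weight :: "(nat \<Rightarrow> complex) \<Rightarrow> bool" where
  "bounded_weight b \<longleftrightarrow> (\<exists>B. \<forall>n. cmod (b n) \<le> B)"

text \<open>Every operator that occurs explicitly below is a weighted shift, or a sum of such. Weights are indexed by the target: up to truncation at
  negative levels, \<open>wshift a k b\<close> maps \<open>e\<^sub>r \<otimes> e\<^sub>n\<close> to \<open>b (n + k)\<close> times \<open>e\<^bsub>r + a\<^esub> \<otimes> e\<^bsub>n + k\<^esub>\<close>. Composition and adjoints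
  then become identities between weights.\<close>

definition wshift_coord :: "int \<Rightarrow> int \<Rightarrow> (nat \<Rightarrow> complex) \<Rightarrow> (int \<times> nat \<Rightarrow> complex) \<Rightarrow> int \<times> nat \<Rightarrow> complex" where
  "wshift_coord a k b f = (\<lambda>(r, n). if k \<le> int n then b n * f (r - a, nat (int n - k)) else 0)"

definition wshift :: "int \<Rightarrow> int \<Rightarrow> (nat \<Rightarrow> complex) \<Rightarrow> operator" where
  "wshift a k b = Blinfun (\<lambda>x. Abs_ell2 (wshift_coord a k b (ell2_coord x)))"

lemma bounded_weightI: "(\<And>n. cmod (b n) \<le> B) \<Longrightarrow> bounded_weight b"
  by (auto simp: bounded_weight_def)

lemma bounded_weightE:
  assumes "bounded_weight b"
  obtains B where "B \<ge> 0" "\<And>n. cmod (b n) \<le> B"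
proof -
  obtain B where B: "\<forall>n. cmod (b n) \<le> B" using assms by (auto simp: bounded_weight_def)
  have "0 \<le> B" by (rule order.trans[OF norm_ge_zero B[rule_format, of 0]])
  then show thesis by (rule that) (rule B[rule_format])
qed

lemma bounded_weight_const [simp]: "bounded_weight (\<lambda>_. c)"
  by (rule bounded_weightI[of _ "cmod c"]) simp

lemma bounded_weight_if [simp]:
  "\<lbrakk>bounded_weight b; bounded_weight c\<rbrakk> \<Longrightarrow> bounded_weight (\<lambda>n. if P n then b n else c n)"
proof -
  assume assms: "bounded_weight b" "bounded_weight c"
  obtain B where B: "B \<ge> 0" "\<And>n. cmod (b n) \<le> B" using assms(1) by (rule bounded_weightE) (rule that)
  obtain C where C: "C \<ge> 0" "\<And>n. cmod (c n) \<le> C" using assms(2) by (rule bounded_weightE) (rule that)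
  have "cmod (if P n then b n else c n) \<le> max B C" for n
    using B(2)[of n] C(2)[of n] by (simp add: le_max_iff_disj)
  then show ?thesis by (rule bounded_weightI)
qed

lemma bounded_weight_mult:
  assumes "bounded_weight b" "bounded_weight c"
  shows "bounded_weight (\<lambda>n. b n * c (f n))"
proof -
  obtain B where B: "B \<ge> 0" "\<And>n. cmod (b n) \<le> B" using assms(1) by (rule bounded_weightE) (rule that)
  obtain C where C: "C \<ge> 0" "\<And>n. cmod (c n) \<le> C" using assms(2) by (rule bounded_weightE) (rule that)
  show ?thesis
    by (rule bounded_weightI[of _ "B * C"]) (unfold norm_mult, rule mult_mono[OF B(2) C(2) B(1) norm_ge_zero])
qed

lemma bounded_weight_add:
  assumes "bounded_weight b" "bounded_weight c"
  shows "bounded_weight (\<lambda>n. b n + c n)"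
proof -
  obtain B where B: "B \<ge> 0" "\<And>n. cmod (b n) \<le> B" using assms(1) by (rule bounded_weightE) (rule that)
  obtain C where C: "C \<ge> 0" "\<And>n. cmod (c n) \<le> C" using assms(2) by (rule bounded_weightE) (rule that)
  show ?thesis
    by (rule bounded_weightI[of _ "B + C"]) (rule order.trans[OF norm_triangle_ineq add_mono[OF B(2) C(2)]])
qed

lemma bounded_weight_cnj: "bounded_weight b \<Longrightarrow> bounded_weight (\<lambda>n. cnj (b (f n)))"
  by (auto simp: bounded_weight_def)

lemma wshift_coord_bound:
  assumes B: "B \<ge> 0" "\<And>n. cmod (b n) \<le> B" and "finite A"
  shows "(\<Sum>i\<in>A. (cmod (wshift_coord a k b (ell2_coord x) i))\<^sup>2) \<le> (B * norm x)\<^sup>2"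
proof -
  define g where "g = (\<lambda>(r, n). (r - a, nat (int n - k)))"
  let ?A = "{(r, n) \<in> A. k \<le> int n}"
  have inj: "inj_on g ?A" by (auto simp: inj_on_def g_def)
  have "(\<Sum>i\<in>A. (cmod (wshift_coord a k b (ell2_coord x) i))\<^sup>2)
      = (\<Sum>i\<in>?A. (cmod (wshift_coord a k b (ell2_coord x) i))\<^sup>2)"
    using assms(3) by (intro sum.mono_neutral_right) (auto simp: wshift_coord_def split: if_splits)
  also have "\<dots> \<le> (\<Sum>i\<in>?A. B\<^sup>2 * (cmod (ell2_coord x (g i)))\<^sup>2)"
  proof (rule sum_mono)
    fix i assume "i \<in> ?A"
    then show "(cmod (wshift_coord a k b (ell2_coord x) i))\<^sup>2 \<le> B\<^sup>2 * (cmod (ell2_coord x (g i)))\<^sup>2"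
      using B by (auto simp: wshift_coord_def g_def norm_mult power_mult_distrib intro!: mult_right_mono power_mono)
  qed
  also have "\<dots> = B\<^sup>2 * (\<Sum>i\<in>g ` ?A. (cmod (ell2_coord x i))\<^sup>2)"
    by (simp add: sum.reindex[OF inj] sum_distrib_left)
  also have "\<dots> \<le> B\<^sup>2 * (norm x)\<^sup>2"
    using assms(3) by (intro mult_left_mono finite_sum_le_norm finite_imageI) (auto intro: finite_subset[of _ A])
  finally show ?thesis by (simp add: power_mult_distrib)
qed

lemma
  assumes B: "B \<ge> 0" "\<And>n. cmod (b n) \<le> B"
  shows wshift_apply': "ell2_coord (blinfun_apply (wshift a k b) x) = wshift_coord a k b (ell2_coord x)" (is ?th1)
    and norm_wshift_le: "norm (wshift a k b) \<le> B" (is ?th2)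
proof -
  define T where "T = (\<lambda>x. Abs_ell2 (wshift_coord a k b (ell2_coord x)))"
  have T: "ell2_coord (T x) = wshift_coord a k b (ell2_coord x)" "norm (T x) \<le> B * norm x" for x
  proof -
    obtain y where "ell2_coord y = wshift_coord a k b (ell2_coord x)" "norm y \<le> B * norm x"
      by (rule ell2_normI[OF wshift_coord_bound[OF B]]) (use B in auto)
    then show "ell2_coord (T x) = wshift_coord a k b (ell2_coord x)" "norm (T x) \<le> B * norm x"
      unfolding T_def by (metis ell2_coord_inverse)+
  qed
  have lin: "bounded_linear T"
  proof (rule bounded_linear_intro[of _ B])
    show "T (x + y) = T x + T y" for x y
      by (rule ell2_eqI) (auto simp: T wshift_coord_def algebra_simps)
    show "T (r *\<^sub>R x) = r *\<^sub>R T x" for r x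
      by (rule ell2_eqI) (auto simp: T wshift_coord_def)
    show "norm (T x) \<le> norm x * B" for x using T(2)[of x] by (simp add: mult.commute)
  qed
  have app: "blinfun_apply (wshift a k b) = T"
    unfolding wshift_def T_def[symmetric] by (rule bounded_linear_Blinfun_apply[OF lin])
  show ?th1 using T(1) by (simp add: app)
  show ?th2 by (rule norm_blinfun_bound) (use B T(2) in \<open>auto simp: app\<close>)
qed

lemma wshift_apply:
  assumes "bounded_weight b"
  shows "ell2_coord (blinfun_apply (wshift a k b) x) (r, n)
    = (if k \<le> int n then b n * ell2_coord x (r - a, nat (int n - k)) else 0)"
proof -
  obtain B where "B \<ge> 0" "\<And>n. cmod (b n) \<le> B" using assms by (rule bounded_weightE) (rule that)
  from wshift_apply'[OF this] show ?thesis by (simp add: wshift_coord_def)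
qed

lemma operator_eqI:
  fixes S T :: operator
  assumes "\<And>x r n. ell2_coord (blinfun_apply S x) (r, n) = ell2_coord (blinfun_apply T x) (r, n)"
  shows "S = T"
proof (intro blinfun_eqI ell2_eqI)
  fix x i
  show "ell2_coord (blinfun_apply S x) i = ell2_coord (blinfun_apply T x) i"
    using assms by (cases i) simp
qed

lemma wshift_cong:
  assumes "\<And>n. k \<le> int n \<Longrightarrow> b n = c n"
  shows "wshift a k b = wshift a k c"
proof -
  have "wshift_coord a k b = wshift_coord a k c"
    using assms by (auto simp: wshift_coord_def fun_eq_iff)
  then show ?thesis by (simp add: wshift_def)
qed

text \<open>The weights of the composition of two weighted shifts.\<close>

definition shift_mult :: "int \<Rightarrow> int \<Rightarrow> (nat \<Rightarrow> complex) \<Rightarrow> (nat \<Rightarrow> complex) \<Rightarrow> nat \<Rightarrow> complex" where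
  "shift_mult k k' b c n = (if k \<le> int n \<and> k' \<le> int n - k then b n * c (nat (int n - k)) else 0)"

lemma bounded_weight_shift_mult:
  "\<lbrakk>bounded_weight b; bounded_weight c\<rbrakk> \<Longrightarrow> bounded_weight (shift_mult k k' b c)"
  unfolding shift_mult_def[abs_def] by (intro bounded_weight_if bounded_weight_mult bounded_weight_const)

lemma wshift_compose:
  assumes "bounded_weight b" "bounded_weight c"
  shows "wshift a k b o\<^sub>L wshift a' k' c = wshift (a + a') (k + k') (shift_mult k k' b c)"
proof (rule operator_eqI)
  fix x r n
  show "ell2_coord (blinfun_apply (wshift a k b o\<^sub>L wshift a' k' c) x) (r, n)
      = ell2_coord (blinfun_apply (wshift (a + a') (k + k') (shift_mult k k' b c)) x) (r, n)"
    by (simp add: wshift_apply[OF assms(1)] wshift_apply[OF assms(2)] wshift_apply[OF bounded_weight_shift_mult[OF assms]])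
      (auto simp: shift_mult_def diff_diff_eq)
qed

lemma wshift_add:
  assumes "bounded_weight b" "bounded_weight c"
  shows "wshift a k b + wshift a k c = wshift a k (\<lambda>n. b n + c n)"
  by (rule operator_eqI)
    (use assms in \<open>auto simp: wshift_apply bounded_weight_add plus_blinfun.rep_eq algebra_simps\<close>)

lemma wshift_minus:
  assumes "bounded_weight b"
  shows "- wshift a k b = wshift a k (\<lambda>n. - b n)"
proof -
  have "bounded_weight (\<lambda>n. - b n)" using assms by (simp add: bounded_weight_def)
  then show ?thesis
    by (intro operator_eqI) (use assms in \<open>auto simp: wshift_apply uminus_blinfun.rep_eq\<close>)
qed

lemma wshift_one: "wshift 0 0 (\<lambda>_. 1) = id_blinfun"
  by (rule operator_eqI) (simp add: wshift_apply)

lemma wshift_zero: "wshift a k (\<lambda>_. 0) = 0"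
  by (rule operator_eqI) (simp add: wshift_apply)

lemma blinfun_apply_scaleC:
  "blinfun_apply (Blinfun (scaleC_ell2 c) :: 'i ell2 \<Rightarrow>\<^sub>L 'i ell2) x = scaleC_ell2 c x"
proof -
  have "bounded_linear (scaleC_ell2 c :: 'i ell2 \<Rightarrow> 'i ell2)"
  proof (rule bounded_linear_intro[of _ "cmod c"])
    fix x y :: "'i ell2" and r :: real
    show "scaleC_ell2 c (x + y) = scaleC_ell2 c x + scaleC_ell2 c y"
      by (rule ell2_eqI) (simp add: algebra_simps)
    show "scaleC_ell2 c (r *\<^sub>R x) = r *\<^sub>R scaleC_ell2 c x"
      by (rule ell2_eqI) simp
    have "(norm (scaleC_ell2 c x))\<^sup>2 = (\<Sum>\<^sub>\<infinity>i. (cmod c)\<^sup>2 * (cmod (ell2_coord x i))\<^sup>2)"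
      unfolding ell2_norm_sq by (simp add: norm_mult power_mult_distrib)
    also have "\<dots> = (cmod c * norm x)\<^sup>2"
      by (simp add: infsum_cmult_right' ell2_norm_sq power_mult_distrib)
    finally have "(norm (scaleC_ell2 c x))\<^sup>2 = (cmod c * norm x)\<^sup>2" .
    then show "norm (scaleC_ell2 c x) \<le> norm x * cmod c"
      by (simp add: mult.commute)
  qed
  then show ?thesis by (simp add: bounded_linear_Blinfun_apply)
qed

lemma Blinfun_scaleC: "Blinfun (scaleC_ell2 c) = wshift 0 0 (\<lambda>_. c)"
  by (rule operator_eqI) (simp add: wshift_apply blinfun_apply_scaleC)

lemma clinear_wshift:
  assumes "bounded_weight b"
  shows "clinear_op (wshift a k b)"
  unfolding clinear_op_def
proof (intro allI ell2_eqI)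
  fix c x i
  show "ell2_coord (blinfun_apply (wshift a k b) (scaleC_ell2 c x)) i
      = ell2_coord (scaleC_ell2 c (blinfun_apply (wshift a k b) x)) i"
    using assms by (cases i) (simp add: wshift_apply)
qed

lemma wshift_ket:
  assumes "bounded_weight b"
  shows "blinfun_apply (wshift a k b) (ket (r, n))
    = (if 0 \<le> int n + k then scaleC_ell2 (b (nat (int n + k))) (ket (r + a, nat (int n + k))) else 0)"
proof (rule ell2_eqI)
  fix i :: "int \<times> nat"
  obtain s m where i: "i = (s, m)" by fastforce
  have iff: "k \<le> int m \<and> (s - a, nat (int m - k)) = (r, n) \<longleftrightarrow> 0 \<le> int n + k \<and> (s, m) = (r + a, nat (int n + k))"
    by auto
  have "ell2_coord (blinfun_apply (wshift a k b) (ket (r, n))) (s, m)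
      = (if k \<le> int m \<and> (s - a, nat (int m - k)) = (r, n) then b m else 0)"
    unfolding wshift_apply[OF assms] coord_simps by simp
  also have "\<dots> = ell2_coord (if 0 \<le> int n + k then scaleC_ell2 (b (nat (int n + k))) (ket (r + a, nat (int n + k))) else 0) (s, m)"
    unfolding iff by auto
  finally show "ell2_coord (blinfun_apply (wshift a k b) (ket (r, n))) i
    = ell2_coord (if 0 \<le> int n + k then scaleC_ell2 (b (nat (int n + k))) (ket (r + a, nat (int n + k))) else 0) i"
    unfolding i .
qed

section \<open>The representation\<close>

text \<open>The weights of the adjoint of a weighted shift.\<close>

definition adj_weight :: "int \<Rightarrow> (nat \<Rightarrow> complex) \<Rightarrow> nat \<Rightarrow> complex" where
  "adj_weight k b n = (if 0 \<le> int n + k then cnj (b (nat (int n + k))) else 0)"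

lemma bounded_weight_adj [simp]: "bounded_weight b \<Longrightarrow> bounded_weight (adj_weight k b)"
  unfolding adj_weight_def[abs_def] by (intro bounded_weight_if bounded_weight_cnj bounded_weight_const)

lemma cinner_wshift:
  assumes b: "bounded_weight b"
  shows "cinner_ell2 (blinfun_apply (wshift a k b) x) y
    = cinner_ell2 x (blinfun_apply (wshift (- a) (- k) (adj_weight k b)) y)"
proof -
  let ?A = "{(r :: int, n). k \<le> int n}" and ?B = "{(r :: int, n). 0 \<le> int n + k}"
  define g where "g = (\<lambda>(r, n). (r - a, nat (int n - k)))"
  define h where "h = (\<lambda>i. cnj (ell2_coord x i) *
    ell2_coord (blinfun_apply (wshift (- a) (- k) (adj_weight k b)) y) i)"
  have bij: "bij_betw g ?A ?B"
    by (rule bij_betw_byWitness[where f' = "\<lambda>(r, n). (r + a, nat (int n + k))"]) (auto simp: g_def)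
  have "cinner_ell2 (blinfun_apply (wshift a k b) x) y = (\<Sum>\<^sub>\<infinity>i\<in>?A. h (g i))"
    unfolding cinner_ell2_def
    by (rule infsum_cong_neutral) (use b in \<open>auto simp: h_def g_def wshift_apply adj_weight_def\<close>)
  also have "\<dots> = (\<Sum>\<^sub>\<infinity>i\<in>?B. h i)"
    by (rule infsum_reindex_bij_betw[OF bij])
  also have "\<dots> = cinner_ell2 x (blinfun_apply (wshift (- a) (- k) (adj_weight k b)) y)"
    unfolding cinner_ell2_def
    by (rule infsum_cong_neutral) (use b in \<open>auto simp: h_def wshift_apply adj_weight_def\<close>)
  finally show ?thesis .
qed

lemma cinner_ket: "cinner_ell2 (ket i) x = ell2_coord x i"
proof -
  have "cinner_ell2 (ket i) x = (\<Sum>\<^sub>\<infinity>j\<in>{i}. ell2_coord x j)"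
    unfolding cinner_ell2_def by (rule infsum_cong_neutral) auto
  then show ?thesis by simp
qed

lemma adjoint_wshift:
  assumes b: "bounded_weight b"
  shows "adjoint_op (wshift a k b) = wshift (- a) (- k) (adj_weight k b)"
  unfolding adjoint_op_def
proof (rule the_equality)
  fix T assume T: "\<forall>x y. cinner_ell2 (blinfun_apply (wshift a k b) x) y = cinner_ell2 x (blinfun_apply T y)"
  show "T = wshift (- a) (- k) (adj_weight k b)"
  proof (rule operator_eqI)
    fix x r n
    show "ell2_coord (blinfun_apply T x) (r, n) = ell2_coord (blinfun_apply (wshift (- a) (- k) (adj_weight k b)) x) (r, n)"
      using T[rule_format, of "ket (r, n)" x] cinner_wshift[OF b, of a k "ket (r, n)" x]
      unfolding cinner_ket by (rule trans[OF sym])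
  qed
qed (use cinner_wshift[OF b] in blast)

abbreviation scalar_op :: "complex \<Rightarrow> operator" where
  "scalar_op c \<equiv> wshift 0 0 (\<lambda>_. c)"

lemma scalar_op_apply: "blinfun_apply (scalar_op c) x = scaleC_ell2 c x"
  by (rule ell2_eqI) (auto simp: wshift_apply)

lemma bounded_op_simps [simp]:
  "carrier bounded_op = {T. clinear_op T}" "mult bounded_op = (o\<^sub>L)" "one bounded_op = id_blinfun"
  "zero bounded_op = 0" "add bounded_op = (+)" "star bounded_op = adjoint_op"
  by (simp_all add: bounded_op_def)

lemma bounded_op_smult: "smult (bounded_op :: operator star_algebra) = (\<lambda>c T. scalar_op c o\<^sub>L T)"
  by (simp add: bounded_op_def Blinfun_scaleC)

lemma operator_assoc: "(T :: operator) o\<^sub>L U o\<^sub>L V = T o\<^sub>L (U o\<^sub>L V)"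
  by (rule blinfun_eqI) simp

lemma clinear_compose: "clinear_op S \<Longrightarrow> clinear_op T \<Longrightarrow> clinear_op (S o\<^sub>L T)"
  by (simp add: clinear_op_def)

lemma clinear_add: "clinear_op S \<Longrightarrow> clinear_op T \<Longrightarrow> clinear_op (S + T)"
  unfolding clinear_op_def by (auto simp: plus_blinfun.rep_eq intro!: ell2_eqI simp: algebra_simps)

lemma clinear_zero: "clinear_op 0"
  by (simp add: clinear_op_def) (auto intro!: ell2_eqI)

lemma scalar_op_commute: "clinear_op T \<Longrightarrow> T o\<^sub>L scalar_op c = scalar_op c o\<^sub>L T"
  by (rule blinfun_eqI) (simp add: scalar_op_apply clinear_op_def)

interpretation bounded_op: abelian_monoid "bounded_op :: operator star_algebra"
  by (rule abelian_monoidI) (simp_all add: clinear_add clinear_zero add_ac)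

lemma finsum_bounded_op:
  assumes "finite A" "\<And>i. i \<in> A \<Longrightarrow> clinear_op (f i)"
  shows "(\<Oplus>\<^bsub>bounded_op :: operator star_algebra\<^esub>i\<in>A. f i) = (\<Sum>i\<in>A. f i)"
  using assms
proof (induction A)
  case (insert i A)
  then show ?case by (subst bounded_op.finsum_insert) (auto simp: Pi_iff)
qed simp

lemma ell2_coord_compose [simp]:
  "ell2_coord (blinfun_apply (S o\<^sub>L T) x) i = ell2_coord (blinfun_apply S (blinfun_apply T x)) i"
  by simp

context su2
begin

lemma q_power_le: "q ^ n \<le> 1" "0 \<le> q ^ n"
  using q_pos q_less_1 by (auto intro: power_le_one)

lemma sqrt_weight_bound: "cmod (complex_of_real (sqrt (1 - q ^ n))) \<le> 1"
  using q_power_le[of n] by simp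

lemma weight_bounded [simp]:
  "bounded_weight (\<lambda>n. complex_of_real (sqrt (1 - q ^ f n)))" "bounded_weight (\<lambda>n. complex_of_real (q ^ f n))"
  using sqrt_weight_bound q_power_le
  by (auto intro!: bounded_weightI[of _ 1] simp del: of_real_power simp: norm_of_real abs_of_nonneg)

lemma rep_gen_eqI:
  assumes "bounded_weight b" "0 \<le> k"
  shows "(THE T. clinear_op T \<and> (\<forall>r n. blinfun_apply T (ket (r, n)) = scaleC_ell2 (b (n + nat k)) (ket (r + a, n + nat k))))
    = wshift a k b"
proof (rule the_equality)
  have *: "blinfun_apply (wshift a k b) (ket (r, n)) = scaleC_ell2 (b (n + nat k)) (ket (r + a, n + nat k))" for r n
    using assms by (simp add: wshift_ket nat_add_distrib)
  then show "clinear_op (wshift a k b) \<and>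
    (\<forall>r n. blinfun_apply (wshift a k b) (ket (r, n)) = scaleC_ell2 (b (n + nat k)) (ket (r + a, n + nat k)))"
    using clinear_wshift[OF assms(1)] by blast
  fix T assume T: "clinear_op T \<and> (\<forall>r n. blinfun_apply T (ket (r, n)) = scaleC_ell2 (b (n + nat k)) (ket (r + a, n + nat k)))"
  show "T = wshift a k b"
  proof (rule clinear_op_eqI)
    fix i show "blinfun_apply T (ket i) = blinfun_apply (wshift a k b) (ket i)"
      using T * by (cases i) simp
  qed (use T clinear_wshift[OF assms(1)] in auto)
qed

lemma rep_gen_Alpha: "rep_gen q Alpha = wshift 0 1 (\<lambda>n. complex_of_real (sqrt (1 - q ^ (2 * n))))"
  using rep_gen_eqI[of "\<lambda>n. complex_of_real (sqrt (1 - q ^ (2 * n)))" 1 0]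
  by (simp add: rep_gen_def scaleR_ell2_def)

lemma rep_gen_Beta: "rep_gen q Beta = wshift 1 0 (\<lambda>n. complex_of_real (q ^ n))"
  using rep_gen_eqI[of "\<lambda>n. complex_of_real (q ^ n)" 0 1]
  by (simp add: rep_gen_def scaleR_ell2_def del: of_real_power)

definition letter_op :: "su2_gen \<times> bool \<Rightarrow> operator" where
  "letter_op x = letter_eval bounded_op (rep_gen q) x"

lemma letter_op_eq:
  "letter_op (Alpha, False) = wshift 0 1 (\<lambda>n. complex_of_real (sqrt (1 - q ^ (2 * n))))"
  "letter_op (Alpha, True) = wshift 0 (- 1) (\<lambda>n. complex_of_real (sqrt (1 - q ^ (2 * (n + 1)))))"
  "letter_op (Beta, False) = wshift 1 0 (\<lambda>n. complex_of_real (q ^ n))"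
  "letter_op (Beta, True) = wshift (- 1) 0 (\<lambda>n. complex_of_real (q ^ n))"
proof -
  show "letter_op (Alpha, True) = wshift 0 (- 1) (\<lambda>n. complex_of_real (sqrt (1 - q ^ (2 * (n + 1)))))"
    unfolding letter_op_def by (simp add: rep_gen_Alpha adjoint_wshift)
      (rule wshift_cong, simp add: adj_weight_def nat_add_distrib)
  show "letter_op (Beta, True) = wshift (- 1) 0 (\<lambda>n. complex_of_real (q ^ n))"
    unfolding letter_op_def by (simp add: rep_gen_Beta adjoint_wshift del: of_real_power)
      (rule wshift_cong, simp add: adj_weight_def)
qed (simp_all add: letter_op_def rep_gen_Alpha rep_gen_Beta)

lemma letter_coord:
  "ell2_coord (blinfun_apply (letter_op (Alpha, False)) z) (r, n)
    = (if n = 0 then 0 else complex_of_real (sqrt (1 - q ^ (2 * n))) * ell2_coord z (r, n - 1))"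
  "ell2_coord (blinfun_apply (letter_op (Alpha, True)) z) (r, n)
    = complex_of_real (sqrt (1 - q ^ (2 * (n + 1)))) * ell2_coord z (r, n + 1)"
  "ell2_coord (blinfun_apply (letter_op (Beta, False)) z) (r, n) = complex_of_real (q ^ n) * ell2_coord z (r - 1, n)"
  "ell2_coord (blinfun_apply (letter_op (Beta, True)) z) (r, n) = complex_of_real (q ^ n) * ell2_coord z (r + 1, n)"
proof -
  have e: "nat (int n - 1) = n - 1" "nat (int n + 1) = n + 1" by arith+
  show "ell2_coord (blinfun_apply (letter_op (Alpha, False)) z) (r, n)
    = (if n = 0 then 0 else complex_of_real (sqrt (1 - q ^ (2 * n))) * ell2_coord z (r, n - 1))"
    "ell2_coord (blinfun_apply (letter_op (Alpha, True)) z) (r, n)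
    = complex_of_real (sqrt (1 - q ^ (2 * (n + 1)))) * ell2_coord z (r, n + 1)"
    unfolding letter_op_eq wshift_apply[OF weight_bounded(1)] by (auto simp: e)
qed (simp_all add: letter_op_eq wshift_apply[OF weight_bounded(2)] del: of_real_power)

lemma clinear_letter: "clinear_op (letter_op x)"
proof -
  obtain g s where "x = (g, s)" by fastforce
  then show ?thesis
    by (cases g; cases s) (simp_all only: letter_op_eq clinear_wshift[OF weight_bounded(1)] clinear_wshift[OF weight_bounded(2)])
qed

definition word_op :: "su2_gen word \<Rightarrow> operator" where
  "word_op w = foldr (\<lambda>a T. letter_op a o\<^sub>L T) w id_blinfun"

lemma word_op_simps [simp]:
  "word_op [] = id_blinfun" "word_op (x # w) = letter_op x o\<^sub>L word_op w"
  by (simp_all add: word_op_def)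

lemma word_op_append: "word_op (v @ w) = word_op v o\<^sub>L word_op w"
  by (induction v) (auto intro!: blinfun_eqI)

lemma clinear_word: "clinear_op (word_op w)"
  by (induction w) (simp_all add: clinear_compose clinear_letter, simp add: clinear_op_def)

definition evaluate :: "(su2_gen word \<Rightarrow> complex) \<Rightarrow> operator" where
  "evaluate f = (\<Sum>w | f w \<noteq> 0. scalar_op (f w) o\<^sub>L word_op w)"

lemma free_eval_bounded_op:
  assumes "f \<in> carrier F"
  shows "free_eval bounded_op (rep_gen q) f = evaluate f"
proof -
  have word: "foldr (\<lambda>a y. letter_eval bounded_op (rep_gen q) a \<otimes>\<^bsub>bounded_op\<^esub> y) w \<one>\<^bsub>bounded_op\<^esub> = word_op w" for w
    by (simp add: word_op_def letter_op_def)
  show ?thesis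
    unfolding free_eval_def evaluate_def word bounded_op_smult
    by (rule finsum_bounded_op)
      (use assms in simp, rule clinear_compose[OF clinear_wshift[OF bounded_weight_const] clinear_word])
qed

lemma evaluate_superset:
  assumes "finite A" "{w. f w \<noteq> 0} \<subseteq> A"
  shows "evaluate f = (\<Sum>w\<in>A. scalar_op (f w) o\<^sub>L word_op w)"
  unfolding evaluate_def using assms
  by (intro sum.mono_neutral_left) (auto simp: wshift_zero)

lemma scalar_op_add: "scalar_op (c + d) = scalar_op c + scalar_op d"
  by (subst wshift_add) simp_all

lemma compose_add:
  fixes S :: operator
  shows "(S + T) o\<^sub>L U = (S o\<^sub>L U) + (T o\<^sub>L U)" "U o\<^sub>L (S + T) = (U o\<^sub>L S) + (U o\<^sub>L T)"
  by (auto intro!: blinfun_eqI simp: plus_blinfun.rep_eq blinfun.add_right)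

lemma evaluate_add:
  assumes "f \<in> carrier F" "g \<in> carrier F"
  shows "evaluate (f \<oplus>\<^bsub>F\<^esub> g) = evaluate f + evaluate g"
proof -
  let ?A = "{w. f w \<noteq> 0} \<union> {w. g w \<noteq> 0}"
  have A: "finite ?A" using assms by simp
  have "evaluate (f \<oplus>\<^bsub>F\<^esub> g) = (\<Sum>w\<in>?A. (scalar_op (f w) o\<^sub>L word_op w) + (scalar_op (g w) o\<^sub>L word_op w))"
    by (subst evaluate_superset[OF A]) (auto simp: scalar_op_add compose_add)
  also have "\<dots> = evaluate f + evaluate g"
    by (simp add: sum.distrib evaluate_superset[OF A, of f] evaluate_superset[OF A, of g] del: F_simps)
  finally show ?thesis .
qed

lemma evaluate_zero: "evaluate (\<lambda>_. 0) = 0"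
  by (simp add: evaluate_def)

lemma evaluate_monomial: "evaluate (monomial c w) = scalar_op c o\<^sub>L word_op w"
  by (subst evaluate_superset[of "{w}"]) (auto simp: monomial_def)

lemma scalar_op_mult: "scalar_op (c * d) = scalar_op c o\<^sub>L scalar_op d"
  by (rule operator_eqI) (simp add: wshift_apply)

lemma evaluate_mult:
  assumes f: "f \<in> carrier F" and g: "g \<in> carrier F"
  shows "evaluate (f \<otimes>\<^bsub>F\<^esub> g) = evaluate f o\<^sub>L evaluate g"
  using f
proof (induction rule: F_induct)
  case zero
  have "(\<lambda>_. 0) \<otimes>\<^bsub>F\<^esub> g = (\<lambda>_. 0)" by simp
  then show ?case by (simp only: evaluate_zero) simp
next
  case (add c u f)
  have mono: "evaluate (monomial c u \<otimes>\<^bsub>F\<^esub> g) = evaluate (monomial c u) o\<^sub>L evaluate g"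
    using g
  proof (induction rule: F_induct)
    case zero
    have "monomial c u \<otimes>\<^bsub>F\<^esub> (\<lambda>_. 0) = (\<lambda>_. 0)" by simp
    then show ?case by (simp only: evaluate_zero) simp
  next
    case (add d v g)
    have mm: "evaluate (monomial c u \<otimes>\<^bsub>F\<^esub> monomial d v) = evaluate (monomial c u) o\<^sub>L evaluate (monomial d v)"
      unfolding monomial_mult evaluate_monomial word_op_append
    proof (intro blinfun_eqI ell2_eqI)
      fix x i
      have "blinfun_apply (word_op u) (scaleC_ell2 d (blinfun_apply (word_op v) x))
          = scaleC_ell2 d (blinfun_apply (word_op u) (blinfun_apply (word_op v) x))"
        using clinear_word[of u] by (simp add: clinear_op_def)
      then show "ell2_coord (blinfun_apply (scalar_op (c * d) o\<^sub>L (word_op u o\<^sub>L word_op v)) x) i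
        = ell2_coord (blinfun_apply (scalar_op c o\<^sub>L word_op u o\<^sub>L (scalar_op d o\<^sub>L word_op v)) x) i"
        by (simp add: scalar_op_apply mult.assoc)
    qed
    show ?case
      by (simp only: F.r_distr[OF monomial_closed add(1) monomial_closed] mm
        evaluate_add[OF F_mult_closed[OF monomial_closed monomial_closed] F_mult_closed[OF monomial_closed add(1)]]
        evaluate_add[OF monomial_closed add(1)] add(2) compose_add)
  qed
  show ?case
    by (simp only: F.l_distr[OF monomial_closed add(1) g] evaluate_add[OF F_mult_closed[OF monomial_closed g] F_mult_closed[OF add(1) g]]
      evaluate_add[OF monomial_closed add(1)] add(2) mono compose_add)
qed

lemma evaluate_uminus:
  assumes "f \<in> carrier F"
  shows "evaluate (\<lambda>w. - f w) = - evaluate f"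
proof -
  have "evaluate (\<lambda>w. - f w) = evaluate (monomial (-1) [] \<otimes>\<^bsub>F\<^esub> f)"
    unfolding monomial_empty_mult by simp
  also have "\<dots> = - evaluate f"
    unfolding evaluate_mult[OF monomial_closed assms] evaluate_monomial
    by (auto intro!: blinfun_eqI ell2_eqI simp: scalar_op_apply uminus_blinfun.rep_eq)
  finally show ?thesis .
qed

lemma evaluate_diff:
  assumes "f \<in> carrier F" "g \<in> carrier F"
  shows "evaluate (\<lambda>w. f w - g w) = evaluate f - evaluate g"
proof -
  have closed: "(\<lambda>w. - g w) \<in> carrier F" using assms by simp
  have "evaluate (\<lambda>w. f w - g w) = evaluate (f \<oplus>\<^bsub>F\<^esub> (\<lambda>w. - g w))"
    by (rule arg_cong[of _ _ evaluate]) simp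
  also have "\<dots> = evaluate f + evaluate (\<lambda>w. - g w)" by (rule evaluate_add[OF assms(1) closed])
  finally show ?thesis by (simp only: evaluate_uminus[OF assms(2)] diff_conv_add_uminus)
qed

text \<open>The relations are compared coordinatewise: each side of a relation is a weighted shift. As the ideal is generated by the
  relations and their adjoints, the adjoint relations are needed too; the last three are self-adjoint.\<close>

lemma evaluate_relations:
  assumes "f \<in> SU2_relations q \<union> star F ` SU2_relations q"
  shows "evaluate f = 0"
proof -
  let ?a = "(Alpha, False)" and ?b = "(Beta, False)" and ?a' = "(Alpha, True)" and ?b' = "(Beta, True)"
  let ?c = "complex_of_real q"
  have e2: "evaluate (\<lambda>w. monomial c u w - monomial d v w) = (scalar_op c o\<^sub>L word_op u) - (scalar_op d o\<^sub>L word_op v)" for c d u v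
    by (simp only: evaluate_diff[OF monomial_closed monomial_closed] evaluate_monomial)
  have id_id: "id_blinfun o\<^sub>L id_blinfun = (id_blinfun :: operator)" by (rule blinfun_eqI) simp
  have e3: "evaluate (\<lambda>w. (monomial c u w + monomial d v w) - monomial 1 [] w)
      = ((scalar_op c o\<^sub>L word_op u) + (scalar_op d o\<^sub>L word_op v)) - id_blinfun" for c d u v
  proof -
    have "(\<lambda>w. monomial c u w + monomial d v w) = monomial c u \<oplus>\<^bsub>F\<^esub> monomial d v" by simp
    then show ?thesis
      using evaluate_diff[OF F_add_closed[OF monomial_closed monomial_closed] monomial_closed, of c u d v 1 "[]"]
        evaluate_add[OF monomial_closed monomial_closed, of c u d v]
      by (simp add: evaluate_monomial wshift_one id_id)
  qed
  have sq: "complex_of_real (sqrt (1 - q ^ n)) * (complex_of_real (sqrt (1 - q ^ n)) * y) = (1 - complex_of_real (q ^ n)) * y" for n y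
  proof -
    have "complex_of_real (sqrt (1 - q ^ n)) * complex_of_real (sqrt (1 - q ^ n)) = complex_of_real (1 - q ^ n)"
      using q_power_le[of n] by (simp flip: of_real_mult)
    then show ?thesis by (simp add: mult.assoc[symmetric])
  qed
  have qq: "complex_of_real (q ^ n) * (complex_of_real (q ^ n) * y) = complex_of_real (q ^ (2 * n)) * y" for n y
    by (simp add: mult_2 power_add)
  note coord = scalar_op_apply letter_coord minus_blinfun.rep_eq plus_blinfun.rep_eq
  have c2: "(complex_of_real q)\<^sup>2 = complex_of_real (q\<^sup>2)" by simp
  have z1: "(scalar_op 1 o\<^sub>L word_op [?b, ?a]) - (scalar_op ?c o\<^sub>L word_op [?a, ?b]) = 0"
      "(scalar_op 1 o\<^sub>L word_op [?a', ?b']) - (scalar_op ?c o\<^sub>L word_op [?b', ?a']) = 0"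
      "(scalar_op 1 o\<^sub>L word_op [?b', ?a]) - (scalar_op ?c o\<^sub>L word_op [?a, ?b']) = 0"
      "(scalar_op 1 o\<^sub>L word_op [?a', ?b]) - (scalar_op ?c o\<^sub>L word_op [?b, ?a']) = 0"
      "(scalar_op 1 o\<^sub>L word_op [?b, ?b']) - (scalar_op 1 o\<^sub>L word_op [?b', ?b]) = 0"
  proof -
    show "(scalar_op 1 o\<^sub>L word_op [?b, ?a]) - (scalar_op ?c o\<^sub>L word_op [?a, ?b]) = 0"
      "(scalar_op 1 o\<^sub>L word_op [?b', ?a]) - (scalar_op ?c o\<^sub>L word_op [?a, ?b']) = 0"
      by (rule operator_eqI, rename_tac x r n, case_tac n, simp_all add: coord)+
    show "(scalar_op 1 o\<^sub>L word_op [?a', ?b']) - (scalar_op ?c o\<^sub>L word_op [?b', ?a']) = 0"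
      "(scalar_op 1 o\<^sub>L word_op [?a', ?b]) - (scalar_op ?c o\<^sub>L word_op [?b, ?a']) = 0"
      "(scalar_op 1 o\<^sub>L word_op [?b, ?b']) - (scalar_op 1 o\<^sub>L word_op [?b', ?b]) = 0"
      by (rule operator_eqI, simp add: coord)+
  qed
  have z2: "((scalar_op 1 o\<^sub>L word_op [?a, ?a']) + (scalar_op 1 o\<^sub>L word_op [?b, ?b'])) - id_blinfun = 0"
  proof (rule operator_eqI)
    fix x r n
    have "complex_of_real (sqrt (1 - q ^ (2 * n))) * (complex_of_real (sqrt (1 - q ^ (2 * n))) * y)
        + complex_of_real (q ^ n) * (complex_of_real (q ^ n) * y) - y = 0" for y :: complex
      unfolding sq qq by (simp add: algebra_simps)
    then show "ell2_coord (blinfun_apply (((scalar_op 1 o\<^sub>L word_op [?a, ?a']) + (scalar_op 1 o\<^sub>L word_op [?b, ?b'])) - id_blinfun) x) (r, n)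
        = ell2_coord (blinfun_apply 0 x) (r, n)"
      by (cases n) (simp_all add: coord del: of_real_power)
  qed
  have z3: "((scalar_op 1 o\<^sub>L word_op [?a', ?a]) + (scalar_op (?c\<^sup>2) o\<^sub>L word_op [?b', ?b])) - id_blinfun = 0"
  proof (rule operator_eqI)
    fix x r n
    have "complex_of_real (sqrt (1 - q ^ (2 * (n + 1)))) * (complex_of_real (sqrt (1 - q ^ (2 * (n + 1)))) * y)
        + complex_of_real (q\<^sup>2) * (complex_of_real (q ^ n) * (complex_of_real (q ^ n) * y)) - y = 0" for y :: complex
      unfolding sq qq by (simp add: algebra_simps power2_eq_square)
    then show "ell2_coord (blinfun_apply (((scalar_op 1 o\<^sub>L word_op [?a', ?a]) + (scalar_op (?c\<^sup>2) o\<^sub>L word_op [?b', ?b])) - id_blinfun) x) (r, n)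
        = ell2_coord (blinfun_apply 0 x) (r, n)"
      unfolding c2 by (simp add: coord del: of_real_power)
  qed
  have ws: "word_star [x, y] = [(fst y, \<not> snd y), (fst x, \<not> snd x)]" "word_star [] = []" for x y :: "su2_gen \<times> bool"
    by (simp_all add: word_star_def case_prod_unfold)
  have sm: "cnj (monomial c u (word_star w)) = monomial (cnj c) (word_star u) w" for c and u w :: "su2_gen word"
    using fun_cong[OF F_star_monomial[of c u], of w] by simp
  have st: "star F (\<lambda>w. monomial c u w - monomial d v w) = (\<lambda>w. monomial (cnj c) (word_star u) w - monomial (cnj d) (word_star v) w)"
    "star F (\<lambda>w. (monomial c u w + monomial d v w) - monomial 1 [] w)
      = (\<lambda>w. (monomial (cnj c) (word_star u) w + monomial (cnj d) (word_star v) w) - monomial 1 [] w)"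
    for c d and u v :: "su2_gen word"
    by (simp_all add: sm ws)
  show ?thesis
    using assms unfolding SU2_relations_eq Let_def image_insert image_empty st ws
    by (elim UnE insertE emptyE; hypsubst; simp only: e2 e3 z1 z2 z3 fst_conv snd_conv not_False_eq_True not_True_eq_False
        complex_cnj_one complex_cnj_complex_of_real complex_cnj_power)
qed

lemma evaluate_I: "f \<in> I \<Longrightarrow> evaluate f = 0"
proof -
  let ?N = "{f \<in> carrier F. evaluate f = 0}"
  have "ideal ?N F"
  proof (rule F_idealI)
    fix f g assume "f \<in> ?N" "g \<in> ?N"
    then show "f \<oplus>\<^bsub>F\<^esub> g \<in> ?N"
      using F_add_closed[of f g] evaluate_add[of f g] by (simp del: F_simps)
  next
    fix c and w :: "su2_gen word" and f assume f: "f \<in> ?N"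
    then have fF: "f \<in> carrier F" by simp
    show "monomial c w \<otimes>\<^bsub>F\<^esub> f \<in> ?N" "f \<otimes>\<^bsub>F\<^esub> monomial c w \<in> ?N"
      using f F_mult_closed[OF monomial_closed fF] F_mult_closed[OF fF monomial_closed]
        evaluate_mult[OF monomial_closed fF] evaluate_mult[OF fF monomial_closed] by (simp_all del: F_simps)
  qed (auto simp: evaluate_zero)
  moreover have "SU2_relations q \<subseteq> ?N" "star F ` SU2_relations q \<subseteq> ?N"
    using gens_closed evaluate_relations by blast+
  ultimately show "f \<in> I \<Longrightarrow> evaluate f = 0" using I_minimal by blast
qed

lemma rep_cs:
  assumes f: "f \<in> carrier F"
  shows "rep q (cs f) = evaluate f"
proof -
  have "induced_hom bounded_op (rep_gen q) (cs f) = free_eval bounded_op (rep_gen q) f"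
  proof (rule induced_hom_cs[OF f])
    fix g assume g: "g \<in> carrier F" "(\<lambda>w. g w - f w) \<in> I"
    then have "evaluate g - evaluate f = 0" using evaluate_I[OF g(2)] evaluate_diff[OF g(1) f] by metis
    then show "free_eval bounded_op (rep_gen q) g = free_eval bounded_op (rep_gen q) f"
      by (simp add: free_eval_bounded_op[OF g(1)] free_eval_bounded_op[OF f])
  qed
  then show ?thesis by (simp add: rep_def free_eval_bounded_op[OF f])
qed

definition degree_ops :: "int \<Rightarrow> operator set" where
  "degree_ops i = rep q ` SU2_degree q l i"

lemma degree_ops_eq: "degree_ops i = {evaluate f |f. f \<in> carrier F \<and> (\<forall>w. f w \<noteq> 0 \<longrightarrow> word_degree l w = i)}"
proof -
  let ?S = "{f \<in> carrier F. \<forall>w. f w \<noteq> 0 \<longrightarrow> word_degree l w = i}"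
  have "degree_ops i = (\<lambda>f. rep q (cs f)) ` ?S"
    unfolding degree_ops_def SU2_degree_eq by blast
  also have "\<dots> = evaluate ` ?S"
    by (rule image_cong[OF refl], rule rep_cs) (unfold mem_Collect_eq, elim conjE)
  finally show ?thesis by blast
qed

section \<open>Words of a fixed degree\<close>

lemma degree_ops_word: "word_degree l w = i \<Longrightarrow> word_op w \<in> degree_ops i"
  unfolding degree_ops_eq
proof (intro CollectI exI conjI)
  show "word_op w = evaluate (monomial 1 w)" by (simp add: evaluate_monomial wshift_one, rule blinfun_eqI, simp)
qed (auto simp: monomial_def)

lemma degree_ops_scalar: "T \<in> degree_ops i \<Longrightarrow> scalar_op c o\<^sub>L T \<in> degree_ops i"
  unfolding degree_ops_eq
proof clarify
  fix f assume f: "f \<in> carrier F" "\<forall>w. f w \<noteq> 0 \<longrightarrow> word_degree l w = i"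
  have "scalar_op c o\<^sub>L evaluate f = evaluate (monomial c []) o\<^sub>L evaluate f"
    unfolding evaluate_monomial by (rule blinfun_eqI) simp
  also have "\<dots> = evaluate (c \<odot>\<^bsub>F\<^esub> f)"
    unfolding evaluate_mult[OF monomial_closed f(1), symmetric] monomial_empty_mult ..
  finally show "\<exists>g. scalar_op c o\<^sub>L evaluate f = evaluate g \<and> g \<in> carrier F \<and> (\<forall>w. g w \<noteq> 0 \<longrightarrow> word_degree l w = i)"
    using F_smult_closed[OF f(1), of c] f(2) by (intro exI[of _ "c \<odot>\<^bsub>F\<^esub> f"]) (auto simp del: F_simps(1))
qed

lemma degree_ops_add: "U \<in> degree_ops i \<Longrightarrow> T \<in> degree_ops i \<Longrightarrow> U + T \<in> degree_ops i"
  unfolding degree_ops_eq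
proof clarify
  fix f g assume f: "f \<in> carrier F" "\<forall>w. f w \<noteq> 0 \<longrightarrow> word_degree l w = i"
    and g: "g \<in> carrier F" "\<forall>w. g w \<noteq> 0 \<longrightarrow> word_degree l w = i"
  have "word_degree l w = i" if "(f \<oplus>\<^bsub>F\<^esub> g) w \<noteq> 0" for w
    using f(2)[rule_format, of w] g(2)[rule_format, of w] that by (cases "f w = 0") auto
  then show "\<exists>h. evaluate f + evaluate g = evaluate h \<and> h \<in> carrier F \<and> (\<forall>w. h w \<noteq> 0 \<longrightarrow> word_degree l w = i)"
    using evaluate_add[OF f(1) g(1)] F_add_closed[OF f(1) g(1)] by (intro exI[of _ "f \<oplus>\<^bsub>F\<^esub> g"]) (simp del: F_simps)
qed

lemma degree_ops_mult: "U \<in> degree_ops i \<Longrightarrow> T \<in> degree_ops j \<Longrightarrow> U o\<^sub>L T \<in> degree_ops (i + j)"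
  unfolding degree_ops_eq
proof clarify
  fix f g assume f: "f \<in> carrier F" "\<forall>w. f w \<noteq> 0 \<longrightarrow> word_degree l w = i"
    and g: "g \<in> carrier F" "\<forall>w. g w \<noteq> 0 \<longrightarrow> word_degree l w = j"
  have "word_degree l w = i + j" if "(f \<otimes>\<^bsub>F\<^esub> g) w \<noteq> 0" for w
  proof -
    have "(\<Sum>k\<le>length w. f (take k w) * g (drop k w)) \<noteq> 0" using that by simp
    then obtain k where "f (take k w) * g (drop k w) \<noteq> 0"
      by (meson sum.not_neutral_contains_not_neutral)
    then have "word_degree l (take k w) = i" "word_degree l (drop k w) = j"
      using f(2) g(2) by auto
    then have "word_degree l (take k w @ drop k w) = i + j" by (simp only: word_degree_simps)
    then show ?thesis by simp
  qed
  then show "\<exists>h. (evaluate f o\<^sub>L evaluate g) = evaluate h \<and> h \<in> carrier F \<and> (\<forall>w. h w \<noteq> 0 \<longrightarrow> word_degree l w = i + j)"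
    using evaluate_mult[OF f(1) g(1)] F_mult_closed[OF f(1) g(1)] by (intro exI[of _ "f \<otimes>\<^bsub>F\<^esub> g"]) (simp del: F_simps)
qed

lemma degree_ops_induct [consumes 1, case_names zero word add]:
  assumes "T \<in> degree_ops i" "P 0" "\<And>c w. word_degree l w = i \<Longrightarrow> P (scalar_op c o\<^sub>L word_op w)"
    and "\<And>U T. P U \<Longrightarrow> P T \<Longrightarrow> P (U + T)"
  shows "P T"
proof -
  obtain f where f: "f \<in> carrier F" "\<forall>w. f w \<noteq> 0 \<longrightarrow> word_degree l w = i" "T = evaluate f"
    using assms(1) unfolding degree_ops_eq by blast
  have "P (\<Sum>w\<in>B. scalar_op (f w) o\<^sub>L word_op w)" if "finite B" "\<And>w. w \<in> B \<Longrightarrow> word_degree l w = i" for B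
    using that by (induction B) (auto intro: assms(2-4))
  from this[of "{w. f w \<noteq> 0}"] show ?thesis
    using f by (simp add: evaluate_def)
qed

lemma degree_ops_zero: "0 \<in> degree_ops i"
  unfolding degree_ops_eq using evaluate_zero by (intro CollectI exI[of _ "\<lambda>_. 0"]) simp

text \<open>A word acts as a weighted shift whose weights converge; the limit is non-zero only for words in
  \<open>\<alpha>\<close> and \<open>\<alpha>\<^sup>*\<close>, and among these the words of degree \<open>0\<close> act diagonally.\<close>

lemma shift_limit:
  fixes b :: "nat \<Rightarrow> 'a :: topological_space"
  assumes "b \<longlonglongrightarrow> x"
  shows "(\<lambda>n. b (nat (int n - k))) \<longlonglongrightarrow> x"
proof (rule filterlim_compose[OF assms])
  show "filterlim (\<lambda>n. nat (int n - k)) sequentially sequentially"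
    unfolding filterlim_at_top
  proof
    fix Z :: nat
    show "\<forall>\<^sub>F n in sequentially. Z \<le> nat (int n - k)"
      by (rule eventually_sequentiallyI[of "Z + nat \<bar>k\<bar>"]) auto
  qed
qed

lemma shift_mult_limit:
  assumes "b \<longlonglongrightarrow> x" "c \<longlonglongrightarrow> y"
  shows "shift_mult k k' b c \<longlonglongrightarrow> x * y"
proof (rule Lim_transform_eventually)
  show "(\<lambda>n. b n * c (nat (int n - k))) \<longlonglongrightarrow> x * y"
    by (intro tendsto_mult assms(1) shift_limit[OF assms(2)])
  show "\<forall>\<^sub>F n in sequentially. b n * c (nat (int n - k)) = shift_mult k k' b c n"
    by (rule eventually_sequentiallyI[of "nat \<bar>k\<bar> + nat \<bar>k'\<bar>"]) (auto simp: shift_mult_def)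
qed

lemma sqrt_weight_limit: "(\<lambda>n. complex_of_real (sqrt (1 - q ^ (2 * n)))) \<longlonglongrightarrow> 1"
proof -
  have "(\<lambda>n. (q\<^sup>2) ^ n) \<longlonglongrightarrow> 0"
    using q_pos q_less_1 by (intro LIMSEQ_power_zero) (simp add: power_less_one_iff abs_square_less_1)
  then have "(\<lambda>n. complex_of_real (sqrt (1 - (q\<^sup>2) ^ n))) \<longlonglongrightarrow> complex_of_real (sqrt (1 - 0))"
    by (intro tendsto_of_real tendsto_real_sqrt tendsto_diff tendsto_const)
  then show ?thesis by (simp add: power_mult)
qed

lemma q_power_limit: "(\<lambda>n. complex_of_real (q ^ n)) \<longlonglongrightarrow> 0"
  using q_pos q_less_1 tendsto_of_real[OF LIMSEQ_power_zero[of q], where 'a = complex] by simp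

lemma word_op_form:
  obtains a k b x where "word_op w = wshift a k b" "bounded_weight b" "b \<longlonglongrightarrow> x"
    "int l * a - k = word_degree l w" "x = 0 \<or> a = 0"
proof -
  have letter: "\<exists>a k b x. letter_op y = wshift a k b \<and> bounded_weight b \<and> b \<longlonglongrightarrow> x \<and>
      int l * a - k = letter_degree l y \<and> (x = 0 \<or> a = 0)" for y
  proof -
    obtain g s where y: "y = (g, s)" by fastforce
    have sq: "(\<lambda>n. complex_of_real (sqrt (1 - q ^ (2 * (n + 1))))) \<longlonglongrightarrow> 1"
      using LIMSEQ_ignore_initial_segment[OF sqrt_weight_limit, of 1] .
    show ?thesis
    proof (cases g)
      case Alpha
      show ?thesis
      proof (cases s)
        case True
        show ?thesis
          unfolding y Alpha using True
          by (intro exI[of _ 0] exI[of _ "-1"] exI[of _ "\<lambda>n. complex_of_real (sqrt (1 - q ^ (2 * (n + 1))))"] exI[of _ 1])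
            (simp only: letter_op_eq sq weight_bounded, simp)
      next
        case False
        show ?thesis
          unfolding y Alpha using False
          by (intro exI[of _ 0] exI[of _ "1"] exI[of _ "\<lambda>n. complex_of_real (sqrt (1 - q ^ (2 * n)))"] exI[of _ 1])
            (simp only: letter_op_eq sqrt_weight_limit weight_bounded, simp)
      qed
    next
      case Beta
      show ?thesis
        unfolding y Beta
        by (intro exI[of _ "if s then -1 else 1"] exI[of _ 0] exI[of _ "\<lambda>n. complex_of_real (q ^ n)"] exI[of _ 0])
          (cases s; simp only: letter_op_eq q_power_limit weight_bounded if_True if_False; simp)
    qed
  qed
  have "\<exists>a k b x. word_op w = wshift a k b \<and> bounded_weight b \<and> b \<longlonglongrightarrow> x \<and>
      int l * a - k = word_degree l w \<and> (x = 0 \<or> a = 0)"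
  proof (induction w)
    case Nil
    show ?case
      by (intro exI[of _ 0] exI[of _ 0] exI[of _ "\<lambda>_. 1"] exI[of _ 1]) (simp add: wshift_one)
  next
    case (Cons y w)
    obtain a k b x where 1: "letter_op y = wshift a k b" "bounded_weight b" "b \<longlonglongrightarrow> x"
      "int l * a - k = letter_degree l y" "x = 0 \<or> a = 0" using letter[of y] by blast
    obtain a' k' b' x' where 2: "word_op w = wshift a' k' b'" "bounded_weight b'" "b' \<longlonglongrightarrow> x'"
      "int l * a' - k' = word_degree l w" "x' = 0 \<or> a' = 0" using Cons by blast
    have "word_op (y # w) = wshift (a + a') (k + k') (shift_mult k k' b b')"
      by (simp add: 1(1) 2(1) wshift_compose[OF 1(2) 2(2)])
    moreover have "int l * (a + a') - (k + k') = word_degree l (y # w)"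
      using 1(4) 2(4) by (simp add: algebra_simps)
    moreover have "x * x' = 0 \<or> a + a' = 0" using 1(5) 2(5) by auto
    ultimately show ?case
      using bounded_weight_shift_mult[OF 1(2) 2(2)] shift_mult_limit[OF 1(3) 2(3)] by blast
  qed
  then show thesis using that by blast
qed

section \<open>Norm closures of the homogeneous components\<close>

definition degree_closure :: "int \<Rightarrow> operator set" where "degree_closure i = closure (degree_ops i)"

lemma degree_ops_closure: "T \<in> degree_ops i \<Longrightarrow> T \<in> degree_closure i"
  unfolding degree_closure_def by (rule subsetD[OF closure_subset])

lemma closed_degree_closure: "closed (degree_closure i)" by (simp add: degree_closure_def)

lemma degree_closure_limit: "(\<And>n. X n \<in> degree_closure i) \<Longrightarrow> X \<longlonglongrightarrow> T \<Longrightarrow> T \<in> degree_closure i"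
  using closed_degree_closure[of i] closed_sequentially by blast

lemma degree_closure_sequence:
  assumes "T \<in> degree_closure i"
  obtains X where "\<And>n. X n \<in> degree_ops i" "X \<longlonglongrightarrow> T"
  using assms unfolding degree_closure_def closure_sequential by blast

lemma compose_tendsto:
  fixes X Y :: "nat \<Rightarrow> operator"
  shows "X \<longlonglongrightarrow> U \<Longrightarrow> Y \<longlonglongrightarrow> T \<Longrightarrow> (\<lambda>n. X n o\<^sub>L Y n) \<longlonglongrightarrow> (U o\<^sub>L T)"
  by (rule bounded_bilinear.tendsto[OF bounded_bilinear_blinfun_compose])

lemma degree_closure_mult: assumes "U \<in> degree_closure i" "T \<in> degree_closure j" shows "U o\<^sub>L T \<in> degree_closure (i + j)"
proof -
  obtain X where X: "\<And>n. X n \<in> degree_ops i" "X \<longlonglongrightarrow> U" using assms(1) by (rule degree_closure_sequence) (rule that)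
  obtain Y where Y: "\<And>n. Y n \<in> degree_ops j" "Y \<longlonglongrightarrow> T" using assms(2) by (rule degree_closure_sequence) (rule that)
  show ?thesis
    by (rule degree_closure_limit[OF _ compose_tendsto[OF X(2) Y(2)]]) (intro degree_ops_closure degree_ops_mult X(1) Y(1))
qed

lemma degree_closure_add: assumes "U \<in> degree_closure i" "T \<in> degree_closure i" shows "U + T \<in> degree_closure i"
proof -
  obtain X where X: "\<And>n. X n \<in> degree_ops i" "X \<longlonglongrightarrow> U" using assms(1) by (rule degree_closure_sequence) (rule that)
  obtain Y where Y: "\<And>n. Y n \<in> degree_ops i" "Y \<longlonglongrightarrow> T" using assms(2) by (rule degree_closure_sequence) (rule that)
  show ?thesis
    by (rule degree_closure_limit[OF _ tendsto_add[OF X(2) Y(2)]]) (intro degree_ops_closure degree_ops_add X(1) Y(1))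
qed

lemma degree_closure_zero: "0 \<in> degree_closure i" by (rule degree_ops_closure[OF degree_ops_zero])

lemma degree_closure_scalar_op: "scalar_op c \<in> degree_closure 0"
proof -
  have "word_op [] \<in> degree_ops 0" by (rule degree_ops_word) simp
  then have "scalar_op c o\<^sub>L id_blinfun \<in> degree_ops 0" using degree_ops_scalar by simp
  moreover have "scalar_op c o\<^sub>L id_blinfun = scalar_op c" by (rule blinfun_eqI) simp
  ultimately show ?thesis using degree_ops_closure by simp
qed

lemma degree_closure_one: "id_blinfun \<in> degree_closure 0" using degree_closure_scalar_op[of 1] by (simp add: wshift_one)

lemma degree_closure_scalar: "T \<in> degree_closure i \<Longrightarrow> scalar_op c o\<^sub>L T \<in> degree_closure i"
  using degree_closure_mult[OF degree_closure_scalar_op[of c], of T i] by simp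

lemma scalar_op_minus_one: "scalar_op (-1) o\<^sub>L T = - T"
  by (rule blinfun_eqI, rule ell2_eqI) (simp add: scalar_op_apply uminus_blinfun.rep_eq)

lemma degree_closure_minus: "T \<in> degree_closure i \<Longrightarrow> - T \<in> degree_closure i"
  using degree_closure_scalar[of T i "-1"] by (simp add: scalar_op_minus_one)

lemma degree_closure_diff: "U \<in> degree_closure i \<Longrightarrow> T \<in> degree_closure i \<Longrightarrow> U - T \<in> degree_closure i"
  using degree_closure_add[of U i "- T"] degree_closure_minus by simp

lemma degree_closure_sum: "(\<And>x. x \<in> X \<Longrightarrow> f x \<in> degree_closure i) \<Longrightarrow> (\<Sum>x\<in>X. f x) \<in> degree_closure i"
  by (induction X rule: infinite_finite_induct) (auto intro: degree_closure_zero degree_closure_add)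

text \<open>Neumann: the fixed point of the contraction \<open>Y \<mapsto> 1 + T Y\<close> is a right inverse of \<open>1 - T\<close>,
  that of \<open>Y \<mapsto> 1 + Y T\<close> a left inverse.\<close>

lemma Neumann:
  assumes T: "T \<in> degree_closure 0" "norm T < 1"
  shows "\<exists>Y\<in>degree_closure 0. (id_blinfun - T) o\<^sub>L Y = id_blinfun" "\<exists>Y\<in>degree_closure 0. Y o\<^sub>L (id_blinfun - T) = id_blinfun"
proof -
  have complete: "complete (degree_closure 0)" by (simp add: complete_eq_closed closed_degree_closure)
  have ne: "degree_closure 0 \<noteq> {}" using degree_closure_zero by auto
  have "\<exists>!Y\<in>degree_closure 0. id_blinfun + (T o\<^sub>L Y) = Y"
  proof (rule Banach_fix[OF complete ne norm_ge_zero T(2)])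
    show "(\<lambda>Y. id_blinfun + (T o\<^sub>L Y)) ` degree_closure 0 \<subseteq> degree_closure 0"
      using degree_closure_mult[OF T(1), of _ 0] degree_closure_add[OF degree_closure_one] by auto
    show "dist (id_blinfun + (T o\<^sub>L x)) (id_blinfun + (T o\<^sub>L y)) \<le> norm T * dist x y" for x y
    proof -
      have "(T o\<^sub>L x) - (T o\<^sub>L y) = T o\<^sub>L (x - y)"
        by (rule blinfun_eqI) (simp add: minus_blinfun.rep_eq blinfun.diff_right)
      then show "dist (id_blinfun + (T o\<^sub>L x)) (id_blinfun + (T o\<^sub>L y)) \<le> norm T * dist x y"
        using norm_blinfun_compose[of T "x - y"] by (simp add: dist_norm)
    qed
  qed
  then obtain Y where Y: "Y \<in> degree_closure 0" "id_blinfun + (T o\<^sub>L Y) = Y" by blast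
  have "(id_blinfun - T) o\<^sub>L Y = Y - (T o\<^sub>L Y)"
    by (rule blinfun_eqI) (simp add: minus_blinfun.rep_eq)
  also have "\<dots> = id_blinfun" using Y(2) by (metis add_diff_cancel_right')
  finally show "\<exists>Y\<in>degree_closure 0. (id_blinfun - T) o\<^sub>L Y = id_blinfun" using Y(1) by blast
  have "\<exists>!Y\<in>degree_closure 0. id_blinfun + (Y o\<^sub>L T) = Y"
  proof (rule Banach_fix[OF complete ne norm_ge_zero T(2)])
    show "(\<lambda>Y. id_blinfun + (Y o\<^sub>L T)) ` degree_closure 0 \<subseteq> degree_closure 0"
      using degree_closure_mult[OF _ T(1), of _ 0] degree_closure_add[OF degree_closure_one] by auto
    show "dist (id_blinfun + (x o\<^sub>L T)) (id_blinfun + (y o\<^sub>L T)) \<le> norm T * dist x y" for x y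
    proof -
      have "(x o\<^sub>L T) - (y o\<^sub>L T) = (x - y) o\<^sub>L T"
        by (rule blinfun_eqI) (simp add: minus_blinfun.rep_eq)
      then show "dist (id_blinfun + (x o\<^sub>L T)) (id_blinfun + (y o\<^sub>L T)) \<le> norm T * dist x y"
        using norm_blinfun_compose[of "x - y" T] by (simp add: dist_norm mult.commute)
    qed
  qed
  then obtain Y where Y: "Y \<in> degree_closure 0" "id_blinfun + (Y o\<^sub>L T) = Y" by blast
  have "Y o\<^sub>L (id_blinfun - T) = Y - (Y o\<^sub>L T)"
    by (rule blinfun_eqI) (simp add: minus_blinfun.rep_eq blinfun.diff_right)
  also have "\<dots> = id_blinfun" using Y(2) by (metis add_diff_cancel_right')
  finally show "\<exists>Y\<in>degree_closure 0. Y o\<^sub>L (id_blinfun - T) = id_blinfun" using Y(1) by blast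
qed

end

section \<open>Shifts and matrix units in the closures\<close>

lemma wshift_eqI:
  assumes "a = a'" "k = k'" "\<And>n. k \<le> int n \<Longrightarrow> b n = b' n"
  shows "wshift a k b = wshift a' k' b'"
  using wshift_cong[of k b b' a, OF assms(3)] assms(1,2) by simp

lemma scalar_wshift:
  assumes "bounded_weight b"
  shows "scalar_op c o\<^sub>L wshift a k b = wshift a k (\<lambda>n. c * b n)"
  unfolding wshift_compose[OF bounded_weight_const assms]
  by (rule wshift_eqI) (auto simp: shift_mult_def)

text \<open>For every \<open>r\<close>, \<open>matrix_unit a m m'\<close> maps \<open>e\<^sub>r \<otimes> e\<^bsub>m'\<^esub>\<close> to \<open>e\<^bsub>r + a\<^esub> \<otimes> e\<^sub>m\<close>; it has degree \<open>l a - (m - m')\<close>.\<close>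

definition unit_weight :: "nat \<Rightarrow> nat \<Rightarrow> complex" where
  "unit_weight m n = (if n = m then 1 else 0)"

definition matrix_unit :: "int \<Rightarrow> nat \<Rightarrow> nat \<Rightarrow> operator" where
  "matrix_unit a m m' = wshift a (int m - int m') (unit_weight m)"

lemma bounded_unit_weight [simp]: "bounded_weight (unit_weight m)"
  unfolding unit_weight_def[abs_def] by (intro bounded_weight_if bounded_weight_const)

lemma matrix_unit_mult: "matrix_unit a m n o\<^sub>L matrix_unit a' n n' = matrix_unit (a + a') m n'"
  unfolding matrix_unit_def wshift_compose[OF bounded_unit_weight bounded_unit_weight]
  by (rule wshift_eqI) (auto simp: shift_mult_def unit_weight_def)

definition level :: "nat \<Rightarrow> operator" where "level n = wshift 0 0 (unit_weight n)"

definition above :: "nat \<Rightarrow> operator" where "above j = wshift 0 0 (\<lambda>n. if j \<le> n then 1 else 0)"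

definition below :: "nat \<Rightarrow> operator" where "below j = wshift 0 0 (\<lambda>n. if j \<le> n then 0 else 1)"

lemma level_matrix_unit: "matrix_unit 0 n n = level n"
  by (simp add: matrix_unit_def level_def)

lemma bounded_indicator [simp]:
  "bounded_weight (\<lambda>n. if j \<le> n then 1 else 0)" "bounded_weight (\<lambda>n. if j \<le> n then 0 else 1)"
  by (intro bounded_weight_if bounded_weight_const)+

lemma above_below: "above j + below j = id_blinfun"
  unfolding above_def below_def wshift_add[OF bounded_indicator] wshift_one[symmetric]
  by (rule wshift_eqI) auto

lemma above_level: "above j + (\<Sum>n<j. level n) = id_blinfun"
proof (induction j)
  case 0
  show ?case by (simp add: above_def wshift_one)
next
  case (Suc j)
  have "above (Suc j) + level j = above j"
    unfolding above_def level_def wshift_add[OF bounded_indicator(1) bounded_unit_weight]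
    by (rule wshift_eqI) (auto simp: unit_weight_def)
  then have "above (Suc j) + (\<Sum>n<Suc j. level n) = above j + (\<Sum>n<j. level n)"
    by (simp only: sum.lessThan_Suc add.assoc[symmetric] add.commute[of _ "level j"])
  then show ?case using Suc by simp
qed

lemma above_above: "j \<le> j' \<Longrightarrow> above j o\<^sub>L above j' = above j'"
  unfolding above_def wshift_compose[OF bounded_indicator(1) bounded_indicator(1)]
  by (rule wshift_eqI) (auto simp: shift_mult_def)

lemma level_level: "level n o\<^sub>L level n = level n"
  using matrix_unit_mult[of 0 n n 0 n] by (simp add: level_matrix_unit)

lemma level_below: "n < j \<Longrightarrow> level n o\<^sub>L below j = level n"
  unfolding level_def below_def wshift_compose[OF bounded_unit_weight bounded_indicator(2)]
  by (rule wshift_eqI) (auto simp: shift_mult_def unit_weight_def)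

lemma norm_above_le: "norm (above j) \<le> 1"
  unfolding above_def by (rule norm_wshift_le) auto

lemma norm_below_le: "norm (below j) \<le> 1"
  unfolding below_def by (rule norm_wshift_le) auto

lemma norm_level_le: "norm (level j) \<le> 1"
  unfolding level_def by (rule norm_wshift_le) (auto simp: unit_weight_def)

lemma norm_compose_le1: "norm (U :: operator) \<le> 1 \<Longrightarrow> norm (T o\<^sub>L U) \<le> norm T"
  by (rule order.trans[OF norm_blinfun_compose mult_left_le]) simp_all

lemma norm_compose_le2: "norm (U :: operator) \<le> 1 \<Longrightarrow> norm (U o\<^sub>L T) \<le> norm T"
  by (rule order.trans[OF norm_blinfun_compose mult_left_le_one_le]) simp_all

lemma norm_scalar_above: "norm (scalar_op c o\<^sub>L above j) \<ge> cmod c"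
proof -
  have "blinfun_apply (scalar_op c o\<^sub>L above j) (ket (0, j)) = scaleC_ell2 c (ket (0, j))"
    by (rule ell2_eqI) (auto simp: scalar_op_apply above_def wshift_apply wshift_ket)
  then have "cmod c = cmod (ell2_coord (blinfun_apply (scalar_op c o\<^sub>L above j) (ket (0, j))) (0, j))"
    by simp
  also have "\<dots> \<le> norm (blinfun_apply (scalar_op c o\<^sub>L above j) (ket (0, j)))" by (rule coord_le_norm)
  also have "\<dots> \<le> norm (scalar_op c o\<^sub>L above j) * norm (ket (0, j) :: (int \<times> nat) ell2)" by (rule norm_blinfun)
  also have "norm (ket (0, j) :: (int \<times> nat) ell2) = 1"
  proof -
    have "(norm (ket (0, j) :: (int \<times> nat) ell2))\<^sup>2 = (\<Sum>\<^sub>\<infinity>i\<in>{(0 :: int, j)}. 1)"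
      unfolding ell2_norm_sq by (rule infsum_cong_neutral) (auto split: if_splits)
    then have "(norm (ket (0, j) :: (int \<times> nat) ell2))\<^sup>2 = 1\<^sup>2" by simp
    then show ?thesis by (rule power2_eq_imp_eq) simp_all
  qed
  finally show ?thesis by simp
qed

lemma norm_scalar_op: "norm (scalar_op c) \<le> cmod c"
  by (rule norm_wshift_le) auto

context su2
begin

lemma letters_degree_ops:
  "letter_op (Alpha, False) \<in> degree_ops (- 1)" "letter_op (Alpha, True) \<in> degree_ops 1"
  "letter_op (Beta, False) \<in> degree_ops (int l)" "letter_op (Beta, True) \<in> degree_ops (- int l)"
proof -
  have "letter_op x \<in> degree_ops (letter_degree l x)" for x
  proof -
    have "word_op [x] = letter_op x" by (auto intro: blinfun_eqI)
    then show ?thesis using degree_ops_word[of "[x]"] by simp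
  qed
  from this[of "(Alpha, False)"] this[of "(Alpha, True)"] this[of "(Beta, False)"] this[of "(Beta, True)"]
  show "letter_op (Alpha, False) \<in> degree_ops (- 1)" "letter_op (Alpha, True) \<in> degree_ops 1"
    "letter_op (Beta, False) \<in> degree_ops (int l)" "letter_op (Beta, True) \<in> degree_ops (- int l)" by simp_all
qed

lemma sqrt_weight_nonzero: "n > 0 \<Longrightarrow> complex_of_real (sqrt (1 - q ^ n)) \<noteq> 0"
  using q_pos q_less_1 power_Suc_less_one[of q "n - 1"] by simp

text \<open>The operator \<open>\<beta>\<beta>\<^sup>*\<close> is diagonal with eigenvalue \<open>q\<^bsup>2n\<^esup>\<close> at level \<open>n\<close>, so its powers converge in norm to the projection onto
  level \<open>0\<close>.\<close>

lemma level_0_in_closure: "level 0 \<in> degree_closure 0"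
proof -
  define X where "X k = wshift 0 0 (\<lambda>n. complex_of_real (q ^ (2 * n * k)))" for k
  have X: "X k \<in> degree_ops 0" for k
  proof (induction k)
    case 0
    have "word_op [] \<in> degree_ops 0" by (rule degree_ops_word) simp
    then show ?case by (simp add: X_def wshift_one)
  next
    case (Suc k)
    have "X (Suc k) = letter_op (Beta, False) o\<^sub>L (letter_op (Beta, True) o\<^sub>L X k)"
      unfolding X_def letter_op_eq wshift_compose[OF weight_bounded(2) weight_bounded(2)]
        wshift_compose[OF weight_bounded(2) bounded_weight_shift_mult[OF weight_bounded(2) weight_bounded(2)]]
      by (rule wshift_eqI) (auto simp: shift_mult_def power_add[symmetric] algebra_simps simp flip: of_real_mult of_real_power)
    then show ?case
      using degree_ops_mult[OF letters_degree_ops(3) degree_ops_mult[OF letters_degree_ops(4) Suc]] by simp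
  qed
  have "X \<longlonglongrightarrow> level 0"
  proof (rule Lim_null[THEN iffD2], rule tendsto_norm_zero_cancel, rule tendsto_sandwich)
    show "\<forall>\<^sub>F k in sequentially. 0 \<le> norm (X k - level 0)" by simp
    have "norm (X k - level 0) \<le> q ^ k" if "k \<ge> 1" for k
    proof -
      have "X k - level 0 = wshift 0 0 (\<lambda>n. complex_of_real (q ^ (2 * n * k)) + - unit_weight 0 n)"
        unfolding X_def level_def diff_conv_add_uminus wshift_minus[OF bounded_unit_weight]
        by (rule wshift_add) (simp_all add: bounded_weight_def unit_weight_def, auto intro: exI[of _ 1] simp: q_power_le norm_power abs_of_pos q_pos)
      moreover have "cmod (complex_of_real (q ^ (2 * n * k)) + - unit_weight 0 n) \<le> q ^ k" for n
      proof (cases n)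
        case (Suc m)
        have "cmod (complex_of_real (q ^ (2 * n * k)) + - unit_weight 0 n) = q ^ (2 * n * k)"
          using q_pos Suc by (simp add: unit_weight_def norm_power)
        also have "\<dots> \<le> q ^ k"
          using q_pos q_less_1 Suc by (intro power_decreasing) auto
        finally show ?thesis .
      qed (use q_pos in \<open>simp add: unit_weight_def\<close>)
      ultimately show ?thesis using q_pos by (simp add: norm_wshift_le)
    qed
    then show "\<forall>\<^sub>F k in sequentially. norm (X k - level 0) \<le> q ^ k"
      by (rule eventually_sequentiallyI)
    show "(\<lambda>k. q ^ k) \<longlonglongrightarrow> 0" using q_pos q_less_1 by (intro LIMSEQ_power_zero) simp
  qed simp
  then show ?thesis by (rule degree_closure_limit[rotated]) (rule degree_ops_closure[OF X])
qed

text \<open>Multiplying the projection onto level \<open>0\<close> by powers of the generators reaches all matrix units, as the weights of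
  \<open>\<alpha>\<close> and \<open>\<beta>\<close> do not vanish.\<close>

lemma matrix_unit_in_closure: "matrix_unit a m m' \<in> degree_closure (int l * a - (int m - int m'))"
proof -
  have inverse: "T \<in> degree_closure i" if "c \<noteq> 0" "wshift a k (\<lambda>n. c * unit_weight m n) \<in> degree_closure i" "T = wshift a k (unit_weight m)" for T a k m c i
  proof -
    have "bounded_weight (\<lambda>n. c * unit_weight m n)"
      using bounded_weight_mult[OF bounded_weight_const bounded_unit_weight, of c m "\<lambda>n. n"] .
    then have "T = scalar_op (1 / c) o\<^sub>L wshift a k (\<lambda>n. c * unit_weight m n)"
      using that(1,3) by (simp add: scalar_wshift)
    then show ?thesis using degree_closure_scalar[OF that(2)] by simp
  qed
  have a_pos: "matrix_unit (int a) 0 0 \<in> degree_closure (int l * int a)" for a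
  proof (induction a)
    case 0
    show ?case using level_0_in_closure by (simp add: level_matrix_unit)
  next
    case (Suc a)
    have "matrix_unit (int (Suc a)) 0 0 = letter_op (Beta, False) o\<^sub>L matrix_unit (int a) 0 0"
      unfolding matrix_unit_def letter_op_eq wshift_compose[OF weight_bounded(2) bounded_unit_weight]
      by (rule wshift_eqI) (auto simp: shift_mult_def unit_weight_def)
    then show ?case using degree_closure_mult[OF degree_ops_closure[OF letters_degree_ops(3)] Suc] by (simp add: algebra_simps)
  qed
  have a_neg: "matrix_unit (- int a) 0 0 \<in> degree_closure (int l * - int a)" for a
  proof (induction a)
    case 0
    show ?case using level_0_in_closure by (simp add: level_matrix_unit)
  next
    case (Suc a)
    have "matrix_unit (- int (Suc a)) 0 0 = letter_op (Beta, True) o\<^sub>L matrix_unit (- int a) 0 0"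
      unfolding matrix_unit_def letter_op_eq wshift_compose[OF weight_bounded(2) bounded_unit_weight]
      by (rule wshift_eqI) (auto simp: shift_mult_def unit_weight_def)
    then show ?case using degree_closure_mult[OF degree_ops_closure[OF letters_degree_ops(4)] Suc] by (simp add: algebra_simps)
  qed
  have a: "matrix_unit a 0 0 \<in> degree_closure (int l * a)"
    using a_pos[of "nat a"] a_neg[of "nat (- a)"] by (cases "a \<ge> 0") simp_all
  have m: "matrix_unit a m 0 \<in> degree_closure (int l * a - int m)" for m
  proof (induction m)
    case 0
    show ?case using a by simp
  next
    case (Suc m)
    let ?c = "complex_of_real (sqrt (1 - q ^ (2 * Suc m)))"
    have "wshift a (int (Suc m)) (\<lambda>n. ?c * unit_weight (Suc m) n) = letter_op (Alpha, False) o\<^sub>L matrix_unit a m 0"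
      unfolding matrix_unit_def letter_op_eq wshift_compose[OF weight_bounded(1) bounded_unit_weight]
      by (rule wshift_eqI) (auto simp: shift_mult_def unit_weight_def)
    then have "wshift a (int (Suc m)) (\<lambda>n. ?c * unit_weight (Suc m) n) \<in> degree_closure (int l * a - int (Suc m))"
      using degree_closure_mult[OF degree_ops_closure[OF letters_degree_ops(1)] Suc] by (simp add: algebra_simps)
    then show ?case
      using inverse[OF sqrt_weight_nonzero, of "2 * Suc m" a "int (Suc m)" "Suc m"] by (simp add: matrix_unit_def)
  qed
  show ?thesis
  proof (induction m')
    case 0
    show ?case using m by simp
  next
    case (Suc m')
    let ?c = "complex_of_real (sqrt (1 - q ^ (2 * Suc m')))"
    have "wshift a (int m - int (Suc m')) (\<lambda>n. ?c * unit_weight m n) = matrix_unit a m m' o\<^sub>L letter_op (Alpha, True)"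
      unfolding matrix_unit_def letter_op_eq wshift_compose[OF bounded_unit_weight weight_bounded(1)]
      by (rule wshift_eqI) (auto simp: shift_mult_def unit_weight_def)
    then have "wshift a (int m - int (Suc m')) (\<lambda>n. ?c * unit_weight m n) \<in> degree_closure (int l * a - (int m - int (Suc m')))"
      using degree_closure_mult[OF Suc degree_ops_closure[OF letters_degree_ops(2)]] by (simp add: algebra_simps)
    then show ?case
      using inverse[OF sqrt_weight_nonzero, of "2 * Suc m'" a "int m - int (Suc m')" m] by (simp add: matrix_unit_def)
  qed
qed

lemma level_in_closure: "level n \<in> degree_closure 0"
  using matrix_unit_in_closure[of 0 n n] by (simp add: level_matrix_unit)

lemma above_in_closure: "above j \<in> degree_closure 0"
proof -
  have "above j = id_blinfun - (\<Sum>n<j. level n)" using above_level[of j] by (simp add: algebra_simps)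
  then show ?thesis using degree_closure_diff[OF degree_closure_one degree_closure_sum[of "{..<j}" level]] level_in_closure by simp
qed

text \<open>A convergent diagonal is the norm limit of diagonals that are eventually constant, and these are scalars
  plus combinations of the projections onto single levels.\<close>

lemma diagonal_in_closure:
  assumes b: "bounded_weight b" and lim: "b \<longlonglongrightarrow> c"
  shows "wshift 0 0 b \<in> degree_closure 0"
proof -
  define X where "X N = wshift 0 0 (\<lambda>n. if n < N then b n else c)" for N :: nat
  have bd: "bounded_weight (\<lambda>n. if n < N then b n else c)" for N :: nat
    by (intro bounded_weight_if b bounded_weight_const)
  have X: "X N \<in> degree_closure 0" for N
  proof (induction N)
    case 0
    show ?case by (simp add: X_def degree_closure_scalar_op)
  next
    case (Suc N)
    have "X (Suc N) = X N + (scalar_op (b N - c) o\<^sub>L level N)"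
      unfolding level_def scalar_wshift[OF bounded_unit_weight] X_def
      by (subst wshift_add[OF bd bounded_weight_mult[OF bounded_weight_const bounded_unit_weight]])
        (rule wshift_eqI, auto simp: unit_weight_def less_Suc_eq)
    then show ?case using degree_closure_add[OF Suc degree_closure_scalar[OF level_in_closure]] by simp
  qed
  have "X \<longlonglongrightarrow> wshift 0 0 b"
  proof (rule LIMSEQ_I)
    fix e :: real assume e: "e > 0"
    obtain M where M: "\<And>n. n \<ge> M \<Longrightarrow> norm (b n - c) < e / 2"
      using LIMSEQ_D[OF lim, of "e / 2"] e by auto
    have "norm (X N - wshift 0 0 b) < e" if N: "N \<ge> M" for N
    proof -
      have mb: "bounded_weight (\<lambda>n. - b n)" using b by (simp add: bounded_weight_def)
      have "X N - wshift 0 0 b = wshift 0 0 (\<lambda>n. (if n < N then b n else c) + - b n)"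
        unfolding X_def diff_conv_add_uminus wshift_minus[OF b] by (rule wshift_add[OF bd mb])
      also have "norm \<dots> \<le> e / 2"
      proof (rule norm_wshift_le)
        show "cmod ((if n < N then b n else c) + - b n) \<le> e / 2" for n
          using M[of n] N e by (auto simp: norm_minus_commute)
      qed (use e in simp)
      finally show ?thesis using e by simp
    qed
    then show "\<exists>no. \<forall>n\<ge>no. norm (X n - wshift 0 0 b) < e" by blast
  qed
  then show ?thesis by (rule degree_closure_limit[rotated]) (rule X)
qed

end

definition shift :: "int \<Rightarrow> operator" where "shift k = wshift 0 k (\<lambda>_. 1)"

lemma shift_shift:
  "shift (- int j) o\<^sub>L shift (int j) = id_blinfun" "shift (int j) o\<^sub>L shift (- int j) = above j"
  unfolding shift_def above_def wshift_compose[OF bounded_weight_const bounded_weight_const] wshift_one[symmetric]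
  by (rule wshift_eqI; auto simp: shift_mult_def)+

lemma bounded_weight_convergent: "b \<longlonglongrightarrow> c \<Longrightarrow> bounded_weight b"
  using Bseq_def convergentI convergent_imp_Bseq unfolding bounded_weight_def by blast

context su2
begin

text \<open>The partial isometry of \<open>\<alpha>\<close> is \<open>\<alpha>\<close> times the diagonal of the inverse weights, which converge to \<open>1\<close>.\<close>

lemma shift_in_closure: "shift k \<in> degree_closure (- k)"
proof -
  have inv: "(\<lambda>n. 1 / complex_of_real (sqrt (1 - q ^ (2 * n)))) \<longlonglongrightarrow> 1"
    using tendsto_divide[OF tendsto_const[of 1] sqrt_weight_limit] by simp
  have inv': "(\<lambda>n. 1 / complex_of_real (sqrt (1 - q ^ (2 * (n + 1))))) \<longlonglongrightarrow> 1"
    using LIMSEQ_ignore_initial_segment[OF inv, of 1] .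
  have pos: "shift 1 \<in> degree_closure (- 1)"
  proof -
    have "wshift 0 0 (\<lambda>n. 1 / complex_of_real (sqrt (1 - q ^ (2 * n)))) o\<^sub>L letter_op (Alpha, False) = shift 1"
      unfolding shift_def letter_op_eq wshift_compose[OF bounded_weight_convergent[OF inv] weight_bounded(1)]
    proof (rule wshift_eqI)
      fix n assume "0 + 1 \<le> int n"
      then show "shift_mult 0 1 (\<lambda>n. 1 / complex_of_real (sqrt (1 - q ^ (2 * n))))
          (\<lambda>n. complex_of_real (sqrt (1 - q ^ (2 * n)))) n = 1"
        using sqrt_weight_nonzero[of "2 * n"] by (simp add: shift_mult_def)
    qed simp_all
    then show ?thesis
      using degree_closure_mult[OF diagonal_in_closure[OF bounded_weight_convergent[OF inv] inv] degree_ops_closure[OF letters_degree_ops(1)]] by simp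
  qed
  have neg: "shift (- 1) \<in> degree_closure 1"
  proof -
    have "wshift 0 0 (\<lambda>n. 1 / complex_of_real (sqrt (1 - q ^ (2 * (n + 1))))) o\<^sub>L letter_op (Alpha, True) = shift (- 1)"
      unfolding shift_def letter_op_eq wshift_compose[OF bounded_weight_convergent[OF inv'] weight_bounded(1)]
    proof (rule wshift_eqI)
      fix n assume "0 + - 1 \<le> int n"
      then show "shift_mult 0 (- 1) (\<lambda>n. 1 / complex_of_real (sqrt (1 - q ^ (2 * (n + 1)))))
          (\<lambda>n. complex_of_real (sqrt (1 - q ^ (2 * (n + 1))))) n = 1"
        using sqrt_weight_nonzero[of "2 * (n + 1)"] by (simp add: shift_mult_def)
    qed simp_all
    then show ?thesis
      using degree_closure_mult[OF diagonal_in_closure[OF bounded_weight_convergent[OF inv'] inv'] degree_ops_closure[OF letters_degree_ops(2)]] by simp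
  qed
  have zero: "shift 0 \<in> degree_closure 0" using degree_closure_one by (simp add: shift_def wshift_one)
  have step: "shift (int (Suc j)) = shift 1 o\<^sub>L shift (int j)" "shift (- int (Suc j)) = shift (- int j) o\<^sub>L shift (- 1)" for j
    unfolding shift_def wshift_compose[OF bounded_weight_const bounded_weight_const]
    by (rule wshift_eqI; auto simp: shift_mult_def)+
  have p: "shift (int j) \<in> degree_closure (- int j)" for j
  proof (induction j)
    case (Suc j)
    then show ?case using degree_closure_mult[OF pos Suc] step(1)[of j] by (simp add: algebra_simps)
  qed (use zero in simp)
  have n: "shift (- int j) \<in> degree_closure (int j)" for j
  proof (induction j)
    case (Suc j)
    then show ?case using degree_closure_mult[OF Suc neg] step(2)[of j] by (simp add: algebra_simps)
  qed (use zero in simp)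
  show ?thesis
    using p[of "nat k"] n[of "nat (- k)"] by (cases "k \<ge> 0") simp_all
qed

section \<open>Asymptotics of the operators of degree \<open>0\<close>\<close>

lemma wshift_above_small:
  assumes b: "bounded_weight b" "b \<longlonglongrightarrow> 0" and e: "e > 0"
  shows "\<exists>j. norm (wshift a k b o\<^sub>L above j) < e"
proof -
  obtain N where N: "\<And>n. n \<ge> N \<Longrightarrow> norm (b n - 0) < e / 2"
    using LIMSEQ_D[OF b(2), of "e / 2"] e by auto
  have "norm (wshift a k b o\<^sub>L above (N + nat \<bar>k\<bar>)) \<le> e / 2"
    unfolding above_def wshift_compose[OF b(1) bounded_indicator(1)]
  proof (rule norm_wshift_le)
    show "cmod (shift_mult k 0 b (\<lambda>n. if N + nat \<bar>k\<bar> \<le> n then 1 else 0) n) \<le> e / 2" for n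
    proof (cases "k \<le> int n \<and> N + nat \<bar>k\<bar> \<le> nat (int n - k)")
      case True
      then have "N \<le> n" by linarith
      then show ?thesis using N[of n] e by (simp add: shift_mult_def)
    next
      case False
      then show ?thesis using e by (auto simp: shift_mult_def)
    qed
  qed (use e in simp)
  then show ?thesis using e by (intro exI[of _ "N + nat \<bar>k\<bar>"]) simp
qed

lemma above_mono: "j \<le> j' \<Longrightarrow> norm (T o\<^sub>L above j') \<le> norm ((T :: operator) o\<^sub>L above j)"
  using norm_compose_le1[OF norm_above_le[of j'], of "T o\<^sub>L above j"]
  by (simp add: operator_assoc above_above)

text \<open>\<open>nearly_scalar T c\<close> says that \<open>T\<close> is \<open>c\<close> modulo compact operators.\<close>

definition nearly_scalar :: "operator \<Rightarrow> complex \<Rightarrow> bool" where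
  "nearly_scalar T c \<longleftrightarrow> (\<forall>e>0. \<exists>j. norm ((T - scalar_op c) o\<^sub>L above j) < e)"

lemma compose_diff:
  fixes U :: operator
  shows "(U - T) o\<^sub>L V = (U o\<^sub>L V) - (T o\<^sub>L V)" "V o\<^sub>L (U - T) = (V o\<^sub>L U) - (V o\<^sub>L T)"
  by (auto intro!: blinfun_eqI simp: minus_blinfun.rep_eq blinfun.diff_right)

lemma scalar_op_diff: "scalar_op (c - d) = scalar_op c - scalar_op d"
  using scalar_op_add[of "c - d" d] by (simp add: algebra_simps)

lemma nearly_scalar_add:
  assumes "nearly_scalar T c" "nearly_scalar U d"
  shows "nearly_scalar (T + U) (c + d)"
  unfolding nearly_scalar_def
proof (intro allI impI)
  fix e :: real assume e: "e > 0"
  then have e2: "e / 2 > 0" by simp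
  obtain i where i: "norm ((T - scalar_op c) o\<^sub>L above i) < e / 2" using assms(1) e2 unfolding nearly_scalar_def by blast
  obtain j where j: "norm ((U - scalar_op d) o\<^sub>L above j) < e / 2" using assms(2) e2 unfolding nearly_scalar_def by blast
  let ?m = "max i j"
  have "(T + U - scalar_op (c + d)) o\<^sub>L above ?m = ((T - scalar_op c) o\<^sub>L above ?m) + ((U - scalar_op d) o\<^sub>L above ?m)"
    unfolding scalar_op_add compose_add[symmetric] by (simp add: algebra_simps)
  then have "norm ((T + U - scalar_op (c + d)) o\<^sub>L above ?m)
      \<le> norm ((T - scalar_op c) o\<^sub>L above ?m) + norm ((U - scalar_op d) o\<^sub>L above ?m)"
    by (simp add: norm_triangle_ineq)
  also have "\<dots> < e"
    using i j above_mono[of i ?m "T - scalar_op c"] above_mono[of j ?m "U - scalar_op d"] by simp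
  finally show "\<exists>j. norm ((T + U - scalar_op (c + d)) o\<^sub>L above j) < e" by blast
qed

lemma nearly_scalar_mult:
  assumes "nearly_scalar T c"
  shows "nearly_scalar (scalar_op d o\<^sub>L T) (d * c)"
  unfolding nearly_scalar_def
proof (intro allI impI)
  fix e :: real assume e: "e > 0"
  have d: "0 < cmod d + 1" by (rule add_nonneg_pos) simp_all
  then obtain j where j: "norm ((T - scalar_op c) o\<^sub>L above j) < e / (cmod d + 1)"
    using assms e unfolding nearly_scalar_def by (meson divide_pos_pos)
  have "((scalar_op d o\<^sub>L T) - scalar_op (d * c)) o\<^sub>L above j = scalar_op d o\<^sub>L ((T - scalar_op c) o\<^sub>L above j)"
    unfolding scalar_op_mult by (simp add: compose_diff operator_assoc)
  then have "norm (((scalar_op d o\<^sub>L T) - scalar_op (d * c)) o\<^sub>L above j)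
      \<le> norm (scalar_op d) * norm ((T - scalar_op c) o\<^sub>L above j)"
    using norm_blinfun_compose[of "scalar_op d" "(T - scalar_op c) o\<^sub>L above j"] by simp
  also have "\<dots> \<le> (cmod d + 1) * norm ((T - scalar_op c) o\<^sub>L above j)"
    using norm_scalar_op[of d] by (intro mult_right_mono) auto
  also have "\<dots> < e" using j d by (simp add: pos_less_divide_eq mult.commute)
  finally show "\<exists>j. norm (((scalar_op d o\<^sub>L T) - scalar_op (d * c)) o\<^sub>L above j) < e" by blast
qed

lemma nearly_scalar_word:
  assumes "word_degree l w = 0"
  shows "\<exists>c. nearly_scalar (word_op w) c"
proof -
  obtain a k b x where w: "word_op w = wshift a k b" "bounded_weight b" "b \<longlonglongrightarrow> x"
    "int l * a - k = word_degree l w" "x = 0 \<or> a = 0" using word_op_form[of w] .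
  show ?thesis
  proof (cases "x = 0")
    case True
    then show ?thesis
      using wshift_above_small[OF w(2), of _ a k] w(1,3) by (intro exI[of _ 0]) (simp add: nearly_scalar_def wshift_zero)
  next
    case False
    then have ak: "a = 0" "k = 0" using w(4,5) assms by simp_all
    have mx: "bounded_weight (\<lambda>n. b n + - x)"
      using bounded_weight_add[OF w(2) bounded_weight_const] .
    have "wshift 0 0 b - scalar_op x = wshift 0 0 (\<lambda>n. b n + - x)"
      unfolding diff_conv_add_uminus wshift_minus[OF bounded_weight_const] by (rule wshift_add[OF w(2) bounded_weight_const])
    moreover have "(\<lambda>n. b n + - x) \<longlonglongrightarrow> 0"
      using LIM_zero[OF w(3)] by simp
    ultimately show ?thesis
      using wshift_above_small[OF mx, of _ 0 0] w(1) ak by (intro exI[of _ x]) (simp add: nearly_scalar_def)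
  qed
qed

lemma nearly_scalar_ops: "T \<in> degree_ops 0 \<Longrightarrow> \<exists>c. nearly_scalar T c"
proof (induction rule: degree_ops_induct)
  case zero
  show ?case by (intro exI[of _ 0]) (simp add: nearly_scalar_def wshift_zero)
next
  case (word c w)
  then show ?case using nearly_scalar_word nearly_scalar_mult by blast
next
  case (add U T)
  then show ?case using nearly_scalar_add by blast
qed

lemma nearly_scalar_dist:
  assumes "nearly_scalar T c" "nearly_scalar U d"
  shows "cmod (c - d) \<le> norm (T - U)"
proof (rule field_le_epsilon)
  fix e :: real assume e: "e > 0"
  then have e2: "e / 2 > 0" by simp
  obtain i where i: "norm ((T - scalar_op c) o\<^sub>L above i) < e / 2" using assms(1) e2 unfolding nearly_scalar_def by blast
  obtain j where j: "norm ((U - scalar_op d) o\<^sub>L above j) < e / 2" using assms(2) e2 unfolding nearly_scalar_def by blast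
  let ?m = "max i j"
  have "scalar_op (c - d) o\<^sub>L above ?m = ((T - U) o\<^sub>L above ?m) - ((T - scalar_op c) o\<^sub>L above ?m) + ((U - scalar_op d) o\<^sub>L above ?m)"
    unfolding scalar_op_diff compose_diff by simp
  then have "cmod (c - d) \<le> norm (((T - U) o\<^sub>L above ?m) - ((T - scalar_op c) o\<^sub>L above ?m) + ((U - scalar_op d) o\<^sub>L above ?m))"
    using norm_scalar_above[of "c - d" ?m] by simp
  also have "\<dots> \<le> norm ((T - U) o\<^sub>L above ?m) + norm ((T - scalar_op c) o\<^sub>L above ?m) + norm ((U - scalar_op d) o\<^sub>L above ?m)"
    by (intro order.trans[OF norm_triangle_ineq] add_mono norm_triangle_ineq4 order_refl)
  also have "\<dots> \<le> norm (T - U) + e"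
    using i j above_mono[of i ?m "T - scalar_op c"] above_mono[of j ?m "U - scalar_op d"]
      norm_compose_le1[OF norm_above_le, of "T - U" ?m] by simp
  finally show "cmod (c - d) \<le> norm (T - U) + e" .
qed

text \<open>The scalar is a Lipschitz function of the operator by \<open>nearly_scalar_dist\<close>, so it converges along a convergent sequence.\<close>

lemma nearly_scalar_closure:
  assumes "T \<in> degree_closure 0"
  obtains c where "nearly_scalar T c"
proof -
  obtain X where X: "\<And>n. X n \<in> degree_ops 0" "X \<longlonglongrightarrow> T" using assms by (rule degree_closure_sequence) (rule that)
  have "\<forall>n. \<exists>c. nearly_scalar (X n) c" using nearly_scalar_ops X(1) by blast
  then obtain d where d: "\<And>n. nearly_scalar (X n) (d n)" by metis
  have "Cauchy d"
  proof (rule CauchyI)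
    fix e :: real assume "e > 0"
    then obtain M where M: "\<forall>m\<ge>M. \<forall>n\<ge>M. norm (X m - X n) < e"
      using CauchyD[OF LIMSEQ_imp_Cauchy[OF X(2)]] by blast
    have "norm (d m - d n) < e" if "m \<ge> M" "n \<ge> M" for m n
      using M that nearly_scalar_dist[OF d[of m] d[of n]] by (meson le_less_trans)
    then show "\<exists>M. \<forall>m\<ge>M. \<forall>n\<ge>M. norm (d m - d n) < e" by blast
  qed
  then obtain c where c: "d \<longlonglongrightarrow> c" using Cauchy_convergent convergent_def by blast
  have "nearly_scalar T c"
    unfolding nearly_scalar_def
  proof (intro allI impI)
    fix e :: real assume "e > 0"
    then have e3: "e / 3 > 0" by simp
    obtain M where M: "\<And>n. n \<ge> M \<Longrightarrow> norm (X n - T) < e / 3" using LIMSEQ_D[OF X(2) e3] by blast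
    obtain N where N: "\<And>n. n \<ge> N \<Longrightarrow> norm (d n - c) < e / 3" using LIMSEQ_D[OF c e3] by blast
    define n where "n = max M N"
    have n: "norm (X n - T) < e / 3" "norm (d n - c) < e / 3" using M[of n] N[of n] by (simp_all add: n_def)
    obtain j where j: "norm ((X n - scalar_op (d n)) o\<^sub>L above j) < e / 3"
      using d[of n] e3 unfolding nearly_scalar_def by blast
    have "(T - scalar_op c) o\<^sub>L above j
        = ((X n - scalar_op (d n)) o\<^sub>L above j) - ((X n - T) o\<^sub>L above j) + (scalar_op (d n - c) o\<^sub>L above j)"
      unfolding scalar_op_diff compose_diff by simp
    then have "norm ((T - scalar_op c) o\<^sub>L above j) \<le> norm ((X n - scalar_op (d n)) o\<^sub>L above j)
        + norm ((X n - T) o\<^sub>L above j) + norm (scalar_op (d n - c) o\<^sub>L above j)"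
      by (simp only:) (intro order.trans[OF norm_triangle_ineq] add_mono norm_triangle_ineq4 order_refl)
    also have "\<dots> \<le> norm ((X n - scalar_op (d n)) o\<^sub>L above j) + norm (X n - T) + cmod (d n - c)"
      by (intro add_mono order_refl norm_compose_le1[OF norm_above_le]
          order.trans[OF norm_compose_le1[OF norm_above_le] norm_scalar_op])
    also have "\<dots> < e" using j n by simp
    finally show "\<exists>j. norm ((T - scalar_op c) o\<^sub>L above j) < e" by blast
  qed
  then show thesis by (rule that)
qed

text \<open>A word changes levels by at most its length, so between low and sufficiently high levels it is \<open>0\<close>. That rows
  decay makes the operators that vanish at infinity a right ideal.\<close>

lemma below_above_small:
  assumes T: "T \<in> degree_closure 0" and e: "e > 0"
  shows "\<exists>j'. norm (below j o\<^sub>L T o\<^sub>L above j') < e"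
proof -
  have word_vanish: "\<exists>J. \<forall>j'\<ge>J. below j o\<^sub>L word_op w o\<^sub>L above j' = 0" for w
  proof -
    obtain a k b x where w: "word_op w = wshift a k b" "bounded_weight b" using word_op_form[of w] by metis
    have "below j o\<^sub>L word_op w o\<^sub>L above j' = 0" if "j' \<ge> j + nat \<bar>k\<bar>" for j'
    proof -
      have "below j o\<^sub>L word_op w o\<^sub>L above j' = wshift (a + 0) (0 + k + 0) (\<lambda>_. 0)"
        unfolding w(1) below_def above_def wshift_compose[OF bounded_indicator(2) w(2)]
          wshift_compose[OF bounded_weight_shift_mult[OF bounded_indicator(2) w(2)] bounded_indicator(1)]
        by (rule wshift_eqI) (use that in \<open>auto simp: shift_mult_def\<close>)
      then show ?thesis by (simp add: wshift_zero)
    qed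
    then show ?thesis by blast
  qed
  have A: "\<exists>J. \<forall>j'\<ge>J. below j o\<^sub>L U o\<^sub>L above j' = 0" if "U \<in> degree_ops 0" for U
    using that
  proof (induction rule: degree_ops_induct)
    case (word c w)
    obtain J where J: "\<forall>j'\<ge>J. below j o\<^sub>L word_op w o\<^sub>L above j' = 0" using word_vanish[of w] by blast
    have "below j o\<^sub>L (scalar_op c o\<^sub>L word_op w) o\<^sub>L above j' = scalar_op c o\<^sub>L (below j o\<^sub>L word_op w o\<^sub>L above j')" for j'
    proof -
      have "below j o\<^sub>L scalar_op c = scalar_op c o\<^sub>L below j"
        by (rule scalar_op_commute) (simp add: below_def clinear_wshift)
      then show ?thesis by (metis operator_assoc)
    qed
    moreover have "scalar_op c o\<^sub>L (0 :: operator) = 0" by (rule blinfun_eqI) simp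
    ultimately show ?case using J by (intro exI[of _ J]) simp
  next
    case (add U T)
    then obtain J J' where "\<forall>j'\<ge>J. below j o\<^sub>L U o\<^sub>L above j' = 0" "\<forall>j'\<ge>J'. below j o\<^sub>L T o\<^sub>L above j' = 0" by blast
    then show ?case by (intro exI[of _ "max J J'"]) (simp add: compose_add)
  qed auto
  obtain X where X: "\<And>n. X n \<in> degree_ops 0" "X \<longlonglongrightarrow> T" using T by (rule degree_closure_sequence) (rule that)
  obtain n where n: "norm (X n - T) < e" using LIMSEQ_D[OF X(2) e] by blast
  obtain j' where j': "below j o\<^sub>L X n o\<^sub>L above j' = 0" using A[OF X(1)] by blast
  have "below j o\<^sub>L T o\<^sub>L above j' = below j o\<^sub>L (T - X n) o\<^sub>L above j'"
    using j' by (simp add: compose_diff)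
  also have "norm \<dots> \<le> norm (T - X n)"
    by (rule order.trans[OF norm_compose_le1[OF norm_above_le] norm_compose_le2[OF norm_below_le]])
  finally show ?thesis using n by (intro exI[of _ j']) (simp add: norm_minus_commute)
qed

text \<open>Commutation with the bilateral shift and preservation of the degree determine each corner
  of an operator up to a scalar.\<close>

lemma level_corner:
  assumes "T \<in> degree_closure 0"
  shows "\<exists>c a. level n o\<^sub>L T o\<^sub>L level m = scalar_op c o\<^sub>L matrix_unit a n m \<and> (c \<noteq> 0 \<longrightarrow> int l * a = int n - int m)"
proof -
  \<comment> \<open>The only shift of the first factor that compensates the change of level from \<open>m\<close> to \<open>n\<close>, if there is one.\<close>
  define a0 where "a0 = (int n - int m) div int l"
  define dv where "dv \<longleftrightarrow> int l dvd (int n - int m)"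
  define h where "h = (\<lambda>T x r. ell2_coord (blinfun_apply T (blinfun_apply (level m) x)) (r, n)
    - (if dv then ell2_coord (blinfun_apply T (ket (0, m))) (a0, n) * ell2_coord x (r - a0, m) else 0))"
  have lin: "bounded_linear (\<lambda>T. ell2_coord (blinfun_apply T y) i)" for y :: "(int \<times> nat) ell2" and i :: "int \<times> nat"
    by (rule bounded_linear_compose[OF bounded_linear_coord blinfun.bounded_linear_left])
  have cont: "continuous_on UNIV (\<lambda>T. h T x r)" for x r
    unfolding h_def by (cases dv) (simp_all, intro continuous_intros linear_continuous_on[OF lin] continuous_on_mult_right, intro linear_continuous_on[OF lin])
  have word_h: "h (word_op w) x r = 0" if deg: "word_degree l w = 0" for w x r
  proof -
    obtain a k b y where w: "word_op w = wshift a k b" "bounded_weight b" "int l * a - k = word_degree l w"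
      using word_op_form[of w] by metis
    have k: "k = int l * a" using w(3) deg by simp
    have lv: "ell2_coord (blinfun_apply (level m) x) (s, m') = (if m' = m then ell2_coord x (s, m') else 0)" for s m'
      by (simp add: level_def wshift_apply unit_weight_def)
    show ?thesis
    proof (cases "int n - int m = k")
      case True
      then have "dv" "a0 = a" using k l_pos by (simp_all add: dv_def a0_def)
      moreover have "nat (int n - k) = m" "k \<le> int n" using True by auto
      ultimately show ?thesis
        unfolding h_def w(1) wshift_apply[OF w(2)] by (simp add: lv)
    next
      case False
      then have "k \<le> int n \<Longrightarrow> nat (int n - k) \<noteq> m" by auto
      then show ?thesis
        unfolding h_def w(1) wshift_apply[OF w(2)] by (auto simp: lv)
    qed
  qed
  have hA: "h U x r = 0" if "U \<in> degree_ops 0" for U x r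
    using that
  proof (induction rule: degree_ops_induct)
    case (word c w)
    have "h (scalar_op c o\<^sub>L word_op w) x r = c * h (word_op w) x r"
      by (simp add: h_def scalar_op_apply algebra_simps)
    then show ?case using word_h[OF word] by simp
  next
    case (add U T)
    have "h (U + T) x r = h U x r + h T x r"
      by (simp add: h_def plus_blinfun.rep_eq algebra_simps)
    then show ?case using add by simp
  qed (simp add: h_def)
  have hT: "h T x r = 0" for x r
  proof -
    have "(\<lambda>T. h T x r) ` closure (degree_ops 0) \<subseteq> {0}"
      by (rule image_closure_subset[OF continuous_on_subset[OF cont subset_UNIV]]) (use hA in auto)
    then show ?thesis using assms unfolding degree_closure_def by blast
  qed
  define c where "c = (if dv then ell2_coord (blinfun_apply T (ket (0, m))) (a0, n) else 0)"
  have "level n o\<^sub>L T o\<^sub>L level m = scalar_op c o\<^sub>L matrix_unit a0 n m"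
  proof (rule operator_eqI)
    fix x r n'
    have "ell2_coord (blinfun_apply T (blinfun_apply (level m) x)) (r, n) = c * ell2_coord x (r - a0, m)"
      using hT[of x r] by (simp add: h_def c_def)
    moreover have "ell2_coord (blinfun_apply (level n) y) (r, n') = (if n' = n then ell2_coord y (r, n) else 0)" for y
      by (simp add: level_def wshift_apply unit_weight_def)
    moreover have "ell2_coord (blinfun_apply (matrix_unit a0 n m) x) (r, n') = (if n' = n then ell2_coord x (r - a0, m) else 0)"
      by (simp add: matrix_unit_def wshift_apply unit_weight_def)
    ultimately show "ell2_coord (blinfun_apply (level n o\<^sub>L T o\<^sub>L level m) x) (r, n')
        = ell2_coord (blinfun_apply (scalar_op c o\<^sub>L matrix_unit a0 n m) x) (r, n')"
      by (simp add: scalar_op_apply)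
  qed
  moreover have "int l * a0 = int n - int m" if "c \<noteq> 0"
    using that by (auto simp: c_def dv_def a0_def split: if_splits)
  ultimately show ?thesis by blast
qed

end

section \<open>Integer combinations in a commutative group\<close>

lemma (in comm_group) subgroup_int_combinations:
  assumes g: "\<And>i. g i \<in> carrier G"
  shows "subgroup {x. \<exists>I (c :: 'i \<Rightarrow> int). finite I \<and> x = (\<Otimes>i\<in>I. g i [^] c i)} G" (is "subgroup ?H G")
proof (rule subgroupI)
  have pow: "g i [^] (k :: int) \<in> carrier G" for i k using g by simp
  then show "?H \<subseteq> carrier G" by (auto intro!: finprod_closed)
  have "\<one> \<in> ?H" by (intro CollectI exI[of _ "{}"] exI[of _ "\<lambda>_. 0"]) simp
  then show "?H \<noteq> {}" by blast
  fix x assume "x \<in> ?H"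
  then obtain I and c :: "'i \<Rightarrow> int" where I: "finite I" "x = (\<Otimes>i\<in>I. g i [^] c i)" by blast
  have "(\<Otimes>i\<in>I. g i [^] (- c i)) \<otimes> (\<Otimes>i\<in>I. g i [^] c i) = (\<Otimes>i\<in>I. g i [^] (- c i) \<otimes> g i [^] c i)"
    using pow by (intro finprod_multf[symmetric]) auto
  also have "\<dots> = \<one>"
    using g by (intro finprod_one_eqI) (simp add: int_pow_neg)
  finally have "inv x = (\<Otimes>i\<in>I. g i [^] (- c i))"
    unfolding I(2) using pow by (intro inv_equality finprod_closed) auto
  then show "inv x \<in> ?H"
    by (intro CollectI exI[of _ I] exI[of _ "\<lambda>i. - c i"] conjI I(1))
  fix y assume "y \<in> ?H"
  then obtain J and d :: "'i \<Rightarrow> int" where J: "finite J" "y = (\<Otimes>i\<in>J. g i [^] d i)" by blast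
  define c' where "c' = (\<lambda>i. if i \<in> I then c i else 0)"
  define d' where "d' = (\<lambda>i. if i \<in> J then d i else 0)"
  have "x = (\<Otimes>i\<in>I \<union> J. g i [^] c' i)"
    unfolding I(2) using I(1) J(1) pow by (intro finprod_mono_neutral_cong_left) (auto simp: c'_def)
  moreover have "y = (\<Otimes>i\<in>I \<union> J. g i [^] d' i)"
    unfolding J(2) using I(1) J(1) pow by (intro finprod_mono_neutral_cong_left) (auto simp: d'_def)
  ultimately have "x \<otimes> y = (\<Otimes>i\<in>I \<union> J. g i [^] c' i \<otimes> g i [^] d' i)"
    using pow by (simp add: finprod_multf)
  also have "\<dots> = (\<Otimes>i\<in>I \<union> J. g i [^] (c' i + d' i))"
    using g by (intro finprod_cong') (auto simp: int_pow_mult)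
  finally show "x \<otimes> y \<in> ?H"
    using I(1) J(1) by (intro CollectI exI[of _ "I \<union> J"] exI[of _ "\<lambda>i. c' i + d' i"] conjI) simp_all
qed

lemma (in infinite_ring) K0_class_corner_sum:
  assumes a: "a \<in> carrier R" "a \<otimes> a = a" and b: "b \<in> carrier R" "b \<otimes> b = b"
    and ab: "a \<otimes> b = \<zero>" "b \<otimes> a = \<zero>"
  shows "K0_class R (corner_module R (a \<oplus> b)) = K0_class R (corner_module R a) \<otimes>\<^bsub>K0 R\<^esub> K0_class R (corner_module R b)"
proof -
  have c: "a \<oplus> b \<in> carrier R" "(a \<oplus> b) \<otimes> (a \<oplus> b) = a \<oplus> b"
    using a b ab by (simp_all add: l_distr r_distr)
  have "module_iso R (corner_module R (a \<oplus> b)) (module_sum (corner_module R a) (corner_module R b))"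
  proof (rule module_isoI_inverse[where f = "\<lambda>r. (r \<otimes> a, r \<otimes> b)" and g = "\<lambda>(s, t). s \<oplus> t"])
    show "left_linear R (corner_module R (a \<oplus> b)) (module_sum (corner_module R a) (corner_module R b)) (\<lambda>r. (r \<otimes> a, r \<otimes> b))"
      using a b by (intro left_linearI) (auto simp: m_assoc l_distr)
    fix y assume "y \<in> carrier (module_sum (corner_module R a) (corner_module R b))"
    then obtain s t where y: "y = (s, t)" "s \<in> carrier R" "s \<otimes> a = s" "t \<in> carrier R" "t \<otimes> b = t" by auto
    have "s \<otimes> b = \<zero>" using y ab a b m_assoc[of s a b] by simp
    moreover have "t \<otimes> a = \<zero>" using y ab a b m_assoc[of t b a] by simp
    ultimately show "(case y of (s, t) \<Rightarrow> s \<oplus> t) \<in> carrier (corner_module R (a \<oplus> b))"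
      "((case y of (s, t) \<Rightarrow> s \<oplus> t) \<otimes> a, (case y of (s, t) \<Rightarrow> s \<oplus> t) \<otimes> b) = y"
      using y a b by (simp_all add: l_distr r_distr)
  qed (use a b in \<open>auto simp: r_distr\<close>)
  then show ?thesis
    by (intro K0_class_sum fg_projective_corner a b c infinite_type)
qed

context su2
begin

section \<open>The modules over the quantum weighted projective line\<close>

abbreviation "R \<equiv> CWP q l"
abbreviation "M \<equiv> degree_module q l"

lemma R_simps [simp]:
  "carrier R = degree_closure 0" "mult R = (o\<^sub>L)" "one R = id_blinfun" "zero R = 0" "add R = (+)"
  by (simp_all add: CWP_def degree_closure_def degree_ops_def)

lemma M_simps [simp]:
  "carrier (M i) = degree_closure i" "zero (M i) = 0" "add (M i) = (+)" "smult (M i) = (o\<^sub>L)"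
  by (simp_all add: degree_module_def degree_closure_def degree_ops_def)

lemma degree_closure_mult_0: "U \<in> degree_closure 0 \<Longrightarrow> T \<in> degree_closure i \<Longrightarrow> U o\<^sub>L T \<in> degree_closure i"
  using degree_closure_mult[of U 0 T i] by simp

lemma id_compose [simp]: "id_blinfun o\<^sub>L (T :: operator) = T" "T o\<^sub>L id_blinfun = T"
  by (auto intro: blinfun_eqI)

lemma zero_compose [simp]: "(0 :: operator) o\<^sub>L T = 0" "T o\<^sub>L (0 :: operator) = 0"
  by (auto intro: blinfun_eqI)

lemma uminus_compose: "(- T :: operator) o\<^sub>L U = - (T o\<^sub>L U)"
  by (rule blinfun_eqI) (simp add: uminus_blinfun.rep_eq)

lemma ring_R: "ring R"
proof (intro ringI abelian_groupI monoidI)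
  fix T assume "T \<in> carrier R"
  then show "\<exists>U\<in>carrier R. U \<oplus>\<^bsub>R\<^esub> T = \<zero>\<^bsub>R\<^esub>"
    by (intro bexI[of _ "- T"]) (simp_all add: degree_closure_minus)
qed (simp_all add: degree_closure_add degree_closure_zero degree_closure_one degree_closure_mult_0 operator_assoc compose_add add_ac)

lemma infinite_operators: "infinite (UNIV :: operator set)"
proof
  assume fin: "finite (UNIV :: operator set)"
  have "inj scalar_op"
  proof (rule injI)
    fix c d assume "scalar_op c = scalar_op d"
    then have "ell2_coord (blinfun_apply (scalar_op c) (ket (0, 0))) (0, 0) = ell2_coord (blinfun_apply (scalar_op d) (ket (0, 0))) (0, 0)"
      by simp
    then show "c = d" by (simp add: scalar_op_apply)
  qed
  then have "finite (UNIV :: complex set)"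
    by (rule finite_imageD[OF finite_subset[OF subset_UNIV fin]])
  then show False using infinite_UNIV_char_0 by blast
qed

sublocale R: infinite_ring R
  by (intro infinite_ring.intro ring_R infinite_ring_axioms.intro infinite_operators)

lemma left_module_M: "left_module R (M i)"
  by (rule R.left_moduleI)
    (simp_all add: degree_closure_add degree_closure_zero degree_closure_one degree_closure_mult_0 operator_assoc compose_add add_ac)

lemma R_minus: "U \<in> degree_closure 0 \<Longrightarrow> T \<in> degree_closure 0 \<Longrightarrow> U \<ominus>\<^bsub>R\<^esub> T = U - T"
  using R.minus_equality[of "- T" T] by (simp add: a_minus_def degree_closure_minus)

lemma finsum_operators:
  fixes P :: "('c, operator, 'd) module_scheme"
  assumes "abelian_monoid P" "add P = (+)" "zero P = 0" "finite K" "\<And>k. k \<in> K \<Longrightarrow> f k \<in> carrier P"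
  shows "(\<Oplus>\<^bsub>P\<^esub>k\<in>K. f k) = (\<Sum>k\<in>K. f k)"
  using assms(4,5)
proof (induction K)
  case empty
  then show ?case using abelian_monoid.finsum_empty[OF assms(1)] assms(3) by simp
next
  case (insert k K)
  then show ?case
    using abelian_monoid.finsum_insert[OF assms(1), of K k f] assms(2) by (simp add: Pi_iff)
qed

text \<open>The hypothesis is strong gradedness in degree \<open>i\<close>: multiplication by the \<open>x k\<close> moves \<open>C\<^sub>i\<close> into the algebra, and the
  \<open>y k\<close> recover the element.\<close>

lemma degree_dual_basis:
  assumes "finite K" "\<And>k. k \<in> K \<Longrightarrow> x k \<in> degree_closure (- i)" "\<And>k. k \<in> K \<Longrightarrow> y k \<in> degree_closure i"
    and one: "(\<Sum>k\<in>K. x k o\<^sub>L y k) = id_blinfun"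
  shows "fg_projective R (M i)"
proof -
  interpret M: left_module R "M i" by (rule left_module_M)
  have TC: "T o\<^sub>L x k \<in> degree_closure 0" if "k \<in> K" "T \<in> degree_closure i" for T k
    using degree_closure_mult[OF that(2) assms(2)[OF that(1)]] by simp
  have "dual_basis R (M i) K y (\<lambda>k T. T o\<^sub>L x k)"
    unfolding dual_basis_def
  proof (intro conjI ballI)
    show "functional R (M i) (\<lambda>T. T o\<^sub>L x k)" if "k \<in> K" for k
      using TC[OF that] by (intro left_linearI) (simp_all add: compose_add operator_assoc)
    fix T assume T: "T \<in> carrier (M i)"
    have "(\<Oplus>\<^bsub>M i\<^esub>k\<in>K. (T o\<^sub>L x k) \<odot>\<^bsub>M i\<^esub> y k) = (\<Sum>k\<in>K. T o\<^sub>L x k o\<^sub>L y k)"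
      using T TC assms(1,3)
      by (subst finsum_operators[OF M.M.abelian_monoid_axioms]) (simp_all add: degree_closure_mult_0)
    also have "\<dots> = (\<Sum>k\<in>K. T o\<^sub>L (x k o\<^sub>L y k))" by (simp only: operator_assoc)
    also have "\<dots> = T o\<^sub>L (\<Sum>k\<in>K. x k o\<^sub>L y k)"
      using assms(1) by (induction K) (simp_all add: compose_add)
    also have "\<dots> = T" using one by simp
    finally show "T = (\<Oplus>\<^bsub>M i\<^esub>k\<in>K. (T o\<^sub>L x k) \<odot>\<^bsub>M i\<^esub> y k)" by simp
  qed (use assms in auto)
  then show ?thesis
    by (rule fg_projectiveI[OF left_module_M _ infinite_operators])
qed

lemma fg_projective_M: "fg_projective R (M i)"
proof (cases "i \<le> 0")
  case True
  then have i: "- i = int (nat (- i))" "i = - int (nat (- i))" by simp_all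
  show ?thesis
    by (rule degree_dual_basis[of "{0 :: nat}" "\<lambda>_. shift i" i "\<lambda>_. shift (- i)"])
      (use shift_in_closure[of i] shift_in_closure[of "- i"] shift_shift(1)[of "nat (- i)"] i in simp_all)
next
  case False
  define j where "j = nat i"
  have i: "i = int j" using False by (simp add: j_def)
  \<comment> \<open>Raising the level by \<open>m\<close> and shifting the first factor by \<open>j\<close> changes the degree by \<open>l j - m = j\<close>.\<close>
  define m where "m = (l - 1) * j"
  have m: "int m = (int l - 1) * int j" using l_pos by (simp add: m_def of_nat_diff)
  define x where "x k = (if k < j then matrix_unit (- i) k (k + m) else shift i)" for k
  define y where "y k = (if k < j then matrix_unit i (k + m) k else shift (- i))" for k
  show ?thesis
  proof (rule degree_dual_basis[of "{..j}" x i y])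
    show "x k \<in> degree_closure (- i)" for k
      using matrix_unit_in_closure[of "- i" k "k + m"] shift_in_closure[of i] by (simp add: x_def i m algebra_simps)
    show "y k \<in> degree_closure i" for k
      using matrix_unit_in_closure[of i "k + m" k] shift_in_closure[of "- i"] by (simp add: y_def i m algebra_simps)
    have "(\<Sum>k\<in>{..j}. x k o\<^sub>L y k) = (\<Sum>k<j. x k o\<^sub>L y k) + (x j o\<^sub>L y j)"
      by (simp add: lessThan_Suc_atMost[symmetric])
    also have "(\<Sum>k<j. x k o\<^sub>L y k) = (\<Sum>k<j. level k)"
      by (rule sum.cong) (simp_all add: x_def y_def matrix_unit_mult level_matrix_unit)
    also have "x j o\<^sub>L y j = above j" by (simp add: x_def y_def i shift_shift)
    finally show "(\<Sum>k\<in>{..j}. x k o\<^sub>L y k) = id_blinfun"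
      using above_level[of j] by (simp add: add.commute)
  qed simp
qed

lemma above_idem: "above j o\<^sub>L above j = above j"
  by (simp add: above_above)

lemma above_Suc_level: "above (Suc n) + level n = above n"
  "above (Suc n) o\<^sub>L level n = 0" "level n o\<^sub>L above (Suc n) = 0"
proof -
  show "above (Suc n) + level n = above n"
    unfolding above_def level_def wshift_add[OF bounded_indicator(1) bounded_unit_weight]
    by (rule wshift_eqI) (auto simp: unit_weight_def)
  show "above (Suc n) o\<^sub>L level n = 0" "level n o\<^sub>L above (Suc n) = 0"
    unfolding above_def level_def wshift_compose[OF bounded_indicator(1) bounded_unit_weight]
      wshift_compose[OF bounded_unit_weight bounded_indicator(1)] wshift_zero[of 0 0, symmetric]
    by (rule wshift_eqI; auto simp: shift_mult_def unit_weight_def)+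
qed

text \<open>Right multiplication by \<open>S\<^sup>*\<^sup>j\<close> has the inverse \<open>r \<mapsto> r S\<^sup>j\<close>, because \<open>S\<^sup>*\<^sup>j S\<^sup>j = 1\<close> and
  \<open>S\<^sup>j S\<^sup>*\<^sup>j = above j\<close>.\<close>

lemma K0_class_above: "K0_class R (M (- int j)) = K0_class R (corner_module R (above j))"
proof (rule R.K0_class_iso[OF fg_projective_M])
  show "fg_projective R (corner_module R (above j))"
    by (rule R.fg_projective_corner) (simp_all add: above_in_closure above_idem)
  have TC: "T o\<^sub>L shift (- int j) \<in> degree_closure 0" if "T \<in> degree_closure (- int j)" for T
    using degree_closure_mult[OF that shift_in_closure[of "- int j"]] by simp
  have TC': "T o\<^sub>L shift (int j) \<in> degree_closure (- int j)" if "T \<in> degree_closure 0" for T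
    using degree_closure_mult[OF that shift_in_closure[of "int j"]] by simp
  have sa: "shift (- int j) o\<^sub>L above j = shift (- int j)"
    by (simp add: shift_shift(2)[symmetric] operator_assoc[symmetric] shift_shift(1))
  show "module_iso R (M (- int j)) (corner_module R (above j))"
    by (rule module_isoI_inverse[where f = "\<lambda>T. T o\<^sub>L shift (- int j)" and g = "\<lambda>T. T o\<^sub>L shift (int j)"], rule left_linearI)
      (auto simp: TC TC' operator_assoc sa shift_shift compose_add)
qed

text \<open>Under the identification of the algebra with operators on a sum of \<open>l\<close> copies of \<open>l\<^sup>2(\<nat>)\<close>, these are the compact operators.\<close>

definition compact_part :: "operator set" where
  "compact_part = {T \<in> degree_closure 0. \<forall>e>0. \<exists>j. norm (T o\<^sub>L above j) < e}"

lemma compact_part_ideal: "ideal compact_part R"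
proof (rule idealI[OF ring_R])
  show "subgroup compact_part (add_monoid R)"
  proof (rule R.add.subgroupI)
    show "compact_part \<subseteq> carrier R" by (auto simp: compact_part_def)
    have "0 \<in> compact_part" by (simp add: compact_part_def degree_closure_zero)
    then show "compact_part \<noteq> {}" by blast
    fix T assume T: "T \<in> compact_part"
    then have TC: "T \<in> degree_closure 0" by (simp add: compact_part_def)
    have "\<ominus>\<^bsub>R\<^esub> T = - T" using TC by (intro R.minus_equality) (simp_all add: degree_closure_minus)
    moreover have "(- T) o\<^sub>L above j = - (T o\<^sub>L above j)" for j
      by (rule blinfun_eqI) (simp add: uminus_blinfun.rep_eq)
    ultimately show "\<ominus>\<^bsub>R\<^esub> T \<in> compact_part" using T by (simp add: compact_part_def degree_closure_minus)
    fix U assume U: "U \<in> compact_part"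
    have "\<exists>j. norm ((T + U) o\<^sub>L above j) < e" if "e > 0" for e
    proof -
      have e2: "e / 2 > 0" using that by simp
      obtain i where i: "norm (T o\<^sub>L above i) < e / 2" using T e2 unfolding compact_part_def by blast
      obtain j where j: "norm (U o\<^sub>L above j) < e / 2" using U e2 unfolding compact_part_def by blast
      have "norm ((T + U) o\<^sub>L above (max i j)) \<le> norm (T o\<^sub>L above (max i j)) + norm (U o\<^sub>L above (max i j))"
        unfolding compose_add by (rule norm_triangle_ineq)
      also have "\<dots> < e"
        using i j above_mono[of i "max i j" T] above_mono[of j "max i j" U] by simp
      finally show ?thesis by blast
    qed
    then show "T \<oplus>\<^bsub>R\<^esub> U \<in> compact_part" using T U by (simp add: compact_part_def degree_closure_add)
  qed
  fix T U assume T: "T \<in> compact_part" and U: "U \<in> carrier R"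
  then have TC: "T \<in> degree_closure 0" "U \<in> degree_closure 0" by (simp_all add: compact_part_def)
  have "\<exists>j. norm (U o\<^sub>L T o\<^sub>L above j) < e" if "e > 0" for e
  proof -
    have n: "0 < norm U + 1" by (rule add_nonneg_pos) simp_all
    then have "e / (norm U + 1) > 0" using that by simp
    then obtain j where j: "norm (T o\<^sub>L above j) < e / (norm U + 1)" using T unfolding compact_part_def by blast
    have "norm (U o\<^sub>L T o\<^sub>L above j) \<le> norm U * norm (T o\<^sub>L above j)"
      unfolding operator_assoc by (rule norm_blinfun_compose)
    also have "\<dots> \<le> (norm U + 1) * norm (T o\<^sub>L above j)" by (rule mult_right_mono) simp_all
    also have "\<dots> < e" using j n by (simp add: pos_less_divide_eq mult.commute)
    finally show ?thesis by blast
  qed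
  then show "U \<otimes>\<^bsub>R\<^esub> T \<in> compact_part" using TC by (simp add: compact_part_def degree_closure_mult_0)
  have "\<exists>j. norm (T o\<^sub>L U o\<^sub>L above j) < e" if "e > 0" for e
  proof -
    have nU: "0 < norm U + 1" and nT: "0 < norm T + 1" by (rule add_nonneg_pos; simp)+
    then have pos: "e / 2 / (norm U + 1) > 0" "e / 2 / (norm T + 1) > 0" using that by simp_all
    obtain i where i: "norm (T o\<^sub>L above i) < e / 2 / (norm U + 1)" using T pos(1) unfolding compact_part_def by blast
    obtain j where j: "norm (below i o\<^sub>L U o\<^sub>L above j) < e / 2 / (norm T + 1)"
      using below_above_small[OF TC(2) pos(2)] by blast
    have "T o\<^sub>L U o\<^sub>L above j = T o\<^sub>L (above i + below i) o\<^sub>L U o\<^sub>L above j"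
      by (simp add: above_below)
    also have "\<dots> = (T o\<^sub>L above i o\<^sub>L (U o\<^sub>L above j)) + (T o\<^sub>L (below i o\<^sub>L U o\<^sub>L above j))"
      by (simp add: compose_add operator_assoc)
    finally have "norm (T o\<^sub>L U o\<^sub>L above j)
        \<le> norm (T o\<^sub>L above i o\<^sub>L (U o\<^sub>L above j)) + norm (T o\<^sub>L (below i o\<^sub>L U o\<^sub>L above j))"
      by (simp add: norm_triangle_ineq)
    also have "\<dots> \<le> norm (T o\<^sub>L above i) * (norm U + 1) + (norm T + 1) * norm (below i o\<^sub>L U o\<^sub>L above j)"
    proof (rule add_mono)
      show "norm (T o\<^sub>L above i o\<^sub>L (U o\<^sub>L above j)) \<le> norm (T o\<^sub>L above i) * (norm U + 1)"
        by (rule order.trans[OF norm_blinfun_compose mult_left_mono])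
          (use norm_compose_le1[OF norm_above_le, of U j] in auto)
      show "norm (T o\<^sub>L (below i o\<^sub>L U o\<^sub>L above j)) \<le> (norm T + 1) * norm (below i o\<^sub>L U o\<^sub>L above j)"
        by (intro order.trans[OF norm_blinfun_compose] mult_right_mono) auto
    qed
    also have "\<dots> < e / 2 + e / 2"
      using i j unfolding pos_less_divide_eq[OF nU] pos_less_divide_eq[OF nT] mult.commute[of "norm T + 1"]
      by (rule add_strict_mono)
    finally show ?thesis by auto
  qed
  then show "T \<otimes>\<^bsub>R\<^esub> U \<in> compact_part" using TC by (simp add: compact_part_def degree_closure_mult_0)
qed

lemma level_in_compact_part: "level n \<in> compact_part"
proof -
  have "level n o\<^sub>L above (Suc n) = 0" by (rule above_Suc_level)
  then show ?thesis using level_in_closure by (auto simp: compact_part_def intro!: exI[of _ "Suc n"])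
qed

text \<open>If \<open>r\<close> is the scalar \<open>c \<noteq> 0\<close> plus an operator that is small on the levels above \<open>j\<close>, then the compression of \<open>r\<close> to
  these levels is \<open>c (1 - x)\<close> with \<open>x\<close> of norm less than \<open>1\<close>.\<close>

lemma invertible_mod_compacts:
  assumes r: "r \<in> degree_closure 0" "r \<notin> compact_part"
  shows "\<exists>j. \<exists>z\<in>degree_closure 0. above j o\<^sub>L r o\<^sub>L z = above j"
proof -
  obtain c where c: "nearly_scalar r c" using r(1) by (rule nearly_scalar_closure) (rule that)
  have c0: "c \<noteq> 0"
  proof
    assume "c = 0"
    then have "r \<in> compact_part" using c r(1) by (simp add: nearly_scalar_def compact_part_def wshift_zero)
    then show False using r(2) by simp
  qed
  then have "cmod c > 0" by simp
  then obtain j where j: "norm ((r - scalar_op c) o\<^sub>L above j) < cmod c"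
    using c unfolding nearly_scalar_def by blast
  define x where "x = scalar_op (- 1 / c) o\<^sub>L (above j o\<^sub>L ((r - scalar_op c) o\<^sub>L above j))"
  have xC: "x \<in> degree_closure 0"
    unfolding x_def by (intro degree_closure_scalar degree_closure_mult_0 above_in_closure degree_closure_diff r degree_closure_scalar_op)
  have "norm x \<le> norm (scalar_op (- 1 / c)) * norm (above j o\<^sub>L ((r - scalar_op c) o\<^sub>L above j))"
    unfolding x_def by (rule norm_blinfun_compose)
  also have "\<dots> \<le> (1 / cmod c) * norm ((r - scalar_op c) o\<^sub>L above j)"
    using norm_scalar_op[of "- 1 / c"] norm_compose_le2[OF norm_above_le, of j "(r - scalar_op c) o\<^sub>L above j"]
    by (intro mult_mono) (simp_all add: norm_divide)
  also have "\<dots> < 1" using j c0 by (simp add: divide_less_eq)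
  finally have "norm x < 1" .
  then obtain w where w: "w \<in> degree_closure 0" "(id_blinfun - x) o\<^sub>L w = id_blinfun"
    using Neumann(1)[OF xC] by blast
  have comm: "above j o\<^sub>L scalar_op d = scalar_op d o\<^sub>L above j" for d
    by (rule scalar_op_commute) (simp add: above_def clinear_wshift)
  have corner: "above j o\<^sub>L r o\<^sub>L above j = scalar_op c o\<^sub>L (above j o\<^sub>L (id_blinfun - x))"
  proof -
    have "above j o\<^sub>L x = x"
      unfolding x_def operator_assoc[symmetric] comm by (simp add: operator_assoc) (simp add: operator_assoc[symmetric] above_idem)
    then have "scalar_op c o\<^sub>L (above j o\<^sub>L (id_blinfun - x)) = (scalar_op c o\<^sub>L above j) - (scalar_op c o\<^sub>L x)"
      by (simp add: compose_diff)
    also have "scalar_op c o\<^sub>L x = - (above j o\<^sub>L ((r - scalar_op c) o\<^sub>L above j))"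
      unfolding x_def operator_assoc[symmetric] scalar_op_mult[symmetric] using c0
      by (simp add: operator_assoc scalar_op_minus_one uminus_compose)
    also have "(scalar_op c o\<^sub>L above j) - - (above j o\<^sub>L ((r - scalar_op c) o\<^sub>L above j)) = above j o\<^sub>L r o\<^sub>L above j"
      by (simp add: compose_diff operator_assoc[symmetric] comm) (simp add: operator_assoc above_idem)
    finally show ?thesis by simp
  qed
  have "above j o\<^sub>L r o\<^sub>L (above j o\<^sub>L w) = above j o\<^sub>L r o\<^sub>L above j o\<^sub>L w"
    by (simp only: operator_assoc)
  also have "\<dots> = scalar_op c o\<^sub>L (above j o\<^sub>L ((id_blinfun - x) o\<^sub>L w))"
    unfolding corner by (simp only: operator_assoc)
  also have "\<dots> = scalar_op c o\<^sub>L above j" using w(2) by simp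
  finally have eq: "above j o\<^sub>L r o\<^sub>L (above j o\<^sub>L w) = scalar_op c o\<^sub>L above j" .
  let ?z = "above j o\<^sub>L w o\<^sub>L scalar_op (1 / c)"
  have "above j o\<^sub>L r o\<^sub>L ?z = above j o\<^sub>L r o\<^sub>L (above j o\<^sub>L w) o\<^sub>L scalar_op (1 / c)"
    by (simp only: operator_assoc)
  also have "\<dots> = scalar_op c o\<^sub>L above j o\<^sub>L scalar_op (1 / c)"
    unfolding eq ..
  also have "\<dots> = above j"
    using c0 by (simp add: comm operator_assoc) (simp add: operator_assoc[symmetric] scalar_op_mult[symmetric] wshift_one)
  finally show ?thesis
    using degree_closure_mult_0[OF degree_closure_mult_0[OF above_in_closure w(1)] degree_closure_scalar_op] by blast
qed

lemma invertible_above: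
  assumes s: "s \<in> compact_part"
  shows "\<exists>j. \<exists>t\<in>degree_closure 0. t o\<^sub>L (id_blinfun - (s o\<^sub>L above j)) = id_blinfun"
proof -
  obtain j where j: "norm (s o\<^sub>L above j) < 1" using s zero_less_one unfolding compact_part_def by blast
  have "s o\<^sub>L above j \<in> degree_closure 0" using s by (simp add: compact_part_def degree_closure_mult_0 above_in_closure)
  from Neumann(2)[OF this j] show ?thesis by blast
qed

text \<open>A non-zero row has a non-zero entry because its tail is small, and that entry is a non-zero multiple of a matrix
  unit, which is inverted by the opposite matrix unit.\<close>

lemma level_minimal:
  assumes r: "r \<in> degree_closure 0" "level n o\<^sub>L r \<noteq> 0"
  shows "\<exists>z\<in>degree_closure 0. level n o\<^sub>L r o\<^sub>L z = level n"
proof -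
  have "\<exists>m. level n o\<^sub>L r o\<^sub>L level m \<noteq> 0"
  proof (rule ccontr)
    assume *: "\<not> (\<exists>m. level n o\<^sub>L r o\<^sub>L level m \<noteq> 0)"
    have tail: "level n o\<^sub>L r o\<^sub>L above j = level n o\<^sub>L r" for j
    proof -
      have "level n o\<^sub>L r o\<^sub>L (\<Sum>m\<in>N. level m) = 0" if "finite N" for N
        using that by (induction N) (use * in \<open>simp_all add: compose_add\<close>)
      then have "level n o\<^sub>L r o\<^sub>L (above j + (\<Sum>m<j. level m)) = level n o\<^sub>L r o\<^sub>L above j"
        by (simp add: compose_add)
      then show ?thesis by (simp add: above_level)
    qed
    have "norm (level n o\<^sub>L r) \<le> 0"
    proof (rule field_le_epsilon)
      fix e :: real assume "e > 0"
      then obtain j where j: "norm (below (Suc n) o\<^sub>L r o\<^sub>L above j) < e"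
        using below_above_small[OF r(1)] by blast
      have "level n o\<^sub>L r = level n o\<^sub>L (below (Suc n) o\<^sub>L r o\<^sub>L above j)"
        using tail[of j] by (simp add: operator_assoc[symmetric] level_below)
      also have "norm \<dots> \<le> norm (below (Suc n) o\<^sub>L r o\<^sub>L above j)" by (rule norm_compose_le2[OF norm_level_le])
      finally show "norm (level n o\<^sub>L r) \<le> 0 + e" using j by simp
    qed
    then show False using r(2) by simp
  qed
  then obtain m where m: "level n o\<^sub>L r o\<^sub>L level m \<noteq> 0" by blast
  obtain c a where ca: "level n o\<^sub>L r o\<^sub>L level m = scalar_op c o\<^sub>L matrix_unit a n m" "c \<noteq> 0 \<longrightarrow> int l * a = int n - int m"
    using level_corner[OF r(1)] by blast
  have c: "c \<noteq> 0" using m ca(1) by (auto simp: wshift_zero)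
  have "matrix_unit (- a) m n \<in> degree_closure 0" using matrix_unit_in_closure[of "- a" m n] ca(2) c by simp
  then have zC: "matrix_unit (- a) m n o\<^sub>L scalar_op (1 / c) \<in> degree_closure 0" by (intro degree_closure_mult_0 degree_closure_scalar_op)
  have "level m o\<^sub>L matrix_unit (- a) m n = matrix_unit (- a) m n"
    using matrix_unit_mult[of 0 m m "- a" n] by (simp add: level_matrix_unit)
  then have "level n o\<^sub>L r o\<^sub>L (matrix_unit (- a) m n o\<^sub>L scalar_op (1 / c))
      = level n o\<^sub>L r o\<^sub>L (level m o\<^sub>L matrix_unit (- a) m n o\<^sub>L scalar_op (1 / c))"
    by simp
  also have "\<dots> = level n o\<^sub>L r o\<^sub>L level m o\<^sub>L matrix_unit (- a) m n o\<^sub>L scalar_op (1 / c)"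
    by (simp only: operator_assoc)
  also have "\<dots> = scalar_op c o\<^sub>L level n o\<^sub>L scalar_op (1 / c)"
  proof -
    have "matrix_unit a n m o\<^sub>L matrix_unit (- a) m n = level n"
      by (simp add: matrix_unit_mult level_matrix_unit)
    then have "scalar_op c o\<^sub>L (matrix_unit a n m o\<^sub>L matrix_unit (- a) m n) o\<^sub>L scalar_op (1 / c)
        = scalar_op c o\<^sub>L level n o\<^sub>L scalar_op (1 / c)" by simp
    then show ?thesis unfolding ca(1) by (simp only: operator_assoc)
  qed
  also have "\<dots> = level n"
  proof -
    have "level n o\<^sub>L scalar_op (1 / c) = scalar_op (1 / c) o\<^sub>L level n"
      by (rule scalar_op_commute) (simp add: level_def clinear_wshift)
    then show ?thesis
      using c by (simp add: operator_assoc) (simp add: operator_assoc[symmetric] scalar_op_mult[symmetric] wshift_one)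
  qed
  finally show ?thesis using zC by blast
qed

lemma compact_extension_R: "compact_extension R compact_part above level"
proof (intro compact_extension.intro compact_extension_axioms.intro R.infinite_ring_axioms compact_part_ideal)
  show "above j \<oplus>\<^bsub>R\<^esub> (\<Oplus>\<^bsub>R\<^esub>n\<in>{..<j}. level n) = \<one>\<^bsub>R\<^esub>" for j
  proof -
    have "(\<Oplus>\<^bsub>R\<^esub>n\<in>K. level n) = (\<Sum>n\<in>K. level n)" if "finite K" for K
      using that by (induction K) (simp_all add: level_in_closure Pi_iff)
    then show ?thesis by (simp add: above_level)
  qed
  show "\<exists>j. \<exists>t\<in>carrier R. t \<otimes>\<^bsub>R\<^esub> (\<one>\<^bsub>R\<^esub> \<ominus>\<^bsub>R\<^esub> s \<otimes>\<^bsub>R\<^esub> above j) = \<one>\<^bsub>R\<^esub>" if "s \<in> compact_part" for s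
    using invertible_above[OF that] that degree_closure_mult_0[OF _ above_in_closure] by (simp add: R_minus degree_closure_one compact_part_def)
qed (simp_all add: above_in_closure above_idem level_in_closure level_level level_in_compact_part invertible_mod_compacts level_minimal)

end

theorem mainTheorem4:
  fixes q :: real and l :: nat
  assumes "0 < q" and "q < 1" and "l \<ge> 1"
  shows "(\<forall>i :: int. fg_projective (CWP q l) (degree_module q l i)) \<and>
    (\<forall>x \<in> carrier (K0 (CWP q l)). \<exists>(I :: int set) (c :: int \<Rightarrow> int). finite I \<and>
       x = (\<Otimes>\<^bsub>K0 (CWP q l)\<^esub>i\<in>I.
              K0_class (CWP q l) (degree_module q l i) [^]\<^bsub>K0 (CWP q l)\<^esub> c i))"
proof -
  interpret su2 q l using assms by unfold_locales
  interpret compact_extension R compact_part above level by (rule compact_extension_R)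
  let ?H = "{x. \<exists>I (c :: int \<Rightarrow> int). finite I \<and> x = (\<Otimes>\<^bsub>K0 R\<^esub>i\<in>I. K0_class R (M i) [^]\<^bsub>K0 R\<^esub> c i)}"
  have M_closed: "K0_class R (M i) \<in> carrier (K0 R)" for i
    by (rule R.K0_class_closed[OF fg_projective_M])
  have H: "subgroup ?H (K0 R)"
    by (rule R.K.subgroup_int_combinations[OF M_closed])
  have M_H: "K0_class R (M i) \<in> ?H" for i
    using M_closed by (intro CollectI exI[of _ "{i}"] exI[of _ "\<lambda>_. 1"]) (simp add: R.K.int_pow_1)
  have p_H: "K0_class R (corner_module R (above j)) \<in> ?H" for j
    using M_H[of "- int j"] unfolding K0_class_above .
  have e_H: "K0_class R (corner_module R (level n)) \<in> ?H" for n
  proof -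
    let ?p = "\<lambda>j. K0_class R (corner_module R (above j))" and ?e = "K0_class R (corner_module R (level n))"
    have "?p n = ?p (Suc n) \<otimes>\<^bsub>K0 R\<^esub> ?e"
      using R.K0_class_corner_sum[of "above (Suc n)" "level n"]
      by (simp add: above_in_closure level_in_closure above_idem level_level above_Suc_level)
    moreover have "?p n \<in> carrier (K0 R)" "?p (Suc n) \<in> carrier (K0 R)" "?e \<in> carrier (K0 R)"
      by (intro R.K0_class_closed R.fg_projective_corner; simp add: above_in_closure above_idem level_in_closure level_level)+
    ultimately have "?e = inv\<^bsub>K0 R\<^esub> ?p (Suc n) \<otimes>\<^bsub>K0 R\<^esub> ?p n"
      by (simp add: R.K.m_assoc[symmetric])
    then show ?thesis
      using subgroup.m_closed[OF H subgroup.m_inv_closed[OF H p_H] p_H] by simp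
  qed
  have "x \<in> ?H" if x: "x \<in> carrier (K0 R)" for x
  proof -
    obtain N N' :: "(operator, nat \<Rightarrow> operator) module"
      where N: "fg_projective R N" "fg_projective R N'" "x = K0_class R N \<otimes>\<^bsub>K0 R\<^esub> inv\<^bsub>K0 R\<^esub> K0_class R N'"
      using x by (rule R.K0_carrierE)
    show ?thesis
      unfolding N(3)
      by (intro subgroup.m_closed[OF H] subgroup.m_inv_closed[OF H]
          K0_class_in_subgroup[OF H p_H e_H R.infinite_fun] N(1,2))
  qed
  then show ?thesis using fg_projective_M by blast
qed

end
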